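(* For each $n\ge1$ let $\boldsymbol M_n$ be a uniform random meandric system of size $n$, and let $\boldsymbol i_n$ be a uniform random element of $\{0,\dots,2n-1\}$ independent of $\boldsymbol M_n$. Then $\boldsymbol M_n$ converges in the quenched Benjamini–Schramm sense to the law of the infinite noodle $(\boldsymbol M_\infty,0)$, i.e. for any bounded continuous function $F:(\mathbb M_{part},d)\to\mathbb R_+$, $$\mathbb E\big[F(\boldsymbol M_n,\boldsymbol i_n)\,\big|\,\boldsymbol M_n\big]\ \longrightarrow\ \mathbb E\big[F(\boldsymbol M_\infty,0)\big]\quad\text{in probability as } n\to\infty.$$
   Context: Meandric systems: a meandric system of size $n$ is an ordered pair of non-crossing matchings of $\{0,\dots,2n-1\}$ (partitions into pairs with no two pairs $\{i,k\},\{j,\ell\}$, $i<j<k<\ell$), the upper and the lower one. Partial matchings: for an integer interval $A$ (finite or infinite), a partial matching on $A$ is a partition of $A$ into pairs and singletons, each singleton being decorated with $L$ or $R$. It is non-crossing if it contains none of: two pairs $\{i,k\},\{j,\ell\}$ with $i<j<k<\ell$; a pair $\{i,k\}$ and a singleton $\{j\}$ with $i<j<k$; two singletons $\{i\},\{j\}$ with $i<j$, $i$ decorated $L$ and $j$ decorated $R$. A partial meandric system on $A$ is an ordered pair (upper, lower) of non-crossing partial matchings on $A$. A meandric system of size $n$ is viewed as a partial meandric system on $\{0,\dots,2n-1\}$ without singletons. Restriction: for a subinterval $B\subseteq A$ and a partial matching $P$ on $A$, $P/B$ is the partial matching on $B$ keeping the pairs of $P$ contained in $B$ and the (decorated) singletons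 of $P$ in $B$, and where each $i\in B$ paired in $P$ with $i'\notin B$ becomes a singleton decorated $L$ if $i'>i$ and $R$ if $i'<i$. For a partial meandric system $M$, $M/B$ is obtained by restricting both partial matchings; $M/[r-k;r+k]$ means the restriction to $[r-k,r+k]\cap A$. Topology: $\mathbb M_{part}$ is the set of marked partial meandric systems $(M,r)$, $M$ a partial meandric system on some integer interval $A$ and $r\in A$. Two are equivalent ($\equiv$) if they differ by a shift (of the domain and the marked point simultaneously); elements of $\mathbb M_{part}$ are considered up to equivalence. The distance is $$d\big((M_1,r_1),(M_2,r_2)\big)=\frac{1}{1+\max\{k: M_1/[r_1-k;r_1+k]\equiv M_2/[r_2-k;r_2+k]\}},$$ where the restrictions are marked at $r_1$, $r_2$ respectively, with the convention that it is $0$ if $(M_1,r_1)\equiv(M_2,r_2)$ and $1$ if the restrictions to $\{r_1\}$ and $\{r_2\}$ already differ. Infinite noodle: let $(a_i)_{i\in\mathbb Z}$, $(b_i)_{i\in\mathbb Z}$ be two independent sequences of i.i.d. uniform random variables in $\{L,R\}$. Almost surely there is a unique non-crossing partition of $\mathbb Z$ into pairs such that, for all $i$, $i$ is the smaller element of its pair iff $a_i=L$ (the upper matching), and similarly one for $(b_i)$ (the lower matching). $\boldsymbol M_\infty$ is the random (partial) meandric system on $\mathbb Z$ formed by these two matchings. *)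

theory Defs
  imports "HOL-Probability.Probability"
begin

datatype side = L | R

text \<open>A partial matching lists its blocks (pairs and singletons) and the decorations of its
  singletons; the domain of \<^term>\<open>deco\<close> is required to be exactly the set of singletons, so that
  equality of records is equality of decorated partial matchings.\<close>

record matching =
  blocks :: "int set set"
  deco :: "int \<Rightarrow> side option"

definition int_interval :: "int set \<Rightarrow> bool" where
  "int_interval A \<longleftrightarrow> (\<forall>x\<in>A. \<forall>y\<in>A. {x..y} \<subseteq> A)"

definition partial_matching :: "int set \<Rightarrow> matching \<Rightarrow> bool" where
  "partial_matching A P \<longleftrightarrow>
     partition_on A (blocks P) \<and> (\<forall>b\<in>blocks P. card b = 1 \<or> card b = 2) \<and>
     dom (deco P) = {i. {i} \<in> blocks P}"

definition noncrossing :: "matching \<Rightarrow> bool" where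
  "noncrossing P \<longleftrightarrow>
     \<not> (\<exists>i j k l. i < j \<and> j < k \<and> k < l \<and> {i, k} \<in> blocks P \<and> {j, l} \<in> blocks P) \<and>
     \<not> (\<exists>i j k. i < j \<and> j < k \<and> {i, k} \<in> blocks P \<and> {j} \<in> blocks P) \<and>
     \<not> (\<exists>i j. i < j \<and> deco P i = Some L \<and> deco P j = Some R)"

text \<open>The first component is the upper matching.\<close>

type_synonym system = "matching \<times> matching"

definition partial_meandric :: "int set \<Rightarrow> system \<Rightarrow> bool" where
  "partial_meandric A M \<longleftrightarrow>
     partial_matching A (fst M) \<and> noncrossing (fst M) \<and>
     partial_matching A (snd M) \<and> noncrossing (snd M)"

definition noncrossing_matching :: "int set \<Rightarrow> matching \<Rightarrow> bool" where
  "noncrossing_matching A P \<longleftrightarrow>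
     partial_matching A P \<and> noncrossing P \<and> (\<forall>b\<in>blocks P. card b = 2)"

definition meandric_systems :: "nat \<Rightarrow> system set" where
  "meandric_systems n =
     {(U, D). noncrossing_matching {0..<2 * int n} U \<and> noncrossing_matching {0..<2 * int n} D}"

definition restrict_matching :: "int set \<Rightarrow> matching \<Rightarrow> matching" where
  "restrict_matching B P =
     \<lparr> blocks = {b \<in> blocks P. b \<subseteq> B} \<union> {{i} | i. i \<in> B \<and> (\<exists>b\<in>blocks P. i \<in> b \<and> \<not> b \<subseteq> B)},
       deco = (\<lambda>i.
         if i \<notin> B then None
         else if deco P i \<noteq> None then deco P i
         else if \<exists>j. j \<notin> B \<and> {i, j} \<in> blocks P \<and> j > i then Some L
         else if \<exists>j. j \<notin> B \<and> {i, j} \<in> blocks P \<and> j < i then Some R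
         else None) \<rparr>"

definition restrict_system :: "int set \<Rightarrow> system \<Rightarrow> system" where
  "restrict_system B M = (restrict_matching B (fst M), restrict_matching B (snd M))"

text \<open>The interval underlying a system is recovered from its blocks.\<close>

definition support :: "system \<Rightarrow> int set" where
  "support M = \<Union> (blocks (fst M))"

definition window :: "system \<times> int \<Rightarrow> nat \<Rightarrow> system \<times> int" where
  "window x k =
     (restrict_system ({snd x - int k..snd x + int k} \<inter> support (fst x)) (fst x), snd x)"

definition shift_matching :: "int \<Rightarrow> matching \<Rightarrow> matching" where
  "shift_matching s P = \<lparr> blocks = (\<lambda>b. (\<lambda>i. i + s) ` b) ` blocks P, deco = (\<lambda>i. deco P (i - s)) \<rparr>"

definition shift_marked :: "int \<Rightarrow> system \<times> int \<Rightarrow> system \<times> int" where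
  "shift_marked s x =
     ((shift_matching s (fst (fst x)), shift_matching s (snd (fst x))), snd x + s)"

definition shift_equiv :: "system \<times> int \<Rightarrow> system \<times> int \<Rightarrow> bool" where
  "shift_equiv x y \<longleftrightarrow> (\<exists>s. y = shift_marked s x)"

definition marked_pms :: "system \<times> int \<Rightarrow> bool" where
  "marked_pms x \<longleftrightarrow> (\<exists>A. int_interval A \<and> partial_meandric A (fst x) \<and> snd x \<in> A)"

definition agree :: "nat \<Rightarrow> system \<times> int \<Rightarrow> system \<times> int \<Rightarrow> bool" where
  "agree k x y \<longleftrightarrow> shift_equiv (window x k) (window y k)"

definition local_dist :: "system \<times> int \<Rightarrow> system \<times> int \<Rightarrow> real" where
  "local_dist x y =
     (if shift_equiv x y then 0
      else if \<not> agree 0 x y then 1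
      else 1 / (1 + real (Max {k. agree k x y})))"

lemma shift_matching_0 [simp]: "shift_matching 0 P = P"
  by (simp add: shift_matching_def)

lemma shift_matching_shift [simp]:
  "shift_matching s (shift_matching t P) = shift_matching (s + t) P"
  by (simp add: shift_matching_def image_image algebra_simps)

lemma shift_marked_0 [simp]: "shift_marked 0 x = x"
  by (simp add: shift_marked_def)

lemma shift_marked_shift [simp]: "shift_marked s (shift_marked t x) = shift_marked (s + t) x"
  by (simp add: shift_marked_def algebra_simps)

lemma shift_equiv_refl [simp]: "shift_equiv x x"
  unfolding shift_equiv_def by (metis shift_marked_0)

lemma shift_equiv_sym: "shift_equiv x y \<Longrightarrow> shift_equiv y x"
  unfolding shift_equiv_def by (metis add.left_inverse shift_marked_0 shift_marked_shift)

lemma shift_equiv_trans: "shift_equiv x y \<Longrightarrow> shift_equiv y z \<Longrightarrow> shift_equiv x z"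
  unfolding shift_equiv_def by (metis shift_marked_shift)

lemma shift_mem_blocks:
  "(\<lambda>i. i + s) ` b \<in> blocks (shift_matching s P) \<longleftrightarrow> b \<in> blocks P" for b :: "int set"
proof -
  have "inj (\<lambda>i::int. i + s)" by simp
  then show ?thesis by (auto simp: shift_matching_def inj_image_eq_iff image_iff)
qed

lemma shift_pair_blocks: "{i, j} \<in> blocks (shift_matching s P) \<longleftrightarrow> {i - s, j - s} \<in> blocks P"
  using shift_mem_blocks[of s "{i - s, j - s}" P] by simp

lemma shift_singleton_blocks: "{i} \<in> blocks (shift_matching s P) \<longleftrightarrow> {i - s} \<in> blocks P"
  using shift_pair_blocks[of i i] by simp

lemma restrict_shift:
  "restrict_matching ((\<lambda>i. i + s) ` B) (shift_matching s P) = shift_matching s (restrict_matching B P)"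
proof (rule matching.equality)
  let ?f = "\<lambda>i::int. i + s"
  have inj: "inj ?f" by simp
  have sub: "?f ` b \<subseteq> ?f ` B \<longleftrightarrow> b \<subseteq> B" for b by (rule inj_image_subset_iff[OF inj])
  have mem: "i \<in> ?f ` B \<longleftrightarrow> i - s \<in> B" for i by (auto simp: image_iff intro!: bexI[of _ "i - s"])
  have "{b \<in> blocks (shift_matching s P). b \<subseteq> ?f ` B} = (`) ?f ` {b \<in> blocks P. b \<subseteq> B}"
    using sub by (auto simp: shift_matching_def)
  moreover have "{{i} | i. i \<in> ?f ` B \<and> (\<exists>b\<in>blocks (shift_matching s P). i \<in> b \<and> \<not> b \<subseteq> ?f ` B)} =
     (`) ?f ` {{i} | i. i \<in> B \<and> (\<exists>b\<in>blocks P. i \<in> b \<and> \<not> b \<subseteq> B)}" (is "?X = ?Y")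
  proof (intro set_eqI iffI)
    fix c assume "c \<in> ?X"
    then obtain k e where "c = {k}" "k \<in> ?f ` B" "e \<in> (`) ?f ` blocks P" "k \<in> e" "\<not> e \<subseteq> ?f ` B"
      unfolding shift_matching_def matching.simps by blast
    then obtain i b where ib: "c = {?f i}" "i \<in> B" "b \<in> blocks P" "?f i \<in> ?f ` b" "\<not> ?f ` b \<subseteq> ?f ` B"
      by blast
    then have "i \<in> b" "\<not> b \<subseteq> B" using sub by auto
    with ib have "{i} \<in> {{i} | i. i \<in> B \<and> (\<exists>b\<in>blocks P. i \<in> b \<and> \<not> b \<subseteq> B)}" by blast
    then have "?f ` {i} \<in> ?Y" by (rule imageI)
    then show "c \<in> ?Y" using ib by simp
  next
    fix c assume "c \<in> ?Y"
    then obtain i b where ib: "c = {?f i}" "i \<in> B" "b \<in> blocks P" "i \<in> b" "\<not> b \<subseteq> B" by auto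
    then have "?f ` b \<in> blocks (shift_matching s P)" "?f i \<in> ?f ` b" "\<not> ?f ` b \<subseteq> ?f ` B" "?f i \<in> ?f ` B"
      using sub shift_mem_blocks by auto
    then have "c = {?f i} \<and> ?f i \<in> ?f ` B \<and>
        (\<exists>b\<in>blocks (shift_matching s P). ?f i \<in> b \<and> \<not> b \<subseteq> ?f ` B)"
      using ib(1) by (intro conjI bexI[of _ "?f ` b"])
    then show "c \<in> ?X" by (intro CollectI) (rule exI)
  qed
  ultimately show "blocks (restrict_matching (?f ` B) (shift_matching s P)) =
      blocks (shift_matching s (restrict_matching B P))"
    by (simp add: restrict_matching_def image_Un) (simp add: shift_matching_def image_Un)
  have ex1: "(\<exists>j. j \<notin> ?f ` B \<and> {i, j} \<in> blocks (shift_matching s P) \<and> j > i) \<longleftrightarrow>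
      (\<exists>j. j \<notin> B \<and> {i - s, j} \<in> blocks P \<and> j > i - s)" (is "?l \<longleftrightarrow> ?r") for i
    unfolding mem shift_pair_blocks
  proof
    assume "\<exists>j. j - s \<notin> B \<and> {i - s, j - s} \<in> blocks P \<and> j > i"
    then obtain j where "j - s \<notin> B \<and> {i - s, j - s} \<in> blocks P \<and> j > i" ..
    then show ?r by (intro exI[of _ "j - s"]) simp
  next
    assume ?r
    then obtain j where "j \<notin> B \<and> {i - s, j} \<in> blocks P \<and> j > i - s" ..
    then show "\<exists>j. j - s \<notin> B \<and> {i - s, j - s} \<in> blocks P \<and> j > i"
      by (intro exI[of _ "j + s"]) auto
  qed
  have ex2: "(\<exists>j. j \<notin> ?f ` B \<and> {i, j} \<in> blocks (shift_matching s P) \<and> j < i) \<longleftrightarrow>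
      (\<exists>j. j \<notin> B \<and> {i - s, j} \<in> blocks P \<and> j < i - s)" (is "?l \<longleftrightarrow> ?r") for i
    unfolding mem shift_pair_blocks
  proof
    assume "\<exists>j. j - s \<notin> B \<and> {i - s, j - s} \<in> blocks P \<and> j < i"
    then obtain j where "j - s \<notin> B \<and> {i - s, j - s} \<in> blocks P \<and> j < i" ..
    then show ?r by (intro exI[of _ "j - s"]) simp
  next
    assume ?r
    then obtain j where "j \<notin> B \<and> {i - s, j} \<in> blocks P \<and> j < i - s" ..
    then show "\<exists>j. j - s \<notin> B \<and> {i - s, j - s} \<in> blocks P \<and> j < i"
      by (intro exI[of _ "j + s"]) auto
  qed
  have d: "deco (shift_matching s Q) i = deco Q (i - s)" for Q i by (simp add: shift_matching_def)
  show "deco (restrict_matching (?f ` B) (shift_matching s P)) =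
      deco (shift_matching s (restrict_matching B P))"
    unfolding fun_eq_iff d
    unfolding restrict_matching_def by (simp only: matching.simps d ex1 ex2) (simp add: mem)
qed simp

lemma support_shift: "support (fst (shift_marked s x)) = (\<lambda>i. i + s) ` support (fst x)"
  by (auto simp: support_def shift_marked_def shift_matching_def)

lemma window_shift: "window (shift_marked s x) k = shift_marked s (window x k)"
proof -
  have "{snd x + s - int k..snd x + s + int k} = (\<lambda>i. i + s) ` {snd x - int k..snd x + int k}"
    by (simp add: algebra_simps)
  then have "{snd x + s - int k..snd x + s + int k} \<inter> (\<lambda>i. i + s) ` support (fst x) =
     (\<lambda>i. i + s) ` ({snd x - int k..snd x + int k} \<inter> support (fst x))"
    by (simp add: image_Int del: image_add_atLeastAtMost')
  then show ?thesis
    unfolding window_def support_shift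
    by (simp add: shift_marked_def restrict_system_def restrict_shift)
qed

lemma window_equiv: "shift_equiv x y \<Longrightarrow> agree k x y"
  unfolding agree_def shift_equiv_def by (auto simp: window_shift)

lemma agree_sym: "agree k x y \<Longrightarrow> agree k y x"
  unfolding agree_def by (rule shift_equiv_sym)

lemma agree_trans: "agree k x y \<Longrightarrow> agree k y z \<Longrightarrow> agree k x z"
  unfolding agree_def by (rule shift_equiv_trans)

lemma partial_matching_block_unique:
  assumes "partial_matching A P" "b \<in> blocks P" "c \<in> blocks P" "i \<in> b" "i \<in> c"
  shows "b = c"
  using assms unfolding partial_matching_def partition_on_def disjoint_def by blast

lemma partial_matching_blocks_eq: "partial_matching A P \<Longrightarrow> \<Union> (blocks P) = A"
  by (auto simp: partial_matching_def partition_on_def)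

lemma support_eq: "partial_meandric A M \<Longrightarrow> support M = A"
  by (simp add: support_def partial_meandric_def partial_matching_blocks_eq)

lemma Union_blocks_restrict:
  assumes "partial_matching A P" "B \<subseteq> A"
  shows "\<Union> (blocks (restrict_matching B P)) = B"
proof
  show "\<Union> (blocks (restrict_matching B P)) \<subseteq> B" by (auto simp: restrict_matching_def)
  show "B \<subseteq> \<Union> (blocks (restrict_matching B P))"
  proof
    fix i assume i: "i \<in> B"
    then obtain b where b: "b \<in> blocks P" "i \<in> b"
      using assms partial_matching_blocks_eq by blast
    have "b \<in> blocks (restrict_matching B P) \<or> {i} \<in> blocks (restrict_matching B P)"
      using b i unfolding restrict_matching_def by auto
    then show "i \<in> \<Union> (blocks (restrict_matching B P))" using b by blast
  qed
qed

lemma restrict_restrict: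
  assumes P: "partial_matching A P" and BC: "C \<subseteq> B" "B \<subseteq> A"
  shows "restrict_matching C (restrict_matching B P) = restrict_matching C P"
proof (rule matching.equality)
  let ?Q = "restrict_matching B P"
  have bQ: "b \<in> blocks ?Q \<longleftrightarrow> b \<in> blocks P \<and> b \<subseteq> B \<or>
     (\<exists>i c. b = {i} \<and> i \<in> B \<and> c \<in> blocks P \<and> i \<in> c \<and> \<not> c \<subseteq> B)" for b
    by (auto simp: restrict_matching_def)
  have bC: "b \<in> blocks (restrict_matching C S) \<longleftrightarrow> b \<in> blocks S \<and> b \<subseteq> C \<or>
     (\<exists>i c. b = {i} \<and> i \<in> C \<and> c \<in> blocks S \<and> i \<in> c \<and> \<not> c \<subseteq> C)" for b S
    by (auto simp: restrict_matching_def)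
  show "blocks (restrict_matching C ?Q) = blocks (restrict_matching C P)"
  proof (intro set_eqI iffI)
    fix b assume "b \<in> blocks (restrict_matching C ?Q)"
    then consider "b \<in> blocks ?Q" "b \<subseteq> C"
      | i c where "b = {i}" "i \<in> C" "c \<in> blocks ?Q" "i \<in> c" "\<not> c \<subseteq> C" unfolding bC by blast
    then show "b \<in> blocks (restrict_matching C P)"
    proof cases
      case 1
      then show ?thesis unfolding bC bQ using BC by blast
    next
      case 2
      then show ?thesis unfolding bC bQ using BC by blast
    qed
  next
    fix b assume "b \<in> blocks (restrict_matching C P)"
    then consider "b \<in> blocks P" "b \<subseteq> C"
      | i c where "b = {i}" "i \<in> C" "c \<in> blocks P" "i \<in> c" "\<not> c \<subseteq> C" unfolding bC by blast
    then show "b \<in> blocks (restrict_matching C ?Q)"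
    proof cases
      case 1
      then show ?thesis unfolding bC bQ using BC by blast
    next
      case 2
      show ?thesis
      proof (cases "c \<subseteq> B")
        case True
        then show ?thesis using 2 unfolding bC bQ by blast
      next
        case False
        then have "{i} \<in> blocks ?Q" using 2 BC unfolding bQ by blast
        then show ?thesis using 2 unfolding bC by blast
      qed
    qed
  qed
  have uniq: "j = k" if "{i, j} \<in> blocks P" "{i, k} \<in> blocks P" for i j k
  proof -
    have "{i, j} = {i, k}" using partial_matching_block_unique[OF P that, of i] by simp
    then show ?thesis by (auto simp: doubleton_eq_iff)
  qed
  show "deco (restrict_matching C ?Q) = deco (restrict_matching C P)"
  proof
    fix i
    show "deco (restrict_matching C ?Q) i = deco (restrict_matching C P) i"
    proof (cases "i \<in> C \<and> deco P i = None")
      case False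
      then show ?thesis using BC by (auto simp: restrict_matching_def)
    next
      case True
      then have iB: "i \<in> B" "i \<in> C" "deco P i = None" using BC by auto
      have pr: "{i, j} \<in> blocks ?Q \<longleftrightarrow> {i, j} \<in> blocks P \<and> j \<in> B" if "j \<notin> C" for j
        unfolding bQ using iB that by (auto simp: doubleton_eq_iff)
      have dC: "deco (restrict_matching C S) i =
         (if deco S i \<noteq> None then deco S i
          else if \<exists>j. j \<notin> C \<and> {i, j} \<in> blocks S \<and> j > i then Some L
          else if \<exists>j. j \<notin> C \<and> {i, j} \<in> blocks S \<and> j < i then Some R else None)" for S
        using iB unfolding restrict_matching_def by simp
      have dQ: "deco ?Q i =
         (if \<exists>j. j \<notin> B \<and> {i, j} \<in> blocks P \<and> j > i then Some L
          else if \<exists>j. j \<notin> B \<and> {i, j} \<in> blocks P \<and> j < i then Some R else None)"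
        using iB unfolding restrict_matching_def by simp
      show ?thesis
      proof (cases "\<exists>j. j \<notin> B \<and> {i, j} \<in> blocks P")
        case True
        then obtain j where j: "j \<notin> B" "{i, j} \<in> blocks P" by blast
        then have eq: "{i, k} \<in> blocks P \<longleftrightarrow> k = j" for k using uniq by blast
        have "j \<noteq> i" "j \<notin> C" using j iB BC by auto
        then show ?thesis unfolding dC[of ?Q] dC[of P] dQ eq using j iB by auto
      next
        case False
        then have "deco ?Q i = None" unfolding dQ by auto
        moreover have "(\<exists>j. j \<notin> C \<and> {i, j} \<in> blocks ?Q \<and> p j) \<longleftrightarrow>
            (\<exists>j. j \<notin> C \<and> {i, j} \<in> blocks P \<and> p j)" for p
          using pr False by blast
        ultimately show ?thesis unfolding dC[of ?Q] dC[of P] using iB by presburger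
      qed
    qed
  qed
qed simp

lemma window_window:
  assumes x: "marked_pms x" and k: "k \<le> l"
  shows "window (window x l) k = window x k"
proof -
  obtain A where A: "partial_meandric A (fst x)" using x by (auto simp: marked_pms_def)
  define W where "W n = {snd x - int n..snd x + int n} \<inter> A" for n
  have WW: "W k \<subseteq> W l" "W l \<subseteq> A" using k by (auto simp: W_def)
  have w: "window x n = (restrict_system (W n) (fst x), snd x)" for n
    unfolding window_def support_eq[OF A] W_def ..
  have "support (restrict_system (W l) (fst x)) = W l"
    using A WW by (simp add: support_def restrict_system_def partial_meandric_def Union_blocks_restrict[of A])
  then have "window (window x l) k =
     (restrict_system ({snd x - int k..snd x + int k} \<inter> W l) (restrict_system (W l) (fst x)), snd x)"
    unfolding w by (simp add: window_def)
  also have "{snd x - int k..snd x + int k} \<inter> W l = W k" using k by (auto simp: W_def)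
  finally show ?thesis
    using A WW by (simp add: w restrict_system_def partial_meandric_def restrict_restrict[of A])
qed

lemma agree_mono:
  assumes "marked_pms x" "marked_pms y" "agree l x y" "k \<le> l"
  shows "agree k x y"
proof -
  obtain s where "window y l = shift_marked s (window x l)"
    using assms(3) by (auto simp: agree_def shift_equiv_def)
  then have "window (window y l) k = shift_marked s (window (window x l) k)"
    by (simp add: window_shift)
  then show ?thesis
    using assms by (auto simp: window_window agree_def shift_equiv_def)
qed

lemma int_interval_shift: "int_interval A \<Longrightarrow> int_interval ((\<lambda>i. i + s) ` A)"
  unfolding int_interval_def
proof (intro ballI subsetI)
  fix x y z assume A: "\<forall>x\<in>A. \<forall>y\<in>A. {x..y} \<subseteq> A"
    and "x \<in> (\<lambda>i. i + s) ` A" "y \<in> (\<lambda>i. i + s) ` A" "z \<in> {x..y}"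
  then have "x - s \<in> A" "y - s \<in> A" "z - s \<in> {x - s..y - s}" by auto
  then have "z - s \<in> A" using A by blast
  then show "z \<in> (\<lambda>i. i + s) ` A" by (auto simp: image_iff intro!: bexI[of _ "z - s"])
qed

lemma partial_matching_shift:
  assumes "partial_matching A P"
  shows "partial_matching ((\<lambda>i. i + s) ` A) (shift_matching s P)"
proof -
  let ?f = "\<lambda>i::int. i + s"
  have p: "partition_on A (blocks P)" using assms by (simp add: partial_matching_def)
  have "partition_on (?f ` A) ((`) ?f ` blocks P)"
  proof (rule partition_onI)
    show "\<Union> ((`) ?f ` blocks P) = ?f ` A" using partition_onD1[OF p] by auto
    show "disjnt b c" if "b \<in> (`) ?f ` blocks P" "c \<in> (`) ?f ` blocks P" "b \<noteq> c" for b c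
    proof -
      obtain b' c' where bc: "b = ?f ` b'" "c = ?f ` c'" "b' \<in> blocks P" "c' \<in> blocks P" "b' \<noteq> c'"
        using \<open>b \<in> _\<close> \<open>c \<in> _\<close> \<open>b \<noteq> c\<close> by blast
      then have "b' \<inter> c' = {}" using partial_matching_block_unique[OF assms] by blast
      moreover have "inj ?f" by simp
      ultimately show ?thesis unfolding disjnt_def bc by (metis image_Int image_empty)
    qed
    show "{} \<notin> (`) ?f ` blocks P"
      using partition_onD3[OF p] by auto
  qed
  moreover have "card (?f ` b) = card b" for b by (simp add: card_image)
  moreover have "dom (deco (shift_matching s P)) = {i. {i} \<in> blocks (shift_matching s P)}"
  proof -
    have "deco P i \<noteq> None \<longleftrightarrow> {i} \<in> blocks P" for i
      using assms unfolding partial_matching_def by (auto simp: dom_def)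
    then show ?thesis unfolding shift_singleton_blocks by (simp add: shift_matching_def dom_def)
  qed
  ultimately show ?thesis using assms unfolding partial_matching_def
    by (auto simp: shift_matching_def)
qed

lemma noncrossing_shift:
  assumes "noncrossing P"
  shows "noncrossing (shift_matching s P)"
proof -
  have d: "deco (shift_matching s P) i = deco P (i - s)" for i by (simp add: shift_matching_def)
  show ?thesis
    using assms unfolding noncrossing_def d shift_pair_blocks shift_singleton_blocks
    by (meson diff_strict_right_mono)
qed

lemma marked_pms_shift: "marked_pms x \<Longrightarrow> marked_pms (shift_marked s x)"
  unfolding marked_pms_def partial_meandric_def
proof (elim exE conjE)
  fix A
  assume "int_interval A" "snd x \<in> A" "partial_matching A (fst (fst x))" "noncrossing (fst (fst x))"
    "partial_matching A (snd (fst x))" "noncrossing (snd (fst x))"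
  then show "\<exists>A. int_interval A \<and> (partial_matching A (fst (fst (shift_marked s x))) \<and>
      noncrossing (fst (fst (shift_marked s x))) \<and> partial_matching A (snd (fst (shift_marked s x))) \<and>
      noncrossing (snd (fst (shift_marked s x)))) \<and> snd (shift_marked s x) \<in> A"
    by (intro exI[of _ "(\<lambda>i. i + s) ` A"])
       (simp add: shift_marked_def int_interval_shift partial_matching_shift noncrossing_shift)
qed

lemma matching_subI:
  fixes W :: "nat \<Rightarrow> int set"
  assumes P: "partial_matching A P" and Q: "partial_matching C Q"
    and W: "\<And>k. W k = {r - int k..r + int k}"
    and eq: "\<And>k. restrict_matching (W k \<inter> A) P = restrict_matching (W k \<inter> C) Q"
  shows "blocks P \<subseteq> blocks Q" and "deco P i = Some x \<Longrightarrow> deco Q i = Some x"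
proof -
  have fin: "finite b" if "b \<in> blocks P \<or> b \<in> blocks Q" for b
  proof -
    have "card b = 1 \<or> card b = 2" using that P Q by (auto simp: partial_matching_def)
    then show ?thesis by (auto intro: card_ge_0_finite)
  qed
  have cover: "\<exists>k. b \<subseteq> W k" if "finite b" for b
  proof -
    define N where "N = (\<Sum>i\<in>b. nat \<bar>i - r\<bar>)"
    have "b \<subseteq> W N"
    proof
      fix i assume "i \<in> b"
      then have "nat \<bar>i - r\<bar> \<le> N" unfolding N_def by (rule member_le_sum) (use that in auto)
      then show "i \<in> W N" unfolding W by auto
    qed
    then show ?thesis ..
  qed
  show sub: "blocks P \<subseteq> blocks Q"
  proof
    fix b assume b: "b \<in> blocks P"
    have bA: "b \<subseteq> A" using b partial_matching_blocks_eq[OF P] by blast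
    obtain k where k: "b \<subseteq> W k" using cover fin b by blast
    have "b \<in> blocks (restrict_matching (W k \<inter> A) P)" using b bA k by (auto simp: restrict_matching_def)
    then have "b \<in> blocks (restrict_matching (W k \<inter> C) Q)" by (simp add: eq)
    then have bC: "b \<subseteq> C" by (auto simp: restrict_matching_def)
    have "b \<noteq> {}" using b P by (auto simp: partial_matching_def partition_on_def)
    then obtain i where i: "i \<in> b" by blast
    then obtain c where c: "c \<in> blocks Q" "i \<in> c" using bC partial_matching_blocks_eq[OF Q] by blast
    then obtain l where l: "b \<union> c \<subseteq> W l" using cover[of "b \<union> c"] fin b by blast
    have cC: "c \<subseteq> C" using c partial_matching_blocks_eq[OF Q] by blast
    have "b \<in> blocks (restrict_matching (W l \<inter> A) P)" using b bA l by (auto simp: restrict_matching_def)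
    then have "b \<in> blocks (restrict_matching (W l \<inter> C) Q)" by (simp add: eq)
    then have "b \<in> blocks Q \<or> (\<exists>d\<in>blocks Q. i \<in> d \<and> \<not> d \<subseteq> W l \<inter> C)"
      using i by (auto simp: restrict_matching_def)
    then show "b \<in> blocks Q"
      using partial_matching_block_unique[OF Q _ c(1) _ c(2)] l cC by blast
  qed
  assume i: "deco P i = Some x"
  then have "{i} \<in> blocks P" using P by (auto simp: partial_matching_def)
  then have iA: "i \<in> A" "i \<in> C" "deco Q i \<noteq> None"
    using sub Q partial_matching_blocks_eq[OF P] partial_matching_blocks_eq[OF Q]
    by (auto simp: partial_matching_def)
  obtain k where k: "i \<in> W k" using cover[of "{i}"] by auto
  have "deco P i = deco (restrict_matching (W k \<inter> A) P) i" using k iA i by (simp add: restrict_matching_def)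
  also have "\<dots> = deco Q i" unfolding eq using k iA by (simp add: restrict_matching_def)
  finally show "deco Q i = Some x" using i by simp
qed

lemma matching_eqI:
  assumes P: "partial_matching A P" and Q: "partial_matching C Q"
    and eq: "\<And>k. restrict_matching ({r - int k..r + int k} \<inter> A) P =
                  restrict_matching ({r - int k..r + int k} \<inter> C) Q"
  shows "P = Q"
proof (rule matching.equality)
  note 1 = matching_subI[OF P Q refl eq] and 2 = matching_subI[OF Q P refl eq[symmetric]]
  show "blocks P = blocks Q" using 1(1) 2(1) by blast
  show "deco P = deco Q"
  proof
    fix i show "deco P i = deco Q i"
      using 1(2)[of i] 2(2)[of i] by (cases "deco P i"; cases "deco Q i") auto
  qed
qed simp

lemma agree_all_imp_equiv:
  assumes x: "marked_pms x" and y: "marked_pms y" and ag: "\<And>k. agree k x y"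
  shows "shift_equiv x y"
proof -
  define s where "s = snd y - snd x"
  define z where "z = shift_marked s x"
  have zm: "marked_pms z" "snd z = snd y"
    using x by (auto simp: z_def s_def marked_pms_shift) (simp add: shift_marked_def)
  have w: "window z k = window y k" for k
  proof -
    obtain t where t: "window y k = shift_marked t (window x k)"
      using ag[of k] by (auto simp: agree_def shift_equiv_def)
    have "snd (window y k) = snd (window x k) + t" unfolding t by (simp add: shift_marked_def)
    then have "t = s" by (simp add: window_def s_def)
    then show ?thesis using t by (simp add: z_def window_shift)
  qed
  obtain A where A: "partial_meandric A (fst z)" using zm by (auto simp: marked_pms_def)
  obtain C where C: "partial_meandric C (fst y)" using y by (auto simp: marked_pms_def)
  have eq: "restrict_system ({snd y - int k..snd y + int k} \<inter> A) (fst z) =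
      restrict_system ({snd y - int k..snd y + int k} \<inter> C) (fst y)" for k
    using w[of k] unfolding window_def support_eq[OF A] support_eq[OF C] zm(2) by (rule Pair_inject)
  have "fst (fst z) = fst (fst y)"
    by (rule matching_eqI[of A _ C _ "snd y"])
       (use A C eq in \<open>simp_all add: partial_meandric_def restrict_system_def\<close>)
  moreover have "snd (fst z) = snd (fst y)"
    by (rule matching_eqI[of A _ C _ "snd y"])
       (use A C eq in \<open>simp_all add: partial_meandric_def restrict_system_def\<close>)
  ultimately have "z = y" using zm(2) by (simp add: prod_eq_iff)
  then show ?thesis by (auto simp: z_def shift_equiv_def)
qed

lemma finite_agree:
  assumes x: "marked_pms x" and y: "marked_pms y" and "\<not> shift_equiv x y"
  shows "finite {k. agree k x y}"
proof -
  obtain l where "\<not> agree l x y" using agree_all_imp_equiv assms by blast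
  then have "{k. agree k x y} \<subseteq> {..<l}" using agree_mono[OF x y, of _ l] by (auto simp: not_less[symmetric])
  then show ?thesis by (rule finite_subset) simp
qed

lemma local_dist_less_iff:
  assumes x: "marked_pms x" and y: "marked_pms y"
  shows "local_dist x y < 1 / (1 + real k) \<longleftrightarrow> agree (Suc k) x y"
proof (cases "shift_equiv x y")
  case True
  then show ?thesis by (simp add: local_dist_def window_equiv)
next
  case False
  note fin = finite_agree[OF x y False]
  show ?thesis
  proof (cases "agree 0 x y")
    case no: False
    then have "\<not> agree (Suc k) x y" using agree_mono[OF x y, of "Suc k" 0] by blast
    then show ?thesis using no False by (simp add: local_dist_def)
  next
    case ag: True
    define m where "m = Max {k. agree k x y}"
    have m: "agree m x y" using Max_in[OF fin] ag unfolding m_def by blast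
    have "agree (Suc k) x y \<longleftrightarrow> Suc k \<le> m"
      using Max_ge[OF fin, of "Suc k"] agree_mono[OF x y m, of "Suc k"] by (auto simp: m_def)
    also have "\<dots> \<longleftrightarrow> 1 / (1 + real m) < 1 / (1 + real k)" by (auto simp: field_simps)
    finally show ?thesis using ag False by (simp add: local_dist_def m_def)
  qed
qed

lemma local_dist_values:
  "local_dist x y = 0 \<and> shift_equiv x y \<or> (\<exists>k. local_dist x y = 1 / (1 + real k)) \<and> \<not> shift_equiv x y"
  by (auto simp: local_dist_def intro: exI[of _ "0::nat"])

lemma local_dist_triangle:
  assumes x: "marked_pms x" and y: "marked_pms y" and z: "marked_pms z"
  shows "local_dist x y \<le> max (local_dist x z) (local_dist y z)"
proof (rule ccontr)
  assume "\<not> ?thesis"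
  then have lt: "local_dist x z < local_dist x y" "local_dist y z < local_dist x y" by auto
  moreover have "local_dist x z \<ge> 0" using local_dist_values[of x z] by auto
  ultimately obtain k where k: "local_dist x y = 1 / (1 + real k)"
    using local_dist_values[of x y] by auto
  have "agree (Suc k) x z" "agree (Suc k) y z"
    using lt k local_dist_less_iff[OF x z] local_dist_less_iff[OF y z] by auto
  then have "agree (Suc k) x y" using agree_sym agree_trans by blast
  then show False using local_dist_less_iff[OF x y, of k] k by simp
qed

lemma local_dist_cong:
  assumes "shift_equiv x x'" "shift_equiv y y'"
  shows "local_dist x y = local_dist x' y'"
proof -
  have "shift_equiv x y \<longleftrightarrow> shift_equiv x' y'"
    using assms shift_equiv_sym shift_equiv_trans by meson
  moreover have "agree k x y \<longleftrightarrow> agree k x' y'" for k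
    using window_equiv[OF assms(1), of k] window_equiv[OF assms(2), of k] agree_sym agree_trans by meson
  ultimately show ?thesis by (simp add: local_dist_def)
qed

definition marked_equiv :: "system \<times> int \<Rightarrow> system \<times> int \<Rightarrow> bool" where
  "marked_equiv x y \<longleftrightarrow> marked_pms x \<and> marked_pms y \<and> shift_equiv x y"

lemma marked_pms_exists: "\<exists>x. marked_pms x"
proof
  let ?P = "\<lparr>blocks = {{0}}, deco = [0 \<mapsto> L]\<rparr>"
  have "partial_matching {0} ?P"
    by (auto simp: partial_matching_def partition_on_def split: if_splits)
  moreover have "noncrossing ?P"
    by (auto simp: noncrossing_def doubleton_eq_iff split: if_splits)
  ultimately show "marked_pms ((?P, ?P), 0)"
    by (auto simp: marked_pms_def partial_meandric_def int_interval_def intro!: exI[of _ "{0}"])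
qed

quotient_type marked_system = "system \<times> int" / partial: marked_equiv
proof (rule part_equivpI)
  show "\<exists>x. marked_equiv x x" using marked_pms_exists by (auto simp: marked_equiv_def)
  show "symp marked_equiv" by (auto simp: symp_def marked_equiv_def intro: shift_equiv_sym)
  show "transp marked_equiv" by (auto simp: transp_def marked_equiv_def intro: shift_equiv_trans)
qed

text \<open>The class of \<^term>\<open>(M, r)\<close>; meaningful when \<^term>\<open>marked_pms (M, r)\<close>.\<close>

definition mark :: "system \<Rightarrow> int \<Rightarrow> marked_system" where
  "mark M r = abs_marked_system (M, r)"

instantiation marked_system :: metric_space
begin

lift_definition dist_marked_system :: "marked_system \<Rightarrow> marked_system \<Rightarrow> real" is local_dist
  by (auto simp: marked_equiv_def intro: local_dist_cong)

definition uniformity_marked_system :: "(marked_system \<times> marked_system) filter" where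
  "uniformity_marked_system = (INF e\<in>{0<..}. principal {(x, y). dist x y < e})"

definition open_marked_system :: "marked_system set \<Rightarrow> bool" where
  "open_marked_system U \<longleftrightarrow> (\<forall>x\<in>U. eventually (\<lambda>(x', y). x' = x \<longrightarrow> y \<in> U) uniformity)"

instance
proof
  fix x y z :: marked_system
  show "dist x y = 0 \<longleftrightarrow> x = y"
    by transfer (use local_dist_values in \<open>force simp: marked_equiv_def\<close>)
  show "dist x y \<le> dist x z + dist y z"
  proof transfer
    fix x y z assume "marked_equiv x x" "marked_equiv y y" "marked_equiv z z"
    then have "local_dist x y \<le> max (local_dist x z) (local_dist y z)"
      by (intro local_dist_triangle) (auto simp: marked_equiv_def)
    moreover have "local_dist x z \<ge> 0" "local_dist y z \<ge> 0"
      using local_dist_values[of x z] local_dist_values[of y z] by auto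
    ultimately show "local_dist x y \<le> local_dist x z + local_dist y z"
      by linarith
  qed
qed (simp_all only: uniformity_marked_system_def open_marked_system_def)

end

lemma dist_mark:
  assumes "marked_pms (M, r)" "marked_pms (N, s)"
  shows "dist (mark M r) (mark N s) = local_dist (M, r) (N, s)"
  using assms unfolding mark_def
  by (simp add: dist_marked_system.abs_eq marked_equiv_def)

lemma mark_eq_iff:
  assumes "marked_pms (M, r)" "marked_pms (N, s)"
  shows "mark M r = mark N s \<longleftrightarrow> shift_equiv (M, r) (N, s)"
proof -
  have "local_dist (M, r) (N, s) = 0 \<longleftrightarrow> shift_equiv (M, r) (N, s)"
    using local_dist_values[of "(M, r)" "(N, s)"] by auto
  then show ?thesis by (metis dist_eq_0_iff dist_mark[OF assms])
qed

text \<open>A non-crossing perfect matching of the integers is determined by its set of openers, and one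
  exists for almost every fair sequence. On the exceptional null set the description below is
  unsatisfiable and the value is an unspecified constant.\<close>

definition has_openers :: "(int \<Rightarrow> side) \<Rightarrow> matching \<Rightarrow> bool" where
  "has_openers a P \<longleftrightarrow> (\<forall>i. a i = L \<longleftrightarrow> (\<exists>j. i < j \<and> {i, j} \<in> blocks P))"

definition noodle_matching :: "(int \<Rightarrow> side) \<Rightarrow> matching" where
  "noodle_matching a = (THE P. noncrossing_matching UNIV P \<and> has_openers a P)"

definition noodle :: "(int \<Rightarrow> side) \<Rightarrow> (int \<Rightarrow> side) \<Rightarrow> system" where
  "noodle a b = (noodle_matching a, noodle_matching b)"

definition uniform_rv :: "'a measure \<Rightarrow> ('a \<Rightarrow> 'b) \<Rightarrow> 'b set \<Rightarrow> bool" where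
  "uniform_rv P X S \<longleftrightarrow>
     X \<in> measurable P (count_space S) \<and> distr P (count_space S) X = uniform_count_measure S"

text \<open>The library's \<^const>\<open>prob_space.indep_var\<close> requires both variables to take values in the same
  type.\<close>

definition indep_rvs ::
    "'a measure \<Rightarrow> 'b measure \<Rightarrow> ('a \<Rightarrow> 'b) \<Rightarrow> 'c measure \<Rightarrow> ('a \<Rightarrow> 'c) \<Rightarrow> bool" where
  "indep_rvs P S X T Y \<longleftrightarrow>
     X \<in> measurable P S \<and> Y \<in> measurable P T \<and>
     prob_space.indep_set P {X -` A \<inter> space P | A. A \<in> sets S} {Y -` B \<inter> space P | B. B \<in> sets T}"

text \<open>The limit is a constant, so the probability space may vary with the index.\<close>

definition tendsto_in_prob :: "(nat \<Rightarrow> 'a measure) \<Rightarrow> (nat \<Rightarrow> 'a \<Rightarrow> real) \<Rightarrow> real \<Rightarrow> bool" where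
  "tendsto_in_prob P X c \<longleftrightarrow>
     (\<forall>\<epsilon>>0. (\<lambda>n. measure (P n) {\<omega> \<in> space (P n). \<bar>X n \<omega> - c\<bar> > \<epsilon>}) \<longlonglongrightarrow> 0)"

definition fair_iid :: "'a measure \<Rightarrow> (int \<Rightarrow> 'a \<Rightarrow> side) \<Rightarrow> bool" where
  "fair_iid Q a \<longleftrightarrow>
     prob_space.indep_vars Q (\<lambda>_. count_space UNIV) a UNIV \<and> (\<forall>i. uniform_rv Q (a i) UNIV)"

end

theory Submission
  imports Defs
begin

text \<open>
  A window of a non-crossing matching is determined by the openers it contains. For the noodle these
  are fair coin flips, and the simple random walk they drive is recurrent, so the noodle exists
  almost surely and its windows are uniform over all pairs of words. For a uniform meandric system
  the two opener words are independent uniform Dyck words. Dyck words of length \<^term>\<open>2 * n\<close> have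
  only polynomially small density among all words, whereas the frequency of a given window in a
  uniform word deviates from its mean with exponentially small probability (Hoeffding); hence the
  window frequencies of the meandric system concentrate around those of the noodle. A bounded
  continuous function is the pointwise limit of its suprema over windows of growing radius, which
  transfers the upper bound from window frequencies to \<^term>\<open>F\<close>; the lower bound is the upper bound
  for \<^term>\<open>\<lambda>x. C - F x\<close>.
\<close>

subsection \<open>Windows of non-crossing matchings\<close>

text \<open>The local structure of a uniform meandric system is never computed. Conditioning a pair
  of uniform words on both being Dyck words multiplies probabilities by at most
  \<open>(2 * n) ^ 4\<close>, so exponentially unlikely events stay negligible; this yields the
  quenched statement directly. For each matching one factor \<open>2 * n\<close> comes from the
  choice of a rotation and another from the lower bound on the central binomial coefficient. A
  bounded continuous \<open>F\<close> need not be uniformly continuous, so it need not be uniformly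
  close to a function of a window. Suprema over cylinders bound it from above and converge at almost
  every noodle, which is enough for their means to converge but gives only one-sided estimates; this
  is why the reflection is needed. The other obstacle is measurability of \<open>F\<close> at the
  noodle: it is required on the whole sample space, also where no matching exists and
  \<open>THE\<close> returns an unspecified value. The ultrametric geometry of the space resolves
  this.\<close>

definition opener :: "matching \<Rightarrow> int \<Rightarrow> side" where
  "opener P i = (if \<exists>j>i. {i, j} \<in> blocks P then L else R)"

lemma has_openers_iff: "has_openers a P \<longleftrightarrow> a = opener P"
proof -
  have "(a i = L \<longleftrightarrow> (\<exists>j>i. {i, j} \<in> blocks P)) \<longleftrightarrow> a i = opener P i" for i
    by (cases "a i") (auto simp: opener_def)
  then show ?thesis by (auto simp: has_openers_def fun_eq_iff)
qed

lemma opener_shift: "opener (shift_matching s P) i = opener P (i - s)"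
proof -
  have "(\<exists>j>i. {i - s, j - s} \<in> blocks P) \<longleftrightarrow> (\<exists>j>i - s. {i - s, j} \<in> blocks P)"
    by (metis add_diff_cancel_right' diff_add_cancel diff_strict_right_mono less_diff_eq)
  then show ?thesis by (simp add: opener_def shift_pair_blocks)
qed

lemma noncrossing_matching_shift:
  "noncrossing_matching A P \<Longrightarrow> noncrossing_matching ((\<lambda>i. i + s) ` A) (shift_matching s P)"
  unfolding noncrossing_matching_def
  by (auto simp: partial_matching_shift noncrossing_shift)
     (auto simp: shift_matching_def card_image)

context
  fixes A P assumes P: "noncrossing_matching A P"
begin

lemma block_pair:
  assumes "b \<in> blocks P"
  obtains i j where "b = {i, j}" "i < j" "i \<in> A" "j \<in> A"
proof -
  have "card b = 2" using P assms by (auto simp: noncrossing_matching_def)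
  then obtain x y where xy: "b = {x, y}" "x \<noteq> y" by (meson card_2_iff)
  then have "x \<in> A" "y \<in> A"
    using P assms partial_matching_blocks_eq[of A P] by (auto simp: noncrossing_matching_def)
  then show thesis using that[of x y] that[of y x] xy by (auto simp: insert_commute neq_iff)
qed

lemma partner_exists:
  assumes "i \<in> A"
  obtains j where "{i, j} \<in> blocks P" "j \<noteq> i" "j \<in> A"
proof -
  obtain b where b: "b \<in> blocks P" "i \<in> b"
    using assms P partial_matching_blocks_eq[of A P] by (auto simp: noncrossing_matching_def)
  obtain x y where "b = {x, y}" "x < y" "x \<in> A" "y \<in> A" using block_pair[OF b(1)] .
  then show thesis using that[of x] that[of y] b by (auto simp: insert_commute)
qed

lemma partner_unique: "{i, j} \<in> blocks P \<Longrightarrow> {i, k} \<in> blocks P \<Longrightarrow> j = k"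
  using partial_matching_block_unique[of A P "{i, j}" "{i, k}" i] P
  by (auto simp: noncrossing_matching_def doubleton_eq_iff)

lemma partner_mem: "{i, j} \<in> blocks P \<Longrightarrow> i \<in> A \<and> j \<in> A"
  using P partial_matching_blocks_eq[of A P] by (auto simp: noncrossing_matching_def)

lemma not_crossing: "{i, k} \<in> blocks P \<Longrightarrow> {j, l} \<in> blocks P \<Longrightarrow> i < j \<Longrightarrow> j < k \<Longrightarrow> \<not> k < l"
  using P unfolding noncrossing_matching_def noncrossing_def by blast

lemma deco_None: "deco P = (\<lambda>_. None)"
proof -
  have "{i} \<notin> blocks P" for i using P by (force simp: noncrossing_matching_def)
  then have "dom (deco P) = {}" using P by (auto simp: noncrossing_matching_def partial_matching_def)
  then show ?thesis by (auto simp: dom_def)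
qed

lemma opener_left: "{i, j} \<in> blocks P \<Longrightarrow> i < j \<Longrightarrow> opener P i = L"
  by (auto simp: opener_def)

lemma opener_right: "{i, j} \<in> blocks P \<Longrightarrow> i < j \<Longrightarrow> opener P j = R"
  using partner_unique[of j i] by (force simp: opener_def insert_commute)

text \<open>The partner of a point under an arc is neither an end of the arc nor beyond it, as that
  would be a crossing. The nested pair is shorter, which drives the inductions in
  \<open>pair_determined\<close> and \<open>pair_imp_arc\<close>.\<close>

lemma partner_inside:
  assumes "{i, j} \<in> blocks P" "i < t" "t < j" "t \<in> A"
  obtains s where "{t, s} \<in> blocks P" "i < s" "s < j" "s \<noteq> t"
proof -
  obtain s where s: "{t, s} \<in> blocks P" "s \<noteq> t" using partner_exists[OF assms(4)] by blast
  have "s \<noteq> i" using partner_unique[of i t j] s assms by (auto simp: insert_commute)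
  moreover have "s \<noteq> j" using partner_unique[of j t i] s assms by (auto simp: insert_commute)
  moreover have "\<not> j < s" using not_crossing[OF assms(1) s(1)] assms by auto
  moreover have "\<not> s < i" using not_crossing[of s t i j] assms s by (auto simp: insert_commute)
  ultimately show thesis using that s by force
qed

end

text \<open>Induction on the length of the arc. Every point strictly between \<open>i\<close> and
  \<open>j\<close> already has a \<open>P'\<close>-partner strictly between them, so neither the
  \<open>P'\<close>-partner \<open>j'\<close> of \<open>i\<close> nor the \<open>P'\<close>-partner
  \<open>i'\<close> of \<open>j\<close> lies there. The letters force \<open>i < j'\<close> and
  \<open>i' < j\<close>; if \<open>i\<close> and \<open>j\<close> were not partners,
  \<open>i' < i < j < j'\<close> would give a crossing.\<close>

lemma pair_determined:
  assumes P: "noncrossing_matching A P" and P': "noncrossing_matching A' P'"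
    and B: "B \<subseteq> A" "B \<subseteq> A'" "int_interval B"
    and op: "\<And>t. t \<in> B \<Longrightarrow> opener P t = opener P' t"
  shows "{i, j} \<in> blocks P \<Longrightarrow> i < j \<Longrightarrow> i \<in> B \<Longrightarrow> j \<in> B \<Longrightarrow> {i, j} \<in> blocks P'"
proof (induction "nat (j - i)" arbitrary: i j rule: less_induct)
  case less
  note ij = less.prems
  have mem: "t \<in> B" if "i \<le> t" "t \<le> j" for t
    using B(3) ij that unfolding int_interval_def by (meson atLeastAtMost_iff subsetD)
  have inside: "\<exists>s. {t, s} \<in> blocks P' \<and> i < s \<and> s < j" if t: "i < t" "t < j" for t
  proof -
    have tA: "t \<in> A" using mem t B by auto
    obtain s where s: "{t, s} \<in> blocks P" "i < s" "s < j" "s \<noteq> t"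
      using partner_inside[OF P ij(1) t, of thesis] tA by blast
    consider "t < s" | "s < t" using s by linarith
    then have "{t, s} \<in> blocks P'"
    proof cases
      case 1
      then show ?thesis using less.hyps[of s t] s t mem by auto
    next
      case 2
      then show ?thesis using less.hyps[of t s] s t mem by (auto simp: insert_commute)
    qed
    then show ?thesis using s by blast
  qed
  have "opener P' i = L" using opener_left[OF P ij(1,2)] op ij by auto
  then obtain j' where j': "j' > i" "{i, j'} \<in> blocks P'" by (auto simp: opener_def split: if_splits)
  have "opener P' j = R" using opener_right[OF P ij(1,2)] op ij by auto
  moreover obtain i' where i': "{j, i'} \<in> blocks P'" "i' \<noteq> j"
    using partner_exists[OF P'] B ij by blast
  ultimately have i'j: "i' < j" using opener_left[OF P' i'(1)] by fastforce
  have "\<not> j' < j"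
  proof
    assume "j' < j"
    then obtain s where "{j', s} \<in> blocks P'" "i < s" using inside j' by blast
    then show False using partner_unique[OF P', of j' i s] j' by (auto simp: insert_commute)
  qed
  moreover have "\<not> i < i'"
  proof
    assume "i < i'"
    then obtain s where "{i', s} \<in> blocks P'" "s < j" using inside i'j by blast
    then show False using partner_unique[OF P', of i' j s] i' by (auto simp: insert_commute)
  qed
  moreover have "\<not> (i' < i \<and> j < j')"
    using not_crossing[OF P', of i' j i j'] i' j' ij by (auto simp: insert_commute)
  ultimately have "j' = j \<or> i' = i" by linarith
  then show ?case using i' j' by (auto simp: insert_commute)
qed

text \<open>A point cut off from its partner is decorated by the side on which the partner lies, and
  that is its letter \<open>opener P i\<close>. In this form \<open>P\<close> enters only through
  its pairs inside \<open>B\<close> and its letters.\<close>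

lemma restrict_noncrossing_matching:
  assumes P: "noncrossing_matching A P" and B: "B \<subseteq> A"
  shows "restrict_matching B P =
    (let D = {b \<in> blocks P. b \<subseteq> B} in
      \<lparr>blocks = D \<union> {{i} |i. i \<in> B \<and> i \<notin> \<Union>D},
       deco = (\<lambda>i. if i \<in> B \<and> i \<notin> \<Union>D then Some (opener P i) else None)\<rparr>)"
proof -
  define D where "D = {b \<in> blocks P. b \<subseteq> B}"
  have D: "i \<notin> \<Union>D \<longleftrightarrow> (\<exists>j. {i, j} \<in> blocks P \<and> j \<notin> B)" if iB: "i \<in> B" for i
  proof -
    have "i \<in> A" using iB B by auto
    obtain j where j: "{i, j} \<in> blocks P" "j \<noteq> i" using partner_exists[OF P \<open>i \<in> A\<close>] .
    have "i \<in> \<Union>D \<longleftrightarrow> j \<in> B"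
    proof
      assume "i \<in> \<Union>D"
      then obtain b where b: "b \<in> blocks P" "b \<subseteq> B" "i \<in> b" by (auto simp: D_def)
      then have "b = {i, j}" using partial_matching_block_unique[of A P b "{i, j}" i] P j
        by (auto simp: noncrossing_matching_def)
      then show "j \<in> B" using b by auto
    qed (use j iB in \<open>auto simp: D_def\<close>)
    then show ?thesis using j partner_unique[OF P] by metis
  qed
  have 1: "{{i} |i. i \<in> B \<and> (\<exists>b\<in>blocks P. i \<in> b \<and> \<not> b \<subseteq> B)} = {{i} |i. i \<in> B \<and> i \<notin> \<Union>D}"
  proof -
    have "(\<exists>b\<in>blocks P. i \<in> b \<and> \<not> b \<subseteq> B) \<longleftrightarrow> (\<exists>j. {i, j} \<in> blocks P \<and> j \<notin> B)" if "i \<in> B" for i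
    proof
      assume "\<exists>b\<in>blocks P. i \<in> b \<and> \<not> b \<subseteq> B"
      then obtain b where b: "b \<in> blocks P" "i \<in> b" "\<not> b \<subseteq> B" by blast
      obtain x y where "b = {x, y}" using block_pair[OF P b(1)] .
      then show "\<exists>j. {i, j} \<in> blocks P \<and> j \<notin> B" using b that by (auto simp: insert_commute)
    qed blast
    then have "i \<in> B \<and> (\<exists>b\<in>blocks P. i \<in> b \<and> \<not> b \<subseteq> B) \<longleftrightarrow> i \<in> B \<and> i \<notin> \<Union>D" for i
      using D[of i] by meson
    then show ?thesis by simp
  qed
  have 2: "(if i \<notin> B then None else if deco P i \<noteq> None then deco P i
         else if \<exists>j. j \<notin> B \<and> {i, j} \<in> blocks P \<and> j > i then Some L
         else if \<exists>j. j \<notin> B \<and> {i, j} \<in> blocks P \<and> j < i then Some R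
         else None) = (if i \<in> B \<and> i \<notin> \<Union>D then Some (opener P i) else None)" for i
  proof (cases "i \<in> B \<and> i \<notin> \<Union>D")
    case True
    then obtain j where j: "{i, j} \<in> blocks P" "j \<notin> B" using D[of i] by meson
    have eq: "{i, k} \<in> blocks P \<longleftrightarrow> k = j" for k using partner_unique[OF P] j by blast
    show ?thesis using True j by (auto simp: eq deco_None[OF P] opener_def)
  next
    case False
    then show ?thesis using D[of i] by (auto simp: deco_None[OF P])
  qed
  show ?thesis unfolding restrict_matching_def Let_def D_def[symmetric] 1 2 ..
qed

lemma restrict_determined:
  assumes P: "noncrossing_matching A P" and P': "noncrossing_matching A' P'"
    and B: "B \<subseteq> A" "B \<subseteq> A'" "int_interval B"
    and op: "\<And>t. t \<in> B \<Longrightarrow> opener P t = opener P' t"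
  shows "restrict_matching B P = restrict_matching B P'"
proof -
  have "{b \<in> blocks P. b \<subseteq> B} = {b \<in> blocks P'. b \<subseteq> B}"
  proof (intro equalityI subsetI)
    fix b assume b: "b \<in> {b \<in> blocks P. b \<subseteq> B}"
    then obtain i j where "b = {i, j}" "i < j" using block_pair[OF P, of b] by blast
    then show "b \<in> {b \<in> blocks P'. b \<subseteq> B}"
      using b pair_determined[OF P P' B op] by auto
  next
    fix b assume b: "b \<in> {b \<in> blocks P'. b \<subseteq> B}"
    then obtain i j where "b = {i, j}" "i < j" using block_pair[OF P', of b] by blast
    then show "b \<in> {b \<in> blocks P. b \<subseteq> B}"
      using b pair_determined[OF P' P B(2,1,3) op[symmetric]] by auto
  qed
  then show ?thesis
    unfolding restrict_noncrossing_matching[OF P B(1)] restrict_noncrossing_matching[OF P' B(2)] Let_def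
    using op by (auto simp: fun_eq_iff)
qed

lemma noncrossing_matching_eqI:
  assumes P: "noncrossing_matching A P" and P': "noncrossing_matching A P'"
    and "int_interval A" "\<And>t. t \<in> A \<Longrightarrow> opener P t = opener P' t"
  shows "P = P'"
proof (rule matching.equality)
  note det = pair_determined[OF P P' subset_refl subset_refl assms(3,4)]
    pair_determined[OF P' P subset_refl subset_refl assms(3) assms(4)[symmetric]]
  have "b \<in> blocks P \<longleftrightarrow> b \<in> blocks P'" for b
    using block_pair[OF P, of b] block_pair[OF P', of b] det by metis
  then show "blocks P = blocks P'" by blast
  show "deco P = deco P'" using deco_None[OF P] deco_None[OF P'] by simp
qed simp

lemma marked_pms_noncrossing:
  assumes "noncrossing_matching A U" "noncrossing_matching A D" "int_interval A" "r \<in> A"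
  shows "marked_pms ((U, D), r)"
  using assms unfolding marked_pms_def partial_meandric_def noncrossing_matching_def by auto

text \<open>Shifting by \<open>r' - r\<close> puts both windows on the same interval. Both windows
  are required to fit into their domains, so that neither is truncated by a boundary.\<close>

lemma agreeI:
  assumes U: "noncrossing_matching A U" and D: "noncrossing_matching A D"
    and U': "noncrossing_matching A' U'" and D': "noncrossing_matching A' D'"
    and A: "{r - int m..r + int m} \<subseteq> A" "{r' - int m..r' + int m} \<subseteq> A'"
    and opU: "\<And>t. \<bar>t\<bar> \<le> int m \<Longrightarrow> opener U (r + t) = opener U' (r' + t)"
    and opD: "\<And>t. \<bar>t\<bar> \<le> int m \<Longrightarrow> opener D (r + t) = opener D' (r' + t)"
  shows "agree m ((U, D), r) ((U', D'), r')"
proof -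
  let ?s = "r' - r" and ?B = "{r' - int m..r' + int m}"
  let ?f = "\<lambda>i::int. i + ?s"
  have supp: "support (V, W) = C" if "noncrossing_matching C V" for C V W
    using that by (simp add: support_def noncrossing_matching_def partial_matching_blocks_eq)
  note sh = noncrossing_matching_shift[OF U, of ?s] noncrossing_matching_shift[OF D, of ?s]
  have BA: "?B \<subseteq> ?f ` A"
  proof
    fix t assume "t \<in> ?B"
    then have "t - ?s \<in> A" using A(1) by auto
    then show "t \<in> ?f ` A" by (rule rev_image_eqI) simp
  qed
  have int: "int_interval ?B" by (auto simp: int_interval_def)
  have "restrict_matching ?B (shift_matching ?s U) = restrict_matching ?B U'"
    using opU[of "_ - r'"] by (intro restrict_determined[OF sh(1) U' BA A(2) int]) (auto simp: opener_shift algebra_simps)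
  moreover have "restrict_matching ?B (shift_matching ?s D) = restrict_matching ?B D'"
    using opD[of "_ - r'"] by (intro restrict_determined[OF sh(2) D' BA A(2) int]) (auto simp: opener_shift algebra_simps)
  moreover have "?B \<inter> ?f ` A = ?B" "?B \<inter> A' = ?B" using BA A(2) by auto
  ultimately have "window (shift_marked ?s ((U, D), r)) m = window ((U', D'), r') m"
    by (simp add: window_def shift_marked_def supp[OF sh(1)] supp[OF U'] restrict_system_def)
  then show ?thesis unfolding window_shift agree_def shift_equiv_def by metis
qed

subsection \<open>Matchings from walks\<close>

primrec side_step :: "side \<Rightarrow> int" where
  "side_step L = 1"
| "side_step R = -1"

text \<open>Two-sided path: \<open>walk a i\<close> is the height just before letter
  \<open>i\<close>, and at most one of the two sums is nonempty.\<close>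

definition walk :: "(int \<Rightarrow> side) \<Rightarrow> int \<Rightarrow> int" where
  "walk a i = (\<Sum>t\<in>{0..<i}. side_step (a t)) - (\<Sum>t\<in>{i..<0}. side_step (a t))"

lemma walk_0 [simp]: "walk a 0 = 0"
  by (simp add: walk_def)

lemma walk_Suc: "walk a (i + 1) = walk a i + side_step (a i)"
proof (cases "i \<ge> 0")
  case True
  then have "{0..<i + 1} = insert i {0..<i}" by auto
  then show ?thesis using True by (simp add: walk_def)
next
  case False
  then have "{i..<0} = insert i {i + 1..<0}" by auto
  then show ?thesis using False by (simp add: walk_def)
qed

text \<open>First-return pairing of up and down steps. Heights are read before letters, so the
  return completed by letter \<open>j\<close> shows at \<open>j + 1\<close>.\<close>

definition walk_arc :: "(int \<Rightarrow> side) \<Rightarrow> int \<Rightarrow> int \<Rightarrow> bool" where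
  "walk_arc a i j \<longleftrightarrow> i < j \<and> walk a (j + 1) = walk a i \<and> (\<forall>t. i < t \<and> t \<le> j \<longrightarrow> walk a i < walk a t)"

lemma arc_left_opener:
  assumes "walk_arc a i j"
  shows "a i = L"
proof -
  have "walk a i < walk a (i + 1)" using assms by (auto simp: walk_arc_def)
  then show ?thesis using walk_Suc[of a i] by (cases "a i") auto
qed

lemma arc_right_closer:
  assumes "walk_arc a i j"
  shows "a j = R"
proof -
  have "walk a i < walk a j" "walk a (j + 1) = walk a i" using assms by (auto simp: walk_arc_def)
  then show ?thesis using walk_Suc[of a j] by (cases "a j") auto
qed

lemma arc_unique_right:
  assumes "walk_arc a i j" "walk_arc a i k"
  shows "j = k"
proof -
  have "\<not> j < k" "\<not> k < j"
    using assms unfolding walk_arc_def by (metis add1_zle_eq less_irrefl less_add_one order_less_trans)+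
  then show ?thesis by simp
qed

lemma arc_unique_left:
  assumes "walk_arc a i k" "walk_arc a j k"
  shows "i = j"
proof -
  have "\<not> i < j" "\<not> j < i" using assms unfolding walk_arc_def by force+
  then show ?thesis by simp
qed

text \<open>Before letter \<open>j\<close> the walk is strictly above the level of \<open>i\<close>,
  and after letter \<open>k\<close> it is back at that level; an arc from \<open>j\<close> reaching
  past \<open>k\<close> would have to be above the level of \<open>j\<close> at
  \<open>k + 1\<close>.\<close>

lemma arc_not_crossing:
  assumes "walk_arc a i k" "walk_arc a j l" "i < j" "j < k"
  shows "\<not> k < l"
proof
  assume "k < l"
  then have "j < k + 1 \<and> k + 1 \<le> l" using assms by simp
  then have "walk a j < walk a (k + 1)" using assms unfolding walk_arc_def by blast
  moreover have "walk a i < walk a j" "walk a (k + 1) = walk a i" using assms unfolding walk_arc_def by auto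
  ultimately show False by simp
qed

text \<open>Down steps have size 1, so the first descent to the starting level or below hits it
  exactly. The bound \<open>k < j\<close> keeps arcs inside a finite interval in
  \<open>balanced_word_rotation\<close>.\<close>

lemma arc_from_opener:
  assumes "a i = L" "i < j" "walk a j \<le> walk a i"
  obtains k where "walk_arc a i k" "k < j"
proof -
  define n where "n = (LEAST d. walk a (i + 1 + int d) \<le> walk a i)"
  have "walk a (i + 1 + int (nat (j - i - 1))) \<le> walk a i" using assms by simp
  then have n: "walk a (i + 1 + int n) \<le> walk a i" "n \<le> nat (j - i - 1)"
    unfolding n_def by (rule LeastI, rule Least_le)
  have less: "walk a i < walk a (i + 1 + int d)" if "d < n" for d
    using not_less_Least[of d "\<lambda>d. walk a (i + 1 + int d) \<le> walk a i"] that by (simp add: n_def)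
  have "n \<noteq> 0" using n walk_Suc[of a i] assms by (cases n) auto
  then obtain m where m: "n = Suc m" by (cases n) auto
  have "walk a i < walk a (i + 1 + int m)" using less m by simp
  moreover have "walk a (i + 1 + int n) = walk a (i + 1 + int m) + side_step (a (i + 1 + int m))"
    using walk_Suc[of a "i + 1 + int m"] m by (simp add: add_ac)
  moreover have "side_step s \<ge> -1" for s by (cases s) auto
  ultimately have "walk a (i + 1 + int n) = walk a i" using n(1) by (smt (verit))
  moreover have "walk a i < walk a t" if "i < t" "t \<le> i + int n" for t
    using less[of "nat (t - i - 1)"] that by simp
  ultimately have "walk_arc a i (i + int n)"
    using \<open>n \<noteq> 0\<close> by (auto simp: walk_arc_def add_ac)
  moreover have "i + int n < j" using n(2) assms by linarith
  ultimately show thesis by (rule that)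
qed

text \<open>Mirror image of \<open>arc_from_opener\<close>: since up steps have size 1, the last
  earlier time at or below the final height is exactly at that height.\<close>

lemma arc_to_closer:
  assumes "a j = R" "i \<le> j" "walk a i \<le> walk a (j + 1)"
  obtains k where "walk_arc a k j" "i \<le> k"
proof -
  define n where "n = (LEAST d. walk a (j - int d) \<le> walk a (j + 1))"
  have "walk a (j - int (nat (j - i))) \<le> walk a (j + 1)" using assms by simp
  then have n: "walk a (j - int n) \<le> walk a (j + 1)" "n \<le> nat (j - i)"
    unfolding n_def by (rule LeastI, rule Least_le)
  have less: "walk a (j + 1) < walk a (j - int d)" if "d < n" for d
    using not_less_Least[of d "\<lambda>d. walk a (j - int d) \<le> walk a (j + 1)"] that by (simp add: n_def)
  have "n \<noteq> 0" using n walk_Suc[of a j] assms by (cases n) auto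
  then obtain m where m: "n = Suc m" by (cases n) auto
  have "walk a (j + 1) < walk a (j - int m)" using less m by simp
  moreover have "walk a (j - int m) = walk a (j - int n) + side_step (a (j - int n))"
    using walk_Suc[of a "j - int n"] m by (simp add: algebra_simps)
  moreover have "side_step s \<le> 1" for s by (cases s) auto
  ultimately have "walk a (j - int n) = walk a (j + 1)" using n(1) by (smt (verit))
  moreover have "walk a (j + 1) < walk a t" if "j - int n < t" "t \<le> j" for t
    using less[of "nat (j - t)"] that by simp
  ultimately have "walk_arc a (j - int n) j"
    using \<open>n \<noteq> 0\<close> by (auto simp: walk_arc_def)
  moreover have "i \<le> j - int n" using n(2) assms by linarith
  ultimately show thesis by (rule that)
qed

definition arc_matching :: "int set \<Rightarrow> (int \<Rightarrow> side) \<Rightarrow> matching" where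
  "arc_matching A a = \<lparr>blocks = {{i, j} |i j. i \<in> A \<and> j \<in> A \<and> walk_arc a i j}, deco = (\<lambda>_. None)\<rparr>"

lemma pair_in_arc_matching:
  "{i, j} \<in> blocks (arc_matching A a) \<longleftrightarrow> i \<in> A \<and> j \<in> A \<and> (walk_arc a i j \<or> walk_arc a j i)"
  by (auto simp: arc_matching_def doubleton_eq_iff)

lemma arc_matching_noncrossing:
  assumes A: "\<And>i. i \<in> A \<Longrightarrow> \<exists>j\<in>A. walk_arc a i j \<or> walk_arc a j i"
  shows "noncrossing_matching A (arc_matching A a)"
proof -
  let ?M = "arc_matching A a"
  have neq: "i \<noteq> j" if "walk_arc a i j" for i j using that by (auto simp: walk_arc_def)
  have bl: "b \<in> blocks ?M \<longleftrightarrow> (\<exists>i j. b = {i, j} \<and> i \<in> A \<and> j \<in> A \<and> walk_arc a i j)" for b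
    by (auto simp: arc_matching_def)
  have card: "card b = 2" if "b \<in> blocks ?M" for b using that neq by (auto simp: bl)
  have nosing: "{i} \<notin> blocks ?M" for i using card by force
  have uniq: "b = c" if "b \<in> blocks ?M" "c \<in> blocks ?M" "x \<in> b" "x \<in> c" for b c x
  proof -
    obtain i j where b: "b = {i, j}" "walk_arc a i j" using \<open>b \<in> blocks ?M\<close> unfolding bl by blast
    obtain k l where c: "c = {k, l}" "walk_arc a k l" using \<open>c \<in> blocks ?M\<close> unfolding bl by blast
    have "a i = L" "a j = R" "a k = L" "a l = R"
      using b c by (auto dest: arc_left_opener arc_right_closer)
    \<comment> \<open>The letter at \<open>x\<close> decides whether \<open>x\<close> is a left or a
      right end, so it plays the same role in both arcs.\<close>
    then have "x = i \<and> x = k \<or> x = j \<and> x = l" using that b c by auto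
    then show "b = c" using b c arc_unique_left arc_unique_right by metis
  qed
  have "\<Union> (blocks ?M) = A"
  proof
    show "\<Union> (blocks ?M) \<subseteq> A" by (auto simp: bl)
    show "A \<subseteq> \<Union> (blocks ?M)"
    proof
      fix i assume "i \<in> A"
      then obtain j where "{i, j} \<in> blocks ?M" using A[of i] by (auto simp: pair_in_arc_matching)
      then show "i \<in> \<Union> (blocks ?M)" by blast
    qed
  qed
  moreover have "{} \<notin> blocks ?M" by (auto simp: bl)
  ultimately have "partition_on A (blocks ?M)"
    using uniq unfolding partition_on_def disjoint_def by (metis disjoint_iff)
  then have "partial_matching A ?M"
    using card nosing by (auto simp: partial_matching_def) (simp add: arc_matching_def)
  moreover have "noncrossing ?M"
  proof -
    have "\<not> ({i, k} \<in> blocks ?M \<and> {j, l} \<in> blocks ?M)" if "i < j" "j < k" "k < l" for i j k l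
    proof
      assume "{i, k} \<in> blocks ?M \<and> {j, l} \<in> blocks ?M"
      moreover have "\<not> walk_arc a k i" "\<not> walk_arc a l j" using that by (auto simp: walk_arc_def)
      ultimately have "walk_arc a i k" "walk_arc a j l" by (auto simp: pair_in_arc_matching)
      then show False using arc_not_crossing that by blast
    qed
    then show ?thesis using nosing by (auto simp: noncrossing_def) (simp add: arc_matching_def)
  qed
  ultimately show ?thesis using card by (simp add: noncrossing_matching_def)
qed

lemma opener_arc_matching:
  assumes A: "\<And>i. i \<in> A \<Longrightarrow> \<exists>j\<in>A. walk_arc a i j \<or> walk_arc a j i" and i: "i \<in> A"
  shows "opener (arc_matching A a) i = a i"
proof (cases "\<exists>j\<in>A. walk_arc a i j")
  case True
  then obtain j where "j \<in> A" "walk_arc a i j" by blast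
  moreover from this have "i < j" by (simp add: walk_arc_def)
  ultimately show ?thesis using i arc_left_opener[of a i j]
    by (auto simp: opener_def pair_in_arc_matching)
next
  case False
  then obtain j where j: "j \<in> A" "walk_arc a j i" using A[OF i] by blast
  have "\<not> walk_arc a k i" if "i < k" for k using that by (auto simp: walk_arc_def)
  then have "opener (arc_matching A a) i = R"
    using False by (auto simp: opener_def pair_in_arc_matching)
  then show ?thesis using arc_right_closer[OF j(2)] by simp
qed

text \<open>Both bounds on the walk inside a pair come from the shorter arcs nested in it.\<close>

lemma pair_imp_arc:
  assumes P: "noncrossing_matching UNIV P"
  shows "{i, j} \<in> blocks P \<Longrightarrow> i < j \<Longrightarrow> walk_arc (opener P) i j"
proof (induction "nat (j - i)" arbitrary: i j rule: less_induct)
  case less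
  let ?a = "opener P"
  let ?S = "walk ?a"
  note ij = less.prems
  have inside: "(\<exists>s. ?a t = L \<and> walk_arc ?a t s \<and> s < j) \<or> (\<exists>s. ?a t = R \<and> walk_arc ?a s t \<and> i < s)"
    if t: "i < t" "t < j" for t
  proof -
    obtain s where s: "{t, s} \<in> blocks P" "i < s" "s < j" "s \<noteq> t"
      using partner_inside[OF P ij(1) t UNIV_I] .
    show ?thesis
    proof (cases "t < s")
      case True
      then show ?thesis using less.hyps[of s t] s t arc_left_opener by auto
    next
      case False
      then have "walk_arc ?a s t" using less.hyps[of t s] s t by (auto simp: insert_commute)
      then show ?thesis using s arc_right_closer by blast
    qed
  qed
  have i: "?S (i + 1) = ?S i + 1" using walk_Suc[of ?a i] opener_left[OF P ij] by simp
  have j: "?S (j + 1) = ?S j - 1" using walk_Suc[of ?a j] opener_right[OF P ij] by simp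
  \<comment> \<open>Going left from \<open>t\<close>, either the previous letter is an up step, or
    an arc nested under the pair ends at \<open>t - 1\<close> and is skipped without change of
    height.\<close>
  have low: "?S i < ?S t" if "i < t" "t \<le> j" for t
    using that
  proof (induction "nat (t - i)" arbitrary: t rule: less_induct)
    case (less t)
    show ?case
    proof (cases "t = i + 1")
      case False
      then have t: "i < t - 1" "t - 1 < j" using less.prems by auto
      from inside[OF t] consider "?a (t - 1) = L" | s where "walk_arc ?a s (t - 1)" "i < s" by blast
      then show ?thesis
      proof cases
        case 1
        then have "?S t = ?S (t - 1) + 1" using walk_Suc[of ?a "t - 1"] by simp
        then show ?thesis using less.hyps[of "t - 1"] t less.prems by simp
      next
        case 2
        then have "?S t = ?S s" "s < t" by (auto simp: walk_arc_def)
        then show ?thesis using less.hyps[of s] 2 less.prems by simp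
      qed
    qed (use i in simp)
  qed
  \<comment> \<open>The same to the right: a down step at \<open>t\<close>, or an arc starting at
    \<open>t\<close>, after which the walk is back at the same height.\<close>
  have high: "?S j \<le> ?S t" if "i < t" "t \<le> j" for t
    using that
  proof (induction "nat (j - t)" arbitrary: t rule: less_induct)
    case (less t)
    show ?case
    proof (cases "t = j")
      case False
      then have t: "i < t" "t < j" using less.prems by auto
      from inside[OF t] consider "?a t = R" | s where "walk_arc ?a t s" "s < j" by blast
      then show ?thesis
      proof cases
        case 1
        then have "?S (t + 1) = ?S t - 1" using walk_Suc[of ?a t] by simp
        then show ?thesis using less.hyps[of "t + 1"] t by simp
      next
        case 2
        then have "?S (s + 1) = ?S t" "t < s" by (auto simp: walk_arc_def)
        then show ?thesis using less.hyps[of "s + 1"] 2 less.prems by simp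
      qed
    qed simp
  qed
  \<comment> \<open>\<open>low\<close> at \<open>j\<close> gives \<open>?S j \<ge> ?S i + 1\<close>
    and \<open>high\<close> at \<open>i + 1\<close> the reverse inequality, so the down step at
    \<open>j\<close> returns exactly to the level of \<open>i\<close>.\<close>
  have "?S (j + 1) = ?S i" using low[of j] high[of "i + 1"] i j ij by simp
  then show ?case using low ij by (auto simp: walk_arc_def)
qed

text \<open>Phrased through arcs rather than through the existence of a matching, so that it is a
  countable combination of events that each depend on finitely many letters.\<close>

definition matchable :: "(int \<Rightarrow> side) \<Rightarrow> bool" where
  "matchable a \<longleftrightarrow> (\<forall>i. \<exists>j. walk_arc a i j \<or> walk_arc a j i)"

lemma matchable_iff: "matchable a \<longleftrightarrow> (\<exists>P. noncrossing_matching UNIV P \<and> has_openers a P)"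
proof
  assume "matchable a"
  then have *: "\<exists>j\<in>UNIV. walk_arc a i j \<or> walk_arc a j i" for i by (simp add: matchable_def)
  have "noncrossing_matching UNIV (arc_matching UNIV a)"
    using * by (intro arc_matching_noncrossing)
  moreover have "opener (arc_matching UNIV a) = a"
    using opener_arc_matching[OF *] by auto
  ultimately show "\<exists>P. noncrossing_matching UNIV P \<and> has_openers a P" by (auto simp: has_openers_iff)
next
  assume "\<exists>P. noncrossing_matching UNIV P \<and> has_openers a P"
  then obtain P where P: "noncrossing_matching UNIV P" and a: "a = opener P"
    by (auto simp: has_openers_iff)
  show "matchable a" unfolding matchable_def
  proof
    fix i
    obtain j where "{i, j} \<in> blocks P" "j \<noteq> i" using partner_exists[OF P UNIV_I] by blast
    then show "\<exists>j. walk_arc a i j \<or> walk_arc a j i"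
      using pair_imp_arc[OF P, of i j] pair_imp_arc[OF P, of j i] a
      by (metis insert_commute linorder_neqE)
  qed
qed

lemma noodle_matching_matchable:
  assumes "matchable a"
  shows "noncrossing_matching UNIV (noodle_matching a)" "opener (noodle_matching a) = a"
proof -
  have "\<exists>!P. noncrossing_matching UNIV P \<and> has_openers a P"
    using assms[unfolded matchable_iff]
    by (auto simp: has_openers_iff int_interval_def intro!: noncrossing_matching_eqI[of UNIV])
  from theI'[OF this]
  show "noncrossing_matching UNIV (noodle_matching a)" "opener (noodle_matching a) = a"
    by (auto simp: noodle_matching_def has_openers_iff)
qed

text \<open>The predicate under \<open>THE\<close> is identically false here, so all such sequences
  share one junk value, which \<open>noodle_eq_or_close\<close> exploits.\<close>

lemma noodle_matching_not_matchable:
  assumes "\<not> matchable a"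
  shows "noodle_matching a = (THE P. False)"
proof -
  have "(\<lambda>P. noncrossing_matching UNIV P \<and> has_openers a P) = (\<lambda>P. False)"
    using assms unfolding matchable_iff by blast
  then show ?thesis by (simp add: noodle_matching_def)
qed

section \<open>Counting non-crossing matchings up to a polynomial factor\<close>

definition nc_matchings :: "nat \<Rightarrow> matching set" where
  "nc_matchings n = {P. noncrossing_matching {0..<2 * int n} P}"

lemma meandric_systems_eq: "meandric_systems n = nc_matchings n \<times> nc_matchings n"
  by (auto simp: meandric_systems_def nc_matchings_def)

lemma opener_outside:
  assumes "noncrossing_matching A P" "i \<notin> A"
  shows "opener P i = R"
  using partner_mem[OF assms(1)] assms(2) by (auto simp: opener_def)

lemma inj_on_opener: "inj_on (\<lambda>P. restrict (opener P) {0..<2 * int n}) (nc_matchings n)"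
proof (rule inj_onI)
  fix P P' assume *: "P \<in> nc_matchings n" "P' \<in> nc_matchings n"
    and "restrict (opener P) {0..<2 * int n} = restrict (opener P') {0..<2 * int n}"
  then have "opener P t = opener P' t" if "t \<in> {0..<2 * int n}" for t
    using that by (metis restrict_apply')
  then show "P = P'"
    using * by (intro noncrossing_matching_eqI[of "{0..<2 * int n}" P P'])
      (auto simp: nc_matchings_def int_interval_def)
qed

instance side :: finite
proof
  have "(UNIV :: side set) = {L, R}" by (auto intro: side.exhaust)
  then show "finite (UNIV :: side set)" by (metis finite.emptyI finite.insertI)
qed

instance side :: countable
  by countable_datatype

lemma card_UNIV_side: "card (UNIV :: side set) = 2"
proof -
  have UNIV: "(UNIV :: side set) = {L, R}" by (auto intro: side.exhaust)
  show ?thesis unfolding UNIV by simp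
qed

lemma finite_nc_matchings [simp]: "finite (nc_matchings n)"
proof (rule finite_imageD[OF _ inj_on_opener])
  show "finite ((\<lambda>P. restrict (opener P) {0..<2 * int n}) ` nc_matchings n)"
    by (rule finite_subset[of _ "{0..<2 * int n} \<rightarrow>\<^sub>E UNIV"]) (auto intro: finite_PiE)
qed

lemma finite_meandric_systems [simp]: "finite (meandric_systems n)"
  by (simp add: meandric_systems_eq)

text \<open>Every balanced cyclic word, started at a minimum of its walk, is a Dyck word.\<close>

lemma balanced_word_rotation:
  assumes X: "X \<subseteq> {0..<2 * int n}" "card X = n" and n: "n > 0"
  obtains P t where "P \<in> nc_matchings n" "t \<in> {0..<2 * int n}"
    "X = {i \<in> {0..<2 * int n}. opener P ((i - t) mod (2 * int n)) = L}"
proof -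
  let ?N = "2 * int n"
  \<comment> \<open>The word of \<open>X\<close> is extended periodically; it is balanced, so its
    walk is periodic as well.\<close>
  define a where "a i = (if i mod ?N \<in> X then L else R)" for i
  have per: "a (i mod ?N) = a i" for i by (simp add: a_def)
  have per': "a (i + ?N) = a i" for i by (simp add: a_def)
  have "walk a ?N = (\<Sum>t\<in>{0..<?N}. side_step (a t))" by (simp add: walk_def)
  also have "\<dots> = (\<Sum>t\<in>X. side_step (a t)) + (\<Sum>t\<in>{0..<?N} - X. side_step (a t))"
    using X by (simp add: sum.subset_diff[of X "{0..<?N}"])
  also have "(\<Sum>t\<in>X. side_step (a t)) = (\<Sum>t\<in>X. 1)"
    using X by (intro sum.cong) (auto simp: a_def subset_iff)
  also have "(\<Sum>t\<in>{0..<?N} - X. side_step (a t)) = (\<Sum>t\<in>{0..<?N} - X. -1)"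
    by (intro sum.cong) (auto simp: a_def)
  also have "card ({0..<?N} - X) = 2 * n - n"
    using X by (subst card_Diff_subset) (auto intro: finite_subset)
  then have "(\<Sum>t\<in>X. (1::int)) + (\<Sum>t\<in>{0..<?N} - X. -1) = 0" using X by simp
  finally have "walk a (0 + ?N) = walk a 0" by simp
  then have walk_per: "walk a (i + ?N) = walk a i" for i
  proof (induction i rule: int_induct[where k = 0])
    case (step1 i)
    then show ?case using walk_Suc[of a i] walk_Suc[of a "i + ?N"] per'[of i]
      by (simp add: algebra_simps)
  next
    case (step2 i)
    then show ?case using walk_Suc[of a "i - 1"] walk_Suc[of a "i - 1 + ?N"] per'[of "i - 1"]
      by (simp add: algebra_simps)
  qed simp
  have "finite (walk a ` {0..<?N})" "walk a ` {0..<?N} \<noteq> {}" using n by auto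
  then have "Min (walk a ` {0..<?N}) \<in> walk a ` {0..<?N}" by (rule Min_in)
  then obtain t where t: "t \<in> {0..<?N}" "walk a t = Min (walk a ` {0..<?N})" by auto
  have min0: "walk a t \<le> walk a i" if "i \<in> {0..<?N}" for i
    unfolding t(2) using that by (intro Min_le) auto
  have min: "walk a t \<le> walk a i" if i: "t \<le> i" "i \<le> t + ?N" for i
  proof -
    consider "i < ?N" | "?N \<le> i" "i < 2 * ?N" using i t by force
    then show ?thesis
    proof cases
      case 1
      then show ?thesis using min0[of i] i t by auto
    next
      case 2
      then show ?thesis using min0[of "i - ?N"] walk_per[of "i - ?N"] by auto
    qed
  qed
  \<comment> \<open>One period starting at a minimum of the walk. Both ends are at minimal height,
    so every up step is closed before the right end and every down step was opened after the left
    end.\<close>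
  let ?A = "{t..<t + ?N}"
  have A: "\<exists>j\<in>?A. walk_arc a i j \<or> walk_arc a j i" if i: "i \<in> ?A" for i
  proof (cases "a i")
    case L
    have "walk a (t + ?N) \<le> walk a i" using min[of i] i walk_per by auto
    then obtain k where "walk_arc a i k" "k < t + ?N" using arc_from_opener[of a i "t + ?N"] L i by auto
    then show ?thesis using i by (intro bexI[of _ k]) (auto simp: walk_arc_def)
  next
    case R
    have "walk a t \<le> walk a (i + 1)" using min[of "i + 1"] i by auto
    then obtain k where "walk_arc a k i" "t \<le> k" using arc_to_closer[of a i t] R i by auto
    then show ?thesis using i by (intro bexI[of _ k]) (auto simp: walk_arc_def)
  qed
  define P where "P = shift_matching (- t) (arc_matching ?A a)"
  have "(\<lambda>i. i + (- t)) ` ?A = {0..<?N}"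
  proof (intro equalityI subsetI)
    fix i assume "i \<in> {0..<?N}"
    then have "i + t \<in> ?A" "i = (i + t) + (- t)" by auto
    then show "i \<in> (\<lambda>i. i + (- t)) ` ?A" by (rule rev_image_eqI)
  qed auto
  then have "noncrossing_matching {0..<?N} P"
    using noncrossing_matching_shift[OF arc_matching_noncrossing[OF A], of "- t"] by (simp add: P_def)
  moreover have op: "opener P i = a (i + t)" if "i \<in> {0..<?N}" for i
    using opener_arc_matching[OF A, of "i + t"] that by (simp add: P_def opener_shift)
  have "opener P ((i - t) mod ?N) = a i" for i
    using op[of "(i - t) mod ?N"] per[of "(i - t) mod ?N + t"] per[of i] n by (simp add: mod_simps)
  then have "X = {i \<in> {0..<?N}. opener P ((i - t) mod ?N) = L}"
    using X(1) by (auto simp: a_def subset_iff split: if_splits)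
  ultimately show thesis using that[of P t] t by (simp add: nc_matchings_def)
qed

text \<open>Pairs of a matching and a rotation map onto the balanced words, so the central binomial
  coefficient is at most \<open>2 * n\<close> times the count; its lower bound
  \<open>4 ^ n / (2 * n)\<close> costs the second factor.\<close>

lemma card_nc_matchings_ge:
  assumes n: "n > 0"
  shows "4 ^ n \<le> (2 * real n)\<^sup>2 * card (nc_matchings n)"
proof -
  let ?N = "2 * int n"
  let ?f = "\<lambda>(P, t). {i \<in> {0..<?N}. opener P ((i - t) mod ?N) = L}"
  have "{X. X \<subseteq> {0..<?N} \<and> card X = n} \<subseteq> ?f ` (nc_matchings n \<times> {0..<?N})"
  proof
    fix X assume "X \<in> {X. X \<subseteq> {0..<?N} \<and> card X = n}"
    then have X: "X \<subseteq> {0..<?N}" "card X = n" by auto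
    obtain P t where "P \<in> nc_matchings n" "t \<in> {0..<?N}" "X = ?f (P, t)"
      unfolding prod.case by (rule balanced_word_rotation[OF X n])
    then show "X \<in> ?f ` (nc_matchings n \<times> {0..<?N})" by (intro image_eqI[of _ _ "(P, t)"]) auto
  qed
  then have "card {X. X \<subseteq> {0..<?N} \<and> card X = n} \<le> card (nc_matchings n \<times> {0..<?N})"
    by (rule surj_card_le[rotated]) simp
  also have "card {X. X \<subseteq> {0..<?N} \<and> card X = n} = (2 * n) choose n"
    by (subst n_subsets) (auto simp: nat_mult_distrib)
  finally have "(2 * n) choose n \<le> card (nc_matchings n) * (2 * n)"
    by (simp add: card_cartesian_product nat_mult_distrib)
  then have "real ((2 * n) choose n) \<le> real (card (nc_matchings n)) * (2 * real n)"
    by (metis of_nat_le_iff of_nat_mult of_nat_numeral)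
  then have "2 * real n * real ((2 * n) choose n) \<le> 2 * real n * (real (card (nc_matchings n)) * (2 * real n))"
    by (rule mult_left_mono) simp
  moreover have "4 ^ n \<le> 2 * real n * real ((2 * n) choose n)"
    using central_binomial_lower_bound[OF n] n by (simp add: field_simps)
  ultimately show ?thesis by (simp add: power2_eq_square mult_ac)
qed

subsection \<open>Recurrence and finite-dimensional laws\<close>

text \<open>A preimage is a finite union of cells cut out by the coordinates in \<open>W\<close>.
  Only constancy of \<open>h\<close> on cells is asked for, because in
  \<open>borel_measurable_noodle\<close> the function is not presented as a function of the
  coordinates.\<close>

lemma measurable_determined:
  fixes X :: "'i \<Rightarrow> 'b \<Rightarrow> 'c::finite"
  assumes X: "\<And>i. X i \<in> measurable N (count_space UNIV)" and W: "finite W"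
    and h: "\<And>\<omega> \<omega>'. \<lbrakk>\<omega> \<in> space N; \<omega>' \<in> space N; \<And>i. i \<in> W \<Longrightarrow> X i \<omega> = X i \<omega>'\<rbrakk> \<Longrightarrow> h \<omega> = h \<omega>'"
  shows "h \<in> measurable N (count_space UNIV)"
proof (rule measurableI)
  fix A
  have [measurable]: "X i \<in> measurable N (count_space UNIV)" for i by (rule X)
  define S where "S = {p \<in> W \<rightarrow>\<^sub>E UNIV. \<exists>\<omega>\<in>space N. h \<omega> \<in> A \<and> (\<forall>i\<in>W. X i \<omega> = p i)}"
  have "finite S" unfolding S_def by (rule finite_subset[of _ "W \<rightarrow>\<^sub>E UNIV"]) (auto intro: finite_PiE W)
  have "h -` A \<inter> space N = (\<Union>p\<in>S. {\<omega> \<in> space N. \<forall>i\<in>W. X i \<omega> = p i})"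
  proof (intro equalityI subsetI)
    fix \<omega> assume "\<omega> \<in> h -` A \<inter> space N"
    then show "\<omega> \<in> (\<Union>p\<in>S. {\<omega> \<in> space N. \<forall>i\<in>W. X i \<omega> = p i})"
      by (intro UN_I[of "restrict (\<lambda>i. X i \<omega>) W"]) (auto simp: S_def intro!: bexI[of _ \<omega>])
  next
    fix \<omega> assume "\<omega> \<in> (\<Union>p\<in>S. {\<omega> \<in> space N. \<forall>i\<in>W. X i \<omega> = p i})"
    then obtain p \<omega>' where p: "\<omega> \<in> space N" "\<forall>i\<in>W. X i \<omega> = p i"
      "\<omega>' \<in> space N" "h \<omega>' \<in> A" "\<forall>i\<in>W. X i \<omega>' = p i" by (auto simp: S_def)
    then have "h \<omega> = h \<omega>'" by (intro h) auto
    then show "\<omega> \<in> h -` A \<inter> space N" using p by simp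
  qed
  moreover have "{\<omega> \<in> space N. \<forall>i\<in>W. X i \<omega> = p i} \<in> sets N" for p
    using W by measurable
  ultimately show "h -` A \<inter> space N \<in> sets N"
    using \<open>finite S\<close> by auto
qed simp

lemma measurable_finite_coordinates:
  fixes X :: "'i \<Rightarrow> 'b \<Rightarrow> 'c::finite"
  assumes "\<And>i. X i \<in> measurable N (count_space UNIV)" "finite W"
    and g: "\<And>x y. (\<And>i. i \<in> W \<Longrightarrow> x i = y i) \<Longrightarrow> g x = g y"
  shows "(\<lambda>\<omega>. g (\<lambda>i. X i \<omega>)) \<in> measurable N (count_space UNIV)"
  by (rule measurable_determined[OF assms(1,2)]) (rule g)

lemma (in prob_space)
  fixes h :: "'c \<Rightarrow> real"
  assumes S: "finite S" "\<And>\<omega>. \<omega> \<in> space M \<Longrightarrow> T \<omega> \<in> S"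
    and T: "\<And>p. p \<in> S \<Longrightarrow> {\<omega> \<in> space M. T \<omega> = p} \<in> events"
  shows integrable_finite_range: "integrable M (\<lambda>\<omega>. h (T \<omega>))"
    and expectation_finite_range:
      "expectation (\<lambda>\<omega>. h (T \<omega>)) = (\<Sum>p\<in>S. h p * prob {\<omega> \<in> space M. T \<omega> = p})"
proof -
  let ?g = "\<lambda>\<omega>. \<Sum>p\<in>S. h p * indicator {\<omega> \<in> space M. T \<omega> = p} \<omega>"
  have eq: "h (T \<omega>) = ?g \<omega>" if \<omega>: "\<omega> \<in> space M" for \<omega>
  proof -
    have "?g \<omega> = (\<Sum>p\<in>S. if p = T \<omega> then h p else 0)"
      using \<omega> by (intro sum.cong) (auto simp: indicator_def)
    then show ?thesis using S \<omega> by simp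
  qed
  have "integrable M ?g"
    using T by (intro Bochner_Integration.integrable_sum)
      (auto simp: integrable_indicator_iff emeasure_eq_measure)
  then show "integrable M (\<lambda>\<omega>. h (T \<omega>))"
    using Bochner_Integration.integrable_cong[OF refl eq, of M] by simp
  have "expectation (\<lambda>\<omega>. h (T \<omega>)) = expectation ?g"
    by (rule Bochner_Integration.integral_cong[OF refl eq])
  also have "\<dots> = (\<Sum>p\<in>S. h p * prob {\<omega> \<in> space M. T \<omega> = p})"
    using T by (subst Bochner_Integration.integral_sum) (auto simp: integrable_indicator_iff emeasure_eq_measure)
  finally show "expectation (\<lambda>\<omega>. h (T \<omega>)) = (\<Sum>p\<in>S. h p * prob {\<omega> \<in> space M. T \<omega> = p})" .
qed

lemma (in prob_space) expectation_uniform_on_finite: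
  fixes h :: "'c \<Rightarrow> real"
  assumes T: "T \<in> measurable M (count_space UNIV)" and S: "finite S" "\<And>\<omega>. \<omega> \<in> space M \<Longrightarrow> T \<omega> \<in> S"
    and q: "\<And>p. p \<in> S \<Longrightarrow> prob {\<omega> \<in> space M. T \<omega> = p} = q"
  shows "expectation (\<lambda>\<omega>. h (T \<omega>)) = q * (\<Sum>p\<in>S. h p)"
proof -
  note [measurable] = T
  have "expectation (\<lambda>\<omega>. h (T \<omega>)) = (\<Sum>p\<in>S. h p * prob {\<omega> \<in> space M. T \<omega> = p})"
    by (rule expectation_finite_range[OF S]) measurable
  also have "\<dots> = (\<Sum>p\<in>S. h p * q)" using q by simp
  finally show ?thesis by (simp add: sum_distrib_left mult.commute)
qed

lemma (in prob_space) expectation_finite_coordinates: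
  fixes X :: "'i \<Rightarrow> 'a \<Rightarrow> 'c::finite" and h :: "('i \<Rightarrow> 'c) \<Rightarrow> real"
  assumes X: "\<And>i. X i \<in> measurable M (count_space UNIV)" and W: "finite W"
    and h: "\<And>x y. (\<And>i. i \<in> W \<Longrightarrow> x i = y i) \<Longrightarrow> h x = h y"
    and q: "\<And>p. prob {\<omega> \<in> space M. \<forall>i\<in>W. X i \<omega> = p i} = q"
  shows "expectation (\<lambda>\<omega>. h (\<lambda>i. X i \<omega>)) = q * (\<Sum>p\<in>W \<rightarrow>\<^sub>E UNIV. h p)"
proof -
  have "expectation (\<lambda>\<omega>. h (restrict (\<lambda>i. X i \<omega>) W)) = q * (\<Sum>p\<in>W \<rightarrow>\<^sub>E UNIV. h p)"
  proof (rule expectation_uniform_on_finite[where T = "\<lambda>\<omega>. restrict (\<lambda>i. X i \<omega>) W" and h = h])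
    show "(\<lambda>\<omega>. restrict (\<lambda>i. X i \<omega>) W) \<in> measurable M (count_space UNIV)"
      by (rule measurable_finite_coordinates[OF X W, of "\<lambda>x. restrict x W"]) auto
    show "finite (W \<rightarrow>\<^sub>E (UNIV :: 'c set))" by (intro finite_PiE W) auto
    show "restrict (\<lambda>i. X i \<omega>) W \<in> W \<rightarrow>\<^sub>E UNIV" for \<omega> by auto
    fix p :: "'i \<Rightarrow> 'c" assume "p \<in> W \<rightarrow>\<^sub>E UNIV"
    then have "restrict (\<lambda>i. X i \<omega>) W = p \<longleftrightarrow> (\<forall>i\<in>W. X i \<omega> = p i)" for \<omega>
      by (auto simp: restrict_def fun_eq_iff PiE_def extensional_def)
    then show "prob {\<omega> \<in> space M. restrict (\<lambda>i. X i \<omega>) W = p} = q" using q[of p] by simp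
  qed
  moreover have "h (restrict (\<lambda>i. X i \<omega>) W) = h (\<lambda>i. X i \<omega>)" for \<omega> by (rule h) simp
  ultimately show ?thesis by simp
qed

section \<open>Survival of the simple random walk on the half-line\<close>

primrec stays_nonneg :: "int \<Rightarrow> side list \<Rightarrow> bool" where
  "stays_nonneg x [] \<longleftrightarrow> 0 \<le> x"
| "stays_nonneg x (s # w) \<longleftrightarrow> 0 \<le> x \<and> stays_nonneg (x + side_step s) w"

text \<open>Probability that a simple random walk from \<open>x\<close> stays nonnegative for
  \<open>n\<close> steps. As a count of words it satisfies the first-step recursion without
  reference to a probability space.\<close>

definition survival :: "nat \<Rightarrow> int \<Rightarrow> real" where
  "survival n x = card {w. length w = n \<and> stays_nonneg x w} / 2 ^ n"

lemma finite_words: "finite {w :: side list. length w = n \<and> P w}"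
proof (rule finite_subset)
  show "finite {w :: side list. set w \<subseteq> UNIV \<and> length w = n}" by (rule finite_lists_length_eq) simp
qed auto

lemma survival_neg: "x < 0 \<Longrightarrow> survival n x = 0"
proof -
  assume "x < 0"
  then have "\<not> stays_nonneg x w" for w by (cases w) auto
  then show ?thesis by (simp add: survival_def)
qed

lemma survival_0: "survival 0 x = (if 0 \<le> x then 1 else 0)"
proof -
  have "{w. length w = 0 \<and> stays_nonneg x w} = (if 0 \<le> x then {[]} else {})" by auto
  then show ?thesis by (simp add: survival_def)
qed

lemma survival_Suc:
  assumes "0 \<le> x"
  shows "survival (Suc n) x = (survival n (x + 1) + survival n (x - 1)) / 2"
proof -
  let ?W = "\<lambda>n x. {w. length w = n \<and> stays_nonneg x w}"
  have "?W (Suc n) x = (#) L ` ?W n (x + 1) \<union> (#) R ` ?W n (x - 1)"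
  proof (intro set_eqI)
    fix w show "w \<in> ?W (Suc n) x \<longleftrightarrow> w \<in> (#) L ` ?W n (x + 1) \<union> (#) R ` ?W n (x - 1)"
    proof (cases w)
      case (Cons s v)
      then show ?thesis using assms by (cases s) auto
    qed auto
  qed
  also have "card \<dots> = card ((#) L ` ?W n (x + 1)) + card ((#) R ` ?W n (x - 1))"
    by (rule card_Un_disjoint) (auto intro: finite_words)
  also have "\<dots> = card (?W n (x + 1)) + card (?W n (x - 1))"
    by (simp add: card_image)
  finally show ?thesis by (simp add: survival_def add_divide_distrib)
qed

lemma survival_nonneg: "0 \<le> survival n x"
  by (simp add: survival_def)

lemma survival_decseq: "survival (Suc n) x \<le> survival n x"
proof (induction n arbitrary: x)
  case 0
  show ?case by (cases "0 \<le> x") (auto simp: survival_Suc survival_0 survival_neg)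
next
  case (Suc n)
  show ?case
  proof (cases "0 \<le> x")
    case True
    show ?thesis
      unfolding survival_Suc[OF True, of n] survival_Suc[OF True, of "Suc n"]
      using Suc[of "x + 1"] Suc[of "x - 1"] by simp
  qed (simp add: survival_neg)
qed

text \<open>The limit is a bounded discrete harmonic function on the half-line with boundary value 0, hence
  linear, hence 0.\<close>

lemma survival_tendsto_0: "(\<lambda>n. survival n x) \<longlonglongrightarrow> 0"
proof -
  have dec: "decseq (\<lambda>n. survival n x)" for x by (simp add: decseq_Suc_iff survival_decseq)
  have "\<exists>l. (\<lambda>n. survival n x) \<longlonglongrightarrow> l" for x
    using decseq_convergent[OF dec, of 0] survival_nonneg by metis
  then obtain q where q: "\<And>x. (\<lambda>n. survival n x) \<longlonglongrightarrow> q x" by metis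
  have harm: "q (x + 1) = 2 * q x - q (x - 1)" if "0 \<le> x" for x
  proof -
    have "(\<lambda>n. survival (Suc n) x) \<longlonglongrightarrow> (q (x + 1) + q (x - 1)) / 2"
      unfolding survival_Suc[OF that] by (intro tendsto_intros q) simp
    moreover have "(\<lambda>n. survival (Suc n) x) \<longlonglongrightarrow> q x" using q by (rule LIMSEQ_Suc)
    ultimately have "q x = (q (x + 1) + q (x - 1)) / 2" by (rule LIMSEQ_unique[rotated])
    then show ?thesis by simp
  qed
  have neg: "q x = 0" if "x < 0" for x
    using LIMSEQ_unique[OF q, of x 0] that by (simp add: survival_neg)
  \<comment> \<open>With boundary value \<open>q (-1) = 0\<close>, harmonicity determines
    \<open>q\<close> from \<open>q 0\<close>. Two consecutive values are carried along since the
    recursion is of second order.\<close>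
  have lin: "q (int n) = (real n + 1) * q 0 \<and> q (int n - 1) = real n * q 0" for n
  proof (induction n)
    case (Suc n)
    then show ?case using harm[of "int n"] by (simp add: algebra_simps)
  qed (simp add: neg)
  have le1: "q x \<le> 1" for x
  proof -
    have "q x \<le> survival 0 x" using decseq_ge[OF dec q, of x 0] by simp
    then show ?thesis by (simp add: survival_0 split: if_splits)
  qed
  have "0 \<le> q 0" by (rule LIMSEQ_le_const[OF q]) (use survival_nonneg in auto)
  moreover have "\<not> 0 < q 0"
  proof
    assume "0 < q 0"
    then obtain n where "1 < real n * q 0" using reals_Archimedean3 by blast
    moreover have "q (int n) = real n * q 0 + q 0" using lin[of n] by (simp add: distrib_right)
    ultimately show False using le1[of "int n"] \<open>0 < q 0\<close> by linarith
  qed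
  ultimately have q0: "q 0 = 0" by simp
  have "q x = 0"
  proof (cases "x < 0")
    case False
    then show ?thesis using lin[of "nat x"] q0 by simp
  qed (rule neg)
  then show ?thesis using q[of x] by simp
qed

lemma stays_nonneg_map:
  assumes "\<And>k. 0 \<le> x + (\<Sum>t<k. side_step (X t))"
  shows "stays_nonneg x (map X [0..<n])"
  using assms
proof (induction n arbitrary: x X)
  case 0
  show ?case using 0[of 0] by simp
next
  case (Suc n)
  have "0 \<le> x + side_step (X 0) + (\<Sum>t<k. side_step (X (Suc t)))" for k
    using Suc.prems[of "Suc k"] by (simp only: sum.lessThan_Suc_shift add.assoc)
  then have "stays_nonneg (x + side_step (X 0)) (map (\<lambda>t. X (Suc t)) [0..<n])"
    by (rule Suc.IH)
  moreover have "0 \<le> x" using Suc.prems[of 0] by simp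
  ultimately show ?case by (simp add: map_upt_Suc del: upt_Suc)
qed

primrec flip :: "side \<Rightarrow> side" where "flip L = R" | "flip R = L"

lemma flip_flip [simp]: "flip (flip s) = s"
  by (cases s) auto

lemma side_step_flip [simp]: "side_step (flip s) = - side_step s"
  by (cases s) auto

text \<open>An up step at \<open>i\<close> is unmatched only if the walk never falls below its
  height just after \<open>i\<close>. An unmatched down step is the same phenomenon for the path
  read leftwards from \<open>i - 1\<close>, where \<open>flip\<close> reverses the sign of each
  step.\<close>

lemma not_matchable_imp_survival:
  assumes "\<not> matchable a"
  shows "\<exists>i. (\<forall>n. 0 \<le> (\<Sum>t<n. side_step (a (i + 1 + int t)))) \<or>
             (\<forall>n. 0 \<le> (\<Sum>t<n. side_step (flip (a (i - 1 - int t)))))"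
proof -
  obtain i where i: "\<And>j. \<not> walk_arc a i j \<and> \<not> walk_arc a j i" using assms by (auto simp: matchable_def)
  show ?thesis
  proof (cases "a i")
    case L
    have "0 \<le> (\<Sum>t<n. side_step (a (i + 1 + int t)))" for n
    proof -
      have "walk a (i + 1 + int n) = walk a i + 1 + (\<Sum>t<n. side_step (a (i + 1 + int t)))"
      proof (induction n)
        case 0
        show ?case using walk_Suc[of a i] L by simp
      next
        case (Suc n)
        then show ?case using walk_Suc[of a "i + 1 + int n"] by (simp add: algebra_simps)
      qed
      moreover have "walk a i < walk a (i + 1 + int n)"
        using arc_from_opener[of a i "i + 1 + int n"] L i by force
      ultimately show ?thesis by simp
    qed
    then show ?thesis by blast
  next
    case R
    have "0 \<le> (\<Sum>t<n. side_step (flip (a (i - 1 - int t))))" for n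
    proof -
      have "walk a (i - int n) = walk a i + (\<Sum>t<n. side_step (flip (a (i - 1 - int t))))"
      proof (induction n)
        case (Suc n)
        have "walk a (i - int n) = walk a (i - 1 - int n) + side_step (a (i - 1 - int n))"
          using walk_Suc[of a "i - 1 - int n"] by (simp add: algebra_simps)
        then show ?case using Suc by (simp add: algebra_simps)
      qed simp
      moreover have "walk a (i + 1) < walk a (i - int n)"
        using arc_to_closer[of a i "i - int n"] R i by force
      moreover have "walk a (i + 1) = walk a i - 1" using walk_Suc[of a i] R by simp
      ultimately show ?thesis by simp
    qed
    then show ?thesis by blast
  qed
qed

section \<open>Laws of finitely many letters and almost sure matchability\<close>

lemma uniform_rv_range: "uniform_rv N X S \<Longrightarrow> \<omega> \<in> space N \<Longrightarrow> X \<omega> \<in> S"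
  by (auto simp: uniform_rv_def dest: measurable_space)

lemma uniform_rv_sets:
  assumes "uniform_rv N X S"
  shows "{\<omega> \<in> space N. X \<omega> \<in> B} \<in> sets N"
proof -
  have "X -` (B \<inter> S) \<inter> space N \<in> sets N"
    using assms by (intro measurable_sets[of X N "count_space S"]) (auto simp: uniform_rv_def)
  also have "X -` (B \<inter> S) \<inter> space N = {\<omega> \<in> space N. X \<omega> \<in> B}"
    using uniform_rv_range[OF assms] by auto
  finally show ?thesis .
qed

lemma uniform_rv_prob:
  assumes X: "uniform_rv N X S" and s: "s \<in> S" "finite S"
  shows "measure N {\<omega> \<in> space N. X \<omega> = s} = 1 / card S"
proof -
  have "measure (distr N (count_space S) X) {s} = 1 / card S"
    using X s by (simp add: uniform_rv_def measure_uniform_count_measure)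
  then show ?thesis using X s
    by (subst (asm) measure_distr) (auto simp: uniform_rv_def vimage_def Int_def conj_commute)
qed

lemma fair_iid_measurable: "fair_iid Q a \<Longrightarrow> a i \<in> measurable Q (count_space UNIV)"
  by (simp add: fair_iid_def uniform_rv_def)

lemma (in prob_space) fair_iid_prob:
  assumes a: "fair_iid M a" and W: "finite W"
  shows "prob {\<omega> \<in> space M. \<forall>i\<in>W. a i \<omega> = u i} = (1 / 2) ^ card W"
proof (cases "W = {}")
  case False
  have "prob (\<Inter>i\<in>W. a i -` {u i} \<inter> space M) = (\<Prod>i\<in>W. prob (a i -` {u i} \<inter> space M))"
    by (rule indep_varsD[where I = UNIV and M' = "\<lambda>_. count_space UNIV"])
       (use a W False in \<open>auto simp: fair_iid_def\<close>)
  also have "\<dots> = (\<Prod>i\<in>W. 1 / 2)"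
  proof (rule prod.cong)
    fix i
    have "uniform_rv M (a i) UNIV" using a by (simp add: fair_iid_def)
    from uniform_rv_prob[OF this, of "u i"] have "prob {\<omega> \<in> space M. a i \<omega> = u i} = 1 / 2"
      by (simp add: card_UNIV_side)
    then show "prob (a i -` {u i} \<inter> space M) = 1 / 2"
      by (simp add: vimage_def Int_def conj_commute)
  qed simp
  also have "(\<Inter>i\<in>W. a i -` {u i} \<inter> space M) = {\<omega> \<in> space M. \<forall>i\<in>W. a i \<omega> = u i}"
    using False by auto
  finally show ?thesis by simp
qed (simp add: prob_space)

text \<open>The injection \<open>\<iota>\<close> lists the letters in reading order and the
  involution \<open>f\<close> will be the identity or \<open>flip\<close>, so one statement serves
  both directions of the walk.\<close>

lemma (in prob_space) fair_iid_survival: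
  assumes a: "fair_iid M a" and \<iota>: "inj \<iota>" and f: "\<And>s. f (f s) = s"
  shows "AE \<omega> in M. \<exists>n. \<not> stays_nonneg 0 (map (\<lambda>t. f (a (\<iota> t) \<omega>)) [0..<n])"
proof -
  note [measurable] = fair_iid_measurable[OF a]
  let ?T = "\<lambda>n \<omega>. map (\<lambda>t. f (a (\<iota> t) \<omega>)) [0..<n]"
  let ?E = "\<lambda>n. {\<omega> \<in> space M. stays_nonneg 0 (?T n \<omega>)}"
  have T [measurable]: "?T n \<in> measurable M (count_space UNIV)" for n
    using measurable_finite_coordinates[of "\<lambda>t. a (\<iota> t)" M "{..<n}" "\<lambda>x. map (\<lambda>t. f (x t)) [0..<n]"]
    by (simp add: fair_iid_measurable[OF a])
  have word: "prob {\<omega> \<in> space M. ?T n \<omega> = w} = (1 / 2) ^ n" if w: "length w = n" for n w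
  proof -
    have eq: "?T n \<omega> = w \<longleftrightarrow> (\<forall>i\<in>\<iota> ` {..<n}. a i \<omega> = f (w ! inv \<iota> i))" for \<omega>
    proof -
      have "?T n \<omega> = w \<longleftrightarrow> (\<forall>t<n. f (a (\<iota> t) \<omega>) = w ! t)"
        using w by (auto simp: list_eq_iff_nth_eq)
      also have "\<dots> \<longleftrightarrow> (\<forall>t<n. a (\<iota> t) \<omega> = f (w ! t))" by (metis f)
      finally show ?thesis using \<iota> by auto
    qed
    have "card (\<iota> ` {..<n}) = n" using \<iota> by (subst card_image) (auto intro: inj_on_subset)
    then show ?thesis unfolding eq by (subst fair_iid_prob[OF a]) auto
  qed
  have E: "prob (?E n) = survival n 0" for n
  proof -
    have "prob (?E n) = expectation (indicator (?E n))" by simp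
    also have "\<dots> = expectation (\<lambda>\<omega>. indicator {w. stays_nonneg 0 w} (?T n \<omega>))"
      by (rule Bochner_Integration.integral_cong) (auto simp: indicator_def)
    also have "\<dots> = (1 / 2) ^ n * (\<Sum>w\<in>{w. length w = n}. indicator {w. stays_nonneg 0 w} w)"
      by (rule expectation_uniform_on_finite[OF T])
         (use word finite_words[of n "\<lambda>_. True"] in auto)
    also have "(\<Sum>w\<in>{w. length w = n}. indicator {w. stays_nonneg 0 w} w) =
        (\<Sum>w\<in>{w. length w = n \<and> stays_nonneg 0 w}. (1::real))"
      using finite_words[of n "\<lambda>_. True"] by (intro sum.mono_neutral_cong_right) auto
    finally show ?thesis by (simp add: survival_def power_divide)
  qed
  have "prob {\<omega> \<in> space M. \<forall>n. stays_nonneg 0 (?T n \<omega>)} \<le> survival n 0" for n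
    unfolding E[symmetric] by (intro finite_measure_mono) auto
  then have "prob {\<omega> \<in> space M. \<forall>n. stays_nonneg 0 (?T n \<omega>)} \<le> 0"
    by (intro LIMSEQ_le_const[OF survival_tendsto_0]) auto
  then have "prob {\<omega> \<in> space M. \<forall>n. stays_nonneg 0 (?T n \<omega>)} = 0" 
    using measure_nonneg by (rule antisym)
  moreover have "{\<omega> \<in> space M. \<forall>n. stays_nonneg 0 (?T n \<omega>)} \<in> sets M" by measurable
  ultimately have "AE \<omega> in M. \<omega> \<notin> {\<omega> \<in> space M. \<forall>n. stays_nonneg 0 (?T n \<omega>)}"
    by (simp add: prob_eq_0)
  then show ?thesis using AE_space by eventually_elim auto
qed

lemma (in prob_space) AE_matchable:
  assumes a: "fair_iid M a"
  shows "AE \<omega> in M. matchable (\<lambda>i. a i \<omega>)"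
proof -
  have 1: "AE \<omega> in M. \<forall>i. \<exists>n. \<not> stays_nonneg 0 (map (\<lambda>t. a (i + 1 + int t) \<omega>) [0..<n])"
    unfolding AE_all_countable
    using fair_iid_survival[OF a, of "\<lambda>t. _ + 1 + int t" "\<lambda>s. s"] by (simp add: inj_def)
  have 2: "AE \<omega> in M. \<forall>i. \<exists>n. \<not> stays_nonneg 0 (map (\<lambda>t. flip (a (i - 1 - int t) \<omega>)) [0..<n])"
    unfolding AE_all_countable
    using fair_iid_survival[OF a, of "\<lambda>t. _ - 1 - int t" flip] by (simp add: inj_def)
  from 1 2 show ?thesis
  proof eventually_elim
    case (elim \<omega>)
    show ?case
    proof (rule ccontr)
      assume "\<not> matchable (\<lambda>i. a i \<omega>)"
      then obtain i where
        "(\<forall>n. 0 \<le> (\<Sum>t<n. side_step (a (i + 1 + int t) \<omega>))) \<or>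
         (\<forall>n. 0 \<le> (\<Sum>t<n. side_step (flip (a (i - 1 - int t) \<omega>))))"
        using not_matchable_imp_survival by blast
      then have "(\<forall>n. stays_nonneg 0 (map (\<lambda>t. a (i + 1 + int t) \<omega>) [0..<n])) \<or>
          (\<forall>n. stays_nonneg 0 (map (\<lambda>t. flip (a (i - 1 - int t) \<omega>)) [0..<n]))"
        using stays_nonneg_map[of 0 "\<lambda>t. a (i + 1 + int t) \<omega>"]
          stays_nonneg_map[of 0 "\<lambda>t. flip (a (i - 1 - int t) \<omega>)"] by auto
      then show False using elim by blast
    qed
  qed
qed

lemma walk_cong: "(\<And>t. \<bar>t\<bar> \<le> \<bar>i\<bar> \<Longrightarrow> a t = a' t) \<Longrightarrow> walk a i = walk a' i"
  unfolding walk_def by (intro arg_cong2[where f = minus] sum.cong) auto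

lemma walk_arc_cong:
  assumes "\<And>t. \<bar>t\<bar> \<le> \<bar>i\<bar> + \<bar>j\<bar> + 1 \<Longrightarrow> a t = a' t"
  shows "walk_arc a i j = walk_arc a' i j"
proof -
  have "walk a t = walk a' t" if "\<bar>t\<bar> \<le> \<bar>i\<bar> + \<bar>j\<bar> + 1" for t
    using that by (intro walk_cong assms) auto
  then show ?thesis unfolding walk_arc_def by (auto simp: abs_if)
qed

lemma measurable_matchable:
  assumes "\<And>i. a i \<in> measurable N (count_space UNIV)"
  shows "Measurable.pred N (\<lambda>\<omega>. matchable (\<lambda>i. a i \<omega>))"
proof -
  have [measurable]: "Measurable.pred N (\<lambda>\<omega>. walk_arc (\<lambda>i. a i \<omega>) i j)" for i j
  proof (rule measurable_finite_coordinates[of a N "{- (\<bar>i\<bar> + \<bar>j\<bar> + 1)..\<bar>i\<bar> + \<bar>j\<bar> + 1}" "\<lambda>x. walk_arc x i j"])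
    show "walk_arc x i j = walk_arc y i j"
      if "\<And>t. t \<in> {- (\<bar>i\<bar> + \<bar>j\<bar> + 1)..\<bar>i\<bar> + \<bar>j\<bar> + 1} \<Longrightarrow> x t = y t" for x y
      by (rule walk_arc_cong, rule that) (auto simp: abs_le_iff)
  qed (simp_all add: assms)
  show ?thesis unfolding matchable_def by measurable
qed

lemma (in prob_space) fair_pair_prob:
  assumes a: "fair_iid M a" and b: "fair_iid M b" and W: "finite W"
    and ind: "indep_var (PiM UNIV (\<lambda>_. count_space UNIV)) (\<lambda>\<omega> i. a i \<omega>)
                        (PiM UNIV (\<lambda>_. count_space UNIV)) (\<lambda>\<omega> i. b i \<omega>)"
  shows "prob {\<omega> \<in> space M. \<forall>i\<in>W. (a i \<omega>, b i \<omega>) = p i} = (1 / 4) ^ card W"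
proof -
  let ?N = "PiM UNIV (\<lambda>_. count_space UNIV) :: (int \<Rightarrow> side) measure"
  have S: "{x \<in> space ?N. \<forall>i\<in>W. x i = u i} \<in> sets ?N" for u
    using W by measurable
  have "prob {\<omega> \<in> space M. \<forall>i\<in>W. (a i \<omega>, b i \<omega>) = p i} =
      prob ((\<lambda>\<omega>. (\<lambda>i. a i \<omega>, \<lambda>i. b i \<omega>)) -`
        ({x \<in> space ?N. \<forall>i\<in>W. x i = fst (p i)} \<times> {x \<in> space ?N. \<forall>i\<in>W. x i = snd (p i)}) \<inter> space M)"
    by (rule arg_cong[where f = prob]) (auto simp: space_PiM prod_eq_iff)
  also have "\<dots> = prob ((\<lambda>\<omega> i. a i \<omega>) -` {x \<in> space ?N. \<forall>i\<in>W. x i = fst (p i)} \<inter> space M) *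
      prob ((\<lambda>\<omega> i. b i \<omega>) -` {x \<in> space ?N. \<forall>i\<in>W. x i = snd (p i)} \<inter> space M)"
    by (rule indep_varD[OF ind S S])
  also have "(\<lambda>\<omega> i. a i \<omega>) -` {x \<in> space ?N. \<forall>i\<in>W. x i = fst (p i)} \<inter> space M =
      {\<omega> \<in> space M. \<forall>i\<in>W. a i \<omega> = fst (p i)}" by (auto simp: space_PiM)
  also have "(\<lambda>\<omega> i. b i \<omega>) -` {x \<in> space ?N. \<forall>i\<in>W. x i = snd (p i)} \<inter> space M =
      {\<omega> \<in> space M. \<forall>i\<in>W. b i \<omega> = snd (p i)}" by (auto simp: space_PiM)
  finally show ?thesis
    unfolding fair_iid_prob[OF a W] fair_iid_prob[OF b W] by (simp flip: power_mult_distrib)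
qed

subsection \<open>Local suprema\<close>

definition cylinder :: "nat \<Rightarrow> (int \<Rightarrow> side \<times> side) \<Rightarrow> marked_system set" where
  "cylinder m p = {x. \<exists>A U D r. x = mark (U, D) r \<and> int_interval A \<and>
     noncrossing_matching A U \<and> noncrossing_matching A D \<and> {r - int m..r + int m} \<subseteq> A \<and>
     (\<forall>t. \<bar>t\<bar> \<le> int m \<longrightarrow> (opener U (r + t), opener D (r + t)) = p t)}"

lemma cylinder_cong:
  assumes "\<And>t. \<bar>t\<bar> \<le> int m \<Longrightarrow> p t = p' t"
  shows "cylinder m p = cylinder m p'"
proof -
  have "(\<forall>t. \<bar>t\<bar> \<le> int m \<longrightarrow> f t = p t) \<longleftrightarrow> (\<forall>t. \<bar>t\<bar> \<le> int m \<longrightarrow> f t = p' t)" for f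
    using assms by auto
  then show ?thesis unfolding cylinder_def by simp
qed

lemma mark_agree_dist:
  assumes "marked_pms (M, r)" "marked_pms (N, s)" "agree (Suc k) (M, r) (N, s)"
  shows "dist (mark M r) (mark N s) < 1 / (1 + real k)"
  using assms by (simp add: dist_mark local_dist_less_iff)

lemma cylinder_dist:
  assumes "x \<in> cylinder (Suc k) p" "y \<in> cylinder (Suc k) p"
  shows "dist x y < 1 / (1 + real k)"
proof -
  obtain A U D r where x: "x = mark (U, D) r" "int_interval A"
    "noncrossing_matching A U" "noncrossing_matching A D" "{r - int (Suc k)..r + int (Suc k)} \<subseteq> A"
    "\<And>t. \<bar>t\<bar> \<le> int (Suc k) \<Longrightarrow> (opener U (r + t), opener D (r + t)) = p t"
    using assms(1) unfolding cylinder_def by blast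
  obtain A' U' D' r' where y: "y = mark (U', D') r'" "int_interval A'"
    "noncrossing_matching A' U'" "noncrossing_matching A' D'" "{r' - int (Suc k)..r' + int (Suc k)} \<subseteq> A'"
    "\<And>t. \<bar>t\<bar> \<le> int (Suc k) \<Longrightarrow> (opener U' (r' + t), opener D' (r' + t)) = p t"
    using assms(2) unfolding cylinder_def by blast
  have "r \<in> A" "r' \<in> A'" using x(5) y(5) by auto
  have "opener U (r + t) = opener U' (r' + t) \<and> opener D (r + t) = opener D' (r' + t)"
    if "\<bar>t\<bar> \<le> int (Suc k)" for t
    using x(6)[OF that] y(6)[OF that] by (metis prod.inject)
  then have "agree (Suc k) ((U, D), r) ((U', D'), r')"
    by (intro agreeI[OF x(3,4) y(3,4) x(5) y(5)]) auto
  then show ?thesis unfolding x(1) y(1)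
    using marked_pms_noncrossing x y \<open>r \<in> A\<close> \<open>r' \<in> A'\<close> by (intro mark_agree_dist) auto
qed

lemma noodle_in_cylinder:
  assumes "matchable a" "matchable b"
  shows "mark (noodle a b) 0 \<in> cylinder m (\<lambda>t. (a t, b t))"
  unfolding cylinder_def noodle_def
  by (rule CollectI, rule exI[of _ UNIV], rule exI[of _ "noodle_matching a"],
      rule exI[of _ "noodle_matching b"], rule exI[of _ 0])
     (simp add: int_interval_def noodle_matching_matchable assms)

text \<open>Adjoining 0 keeps the supremum in the range of a nonnegative \<^term>\<open>F\<close> without knowing that
  the cylinder is inhabited.\<close>

definition cylinder_sup :: "(marked_system \<Rightarrow> real) \<Rightarrow> nat \<Rightarrow> (int \<Rightarrow> side \<times> side) \<Rightarrow> real" where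
  "cylinder_sup F m p = Sup (insert 0 (F ` cylinder m p))"

lemma cylinder_sup_cong:
  "(\<And>t. \<bar>t\<bar> \<le> int m \<Longrightarrow> p t = p' t) \<Longrightarrow> cylinder_sup F m p = cylinder_sup F m p'"
  unfolding cylinder_sup_def using cylinder_cong[of m p p'] by simp

context
  fixes F :: "marked_system \<Rightarrow> real" and C :: real
  assumes F0: "\<And>x. 0 \<le> F x" and FC: "\<And>x. F x \<le> C"
begin

lemma bdd_above_F: "bdd_above (F ` S)"
  using FC by (intro bdd_aboveI2) auto

lemma cylinder_sup_nonneg: "0 \<le> cylinder_sup F m p"
  unfolding cylinder_sup_def by (intro cSup_upper) (auto simp: bdd_above_F)

lemma cylinder_sup_le: "cylinder_sup F m p \<le> C"
  unfolding cylinder_sup_def using order_trans[OF F0 FC] FC by (intro cSup_least) auto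

lemma cylinder_sup_upper: "x \<in> cylinder m p \<Longrightarrow> F x \<le> cylinder_sup F m p"
  unfolding cylinder_sup_def by (intro cSup_upper) (auto simp: bdd_above_F)

text \<open>The cylinders all contain \<open>x\<close> and their diameters tend to 0, so continuity
  at \<open>x\<close> squeezes the suprema. The rate depends on \<open>x\<close>, so the limit is
  pointwise and is later integrated by dominated convergence.\<close>

lemma cylinder_sup_tendsto:
  assumes F: "continuous_on UNIV F" and x: "\<And>m. x \<in> cylinder m p"
  shows "(\<lambda>m. cylinder_sup F m p) \<longlonglongrightarrow> F x"
proof (rule LIMSEQ_I)
  fix e :: real assume "0 < e"
  then obtain d where d: "d > 0" "\<And>y. dist y x < d \<Longrightarrow> dist (F y) (F x) < e / 2"
    using F unfolding continuous_on_iff by (metis UNIV_I half_gt_zero)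
  obtain k where k: "1 / (1 + real k) < d"
    using reals_Archimedean[OF d(1)] by (auto simp: inverse_eq_divide)
  have "norm (cylinder_sup F m p - F x) < e" if "m \<ge> Suc k" for m
  proof -
    obtain j where j: "m = Suc j" "j \<ge> k" using \<open>m \<ge> Suc k\<close> by (cases m) auto
    have jd: "1 / (1 + real j) < d" using j k by (smt (verit) frac_le of_nat_0_le_iff of_nat_mono)
    have "cylinder_sup F m p \<le> F x + e / 2"
      unfolding cylinder_sup_def
    proof (rule cSup_least)
      fix z assume "z \<in> insert 0 (F ` cylinder m p)"
      then consider "z = 0" | y where "y \<in> cylinder m p" "z = F y" by blast
      then show "z \<le> F x + e / 2"
      proof cases
        case 2
        then have "dist y x < d" using cylinder_dist[of y j p x] x jd j by fastforce
        then show ?thesis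
          using d(2)[of y] 2 abs_ge_self[of "F y - F x"] unfolding dist_real_def by linarith
      qed (use F0[of x] \<open>0 < e\<close> in simp)
    qed simp
    moreover have "F x \<le> cylinder_sup F m p" using x by (rule cylinder_sup_upper)
    ultimately show ?thesis using \<open>0 < e\<close> by simp
  qed
  then show "\<exists>no. \<forall>n\<ge>no. norm (cylinder_sup F n p - F x) < e" by blast
qed

text \<open>Balls are available around every point, including the junk value of the noodle, which
  need not lie in any cylinder. These suprema serve for measurability, the cylinder suprema for the
  averages.\<close>

lemma ball_sup_tendsto:
  assumes F: "continuous_on UNIV F"
  shows "(\<lambda>k. Sup (F ` ball x (1 / (1 + real k)))) \<longlonglongrightarrow> F x"
proof (rule LIMSEQ_I)
  fix e :: real assume "0 < e"
  then obtain d where d: "d > 0" "\<And>y. dist y x < d \<Longrightarrow> dist (F y) (F x) < e / 2"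
    using F unfolding continuous_on_iff by (metis UNIV_I half_gt_zero)
  obtain k where k: "1 / (1 + real k) < d"
    using reals_Archimedean[OF d(1)] by (auto simp: inverse_eq_divide)
  have "norm (Sup (F ` ball x (1 / (1 + real j))) - F x) < e" if "j \<ge> k" for j
  proof -
    have jd: "1 / (1 + real j) < d" using that k by (smt (verit) frac_le of_nat_0_le_iff of_nat_mono)
    have "Sup (F ` ball x (1 / (1 + real j))) \<le> F x + e / 2"
    proof (rule cSup_least)
      fix z assume "z \<in> F ` ball x (1 / (1 + real j))"
      then obtain y where "dist x y < 1 / (1 + real j)" "z = F y" by auto
      then show "z \<le> F x + e / 2"
        using d(2)[of y] jd abs_ge_self[of "F y - F x"]
        unfolding dist_real_def dist_commute[of x] by linarith
    qed (simp add: field_simps)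
    moreover have "F x \<le> Sup (F ` ball x (1 / (1 + real j)))"
      by (intro cSup_upper bdd_above_F) (simp add: field_simps)
    ultimately show ?thesis using \<open>0 < e\<close> by simp
  qed
  then show "\<exists>no. \<forall>n\<ge>no. norm (Sup (F ` ball x (1 / (1 + real n))) - F x) < e" by blast
qed

end

section \<open>Measurability of functions of the noodle\<close>

lemma dist_marked_system_ultra: "dist x y \<le> max (dist x z) (dist y z)" for x y z :: marked_system
  by transfer (auto intro!: local_dist_triangle simp: marked_equiv_def)

text \<open>Ultrametric geometry: every point of a ball is a centre of it. Hence a supremum over a
  ball is unchanged when the centre moves by less than the radius.\<close>

lemma ball_eq_of_dist:
  fixes x y :: marked_system
  assumes "dist x y < e"
  shows "ball x e = ball y e"
proof -
  have "dist x z < e \<longleftrightarrow> dist y z < e" for z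
    using dist_marked_system_ultra[of x z y] dist_marked_system_ultra[of y z x] assms
    by (auto simp: dist_commute max_def split: if_splits)
  then show ?thesis by auto
qed

text \<open>A pair outside the domain of the partial quotient has an empty equivalence class, so
  \<open>mark\<close> sends all such pairs to one point.\<close>

lemma mark_not_marked:
  assumes "\<not> marked_pms (M, r)"
  shows "mark M r = Abs_marked_system {}"
proof -
  interpret td: type_definition Rep_marked_system Abs_marked_system
      "{c. \<exists>x. marked_equiv x x \<and> c = Collect (marked_equiv x)}"
    by (rule marked_system.type_definition_marked_system)
  have "part_equivp marked_equiv"
    by (rule Quotient3_part_equivp[OF Quotient3_marked_system])
  then have "quot_type marked_equiv Abs_marked_system Rep_marked_system"
    using td.Rep td.Rep_inverse td.Abs_inverse td.Rep_inject by unfold_locales auto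
  then have "mark M r = Abs_marked_system (Collect (marked_equiv (M, r)))"
    by (simp add: mark_def abs_marked_system_def quot_type.abs_def)
  moreover have "Collect (marked_equiv (M, r)) = {}" using assms by (simp add: marked_equiv_def)
  ultimately show ?thesis by simp
qed

lemma partial_matching_noncrossing_iff:
  assumes "noncrossing_matching A U"
  shows "partial_matching B U \<and> noncrossing U \<longleftrightarrow> B = A"
proof -
  have "partial_matching A U" "noncrossing U" using assms by (auto simp: noncrossing_matching_def)
  then show ?thesis using partial_matching_blocks_eq[of A U] partial_matching_blocks_eq[of B U] by auto
qed

text \<open>Off the event that both sequences are matchable, one component is the junk value of
  \<^term>\<open>noodle_matching\<close>; it is the same value throughout, so the ball around the noodle is still
  determined by finitely many coordinates.\<close>

lemma mark_eq_or_close: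
  assumes U: "U = U' \<or> (noncrossing_matching UNIV U \<and> noncrossing_matching UNIV U' \<and>
                (\<forall>t. \<bar>t\<bar> \<le> int (Suc k) \<longrightarrow> opener U t = opener U' t))"
    and D: "D = D' \<or> (noncrossing_matching UNIV D \<and> noncrossing_matching UNIV D' \<and>
                (\<forall>t. \<bar>t\<bar> \<le> int (Suc k) \<longrightarrow> opener D t = opener D' t))"
  shows "mark (U, D) 0 = mark (U', D') 0 \<or> dist (mark (U, D) 0) (mark (U', D') 0) < 1 / (1 + real k)"
proof (cases "U = U' \<and> D = D'")
  case False
  \<comment> \<open>The junk matching is unspecified and could happen to be a partial matching, so
    it is used only through being the same on both sides.\<close>
  have pm: "partial_matching A X \<and> noncrossing X \<longleftrightarrow> partial_matching A X' \<and> noncrossing X'"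
    if "X = X' \<or> noncrossing_matching UNIV X \<and> noncrossing_matching UNIV X' \<and> B" for A X X' B
    using that partial_matching_noncrossing_iff[of UNIV X A] partial_matching_noncrossing_iff[of UNIV X' A]
    by blast
  have iff: "partial_meandric A (U, D) \<longleftrightarrow> partial_meandric A (U', D')" for A
    using pm[OF U, of A] pm[OF D, of A] by (auto simp: partial_meandric_def)
  show ?thesis
  proof (cases "marked_pms ((U, D), 0)")
    case True
    then obtain A where A: "int_interval A" "partial_meandric A (U, D)" by (auto simp: marked_pms_def)
    \<comment> \<open>Unless the two systems coincide, some component is a matching of all integers
      and forces the common domain.\<close>
    have univ: "A = UNIV"
    proof -
      from False U D have "noncrossing_matching UNIV U \<or> noncrossing_matching UNIV D" by blast
      then show ?thesis
        using A(2) partial_matching_noncrossing_iff[of UNIV U A] partial_matching_noncrossing_iff[of UNIV D A]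
        by (auto simp: partial_meandric_def)
    qed
    have A': "partial_meandric A (U', D')" using A iff by simp
    let ?W = "{- int (Suc k)..int (Suc k)}"
    have W: "restrict_matching ?W X = restrict_matching ?W X'"
      if "X = X' \<or> noncrossing_matching UNIV X \<and> noncrossing_matching UNIV X' \<and>
        (\<forall>t. \<bar>t\<bar> \<le> int (Suc k) \<longrightarrow> opener X t = opener X' t)" for X X'
      using that by (auto intro!: restrict_determined[of UNIV _ UNIV] simp: int_interval_def)
    have "window ((U, D), 0) (Suc k) = window ((U', D'), 0) (Suc k)"
      using W[OF U] W[OF D]
      by (simp add: window_def support_eq[OF A(2)] support_eq[OF A'] univ restrict_system_def)
    then have "agree (Suc k) ((U, D), 0) ((U', D'), 0)" by (simp add: agree_def)
    moreover have "marked_pms ((U', D'), 0)" using A A' univ by (auto simp: marked_pms_def)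
    ultimately show ?thesis using True mark_agree_dist by blast
  next
    case no: False
    then have "\<not> marked_pms ((U', D'), 0)" using iff by (auto simp: marked_pms_def)
    then show ?thesis using no by (simp add: mark_not_marked)
  qed
qed simp

lemma noodle_eq_or_close:
  assumes "matchable a = matchable a'" "matchable b = matchable b'"
    and "\<And>t. \<bar>t\<bar> \<le> int (Suc k) \<Longrightarrow> a t = a' t" "\<And>t. \<bar>t\<bar> \<le> int (Suc k) \<Longrightarrow> b t = b' t"
  shows "mark (noodle a b) 0 = mark (noodle a' b') 0 \<or>
    dist (mark (noodle a b) 0) (mark (noodle a' b') 0) < 1 / (1 + real k)"
  unfolding noodle_def
proof (rule mark_eq_or_close)
  have *: "noodle_matching c = noodle_matching c' \<or>
      (noncrossing_matching UNIV (noodle_matching c) \<and> noncrossing_matching UNIV (noodle_matching c') \<and>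
       (\<forall>t. \<bar>t\<bar> \<le> int (Suc k) \<longrightarrow> opener (noodle_matching c) t = opener (noodle_matching c') t))"
    if "matchable c = matchable c'" "\<And>t. \<bar>t\<bar> \<le> int (Suc k) \<Longrightarrow> c t = c' t" for c c'
    using that by (cases "matchable c") (simp_all add: noodle_matching_matchable noodle_matching_not_matchable)
  show "noodle_matching a = noodle_matching a' \<or>
      (noncrossing_matching UNIV (noodle_matching a) \<and> noncrossing_matching UNIV (noodle_matching a') \<and>
       (\<forall>t. \<bar>t\<bar> \<le> int (Suc k) \<longrightarrow> opener (noodle_matching a) t = opener (noodle_matching a') t))"
    by (rule *) (use assms in auto)
  show "noodle_matching b = noodle_matching b' \<or>
      (noncrossing_matching UNIV (noodle_matching b) \<and> noncrossing_matching UNIV (noodle_matching b') \<and>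
       (\<forall>t. \<bar>t\<bar> \<le> int (Suc k) \<longrightarrow> opener (noodle_matching b) t = opener (noodle_matching b') t))"
    by (rule *) (use assms in auto)
qed

lemma measurable_Pair_count_space:
  fixes f :: "'a \<Rightarrow> 'b::countable" and g :: "'a \<Rightarrow> 'c::countable"
  assumes "f \<in> measurable N (count_space UNIV)" "g \<in> measurable N (count_space UNIV)"
  shows "(\<lambda>x. (f x, g x)) \<in> measurable N (count_space UNIV)"
  using measurable_Pair[OF assms] by (simp add: pair_measure_countable)

text \<open>The ball suprema converge at every sample point and are functions of finitely many
  discrete data. An almost sure limit would not suffice, as the measure need not be
  complete.\<close>

lemma borel_measurable_noodle:
  fixes F :: "marked_system \<Rightarrow> real"
  assumes a: "\<And>i. a i \<in> measurable N (count_space UNIV)" and b: "\<And>i. b i \<in> measurable N (count_space UNIV)"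
    and F: "continuous_on UNIV F" "\<And>x. 0 \<le> F x" "\<And>x. F x \<le> C"
  shows "(\<lambda>\<omega>. F (mark (noodle (\<lambda>i. a i \<omega>) (\<lambda>i. b i \<omega>)) 0)) \<in> borel_measurable N"
proof -
  let ?G = "\<lambda>\<omega>. mark (noodle (\<lambda>i. a i \<omega>) (\<lambda>i. b i \<omega>)) 0"
  have lim: "(\<lambda>k. Sup (F ` ball (?G \<omega>) (1 / (1 + real k)))) \<longlonglongrightarrow> F (?G \<omega>)" for \<omega>
    by (rule ball_sup_tendsto) (use F in auto)
  \<comment> \<open>Matchability depends on infinitely many letters, but as a two-valued flag
    attached to each coordinate it leaves the set of coordinate values finite.\<close>
  define X where "X i \<omega> = ((a i \<omega>, b i \<omega>), matchable (\<lambda>i. a i \<omega>), matchable (\<lambda>i. b i \<omega>))" for i \<omega>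
  have X: "X i \<in> measurable N (count_space UNIV)" for i
    unfolding X_def using a b measurable_matchable by (intro measurable_Pair_count_space) auto
  have "(\<lambda>\<omega>. Sup (F ` ball (?G \<omega>) (1 / (1 + real k)))) \<in> measurable N (count_space UNIV)" for k
  proof (rule measurable_determined[OF X, of "{- int (Suc k)..int (Suc k)}"])
    fix \<omega> \<omega>' assume eq: "\<And>i. i \<in> {- int (Suc k)..int (Suc k)} \<Longrightarrow> X i \<omega> = X i \<omega>'"
    have "?G \<omega> = ?G \<omega>' \<or> dist (?G \<omega>) (?G \<omega>') < 1 / (1 + real k)"
      by (rule noodle_eq_or_close) (use eq[of 0] eq in \<open>auto simp: X_def abs_le_iff\<close>)
    then show "Sup (F ` ball (?G \<omega>) (1 / (1 + real k))) = Sup (F ` ball (?G \<omega>') (1 / (1 + real k)))"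
      using ball_eq_of_dist by metis
  qed simp
  then have "(\<lambda>\<omega>. Sup (F ` ball (?G \<omega>) (1 / (1 + real k)))) \<in> borel_measurable N" for k
    by (rule measurable_compose) simp
  then show ?thesis
    by (rule borel_measurable_LIMSEQ_real[rotated, where u = "\<lambda>k \<omega>. Sup (F ` ball (?G \<omega>) (1 / (1 + real k)))"])
       (rule lim)
qed

text \<open>A finite sum rather than an expectation, so that the same number arises on the space of
  the noodle and under \<open>word_pmf\<close>.\<close>

definition window_mean :: "(marked_system \<Rightarrow> real) \<Rightarrow> nat \<Rightarrow> real" where
  "window_mean F m = (1 / 4) ^ (2 * m + 1) *
     (\<Sum>p\<in>{- int m..int m} \<rightarrow>\<^sub>E UNIV. cylinder_sup F m p)"

lemma (in prob_space) expectation_cylinder_sup: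
  assumes X: "\<And>i. X i \<in> measurable M (count_space UNIV)"
    and q: "\<And>p. prob {\<omega> \<in> space M. \<forall>i\<in>{- int m..int m}. X i \<omega> = p i} = (1 / 4) ^ (2 * m + 1)"
  shows "expectation (\<lambda>\<omega>. cylinder_sup F m (\<lambda>i. X i \<omega>)) = window_mean F m"
  unfolding window_mean_def
  by (rule expectation_finite_coordinates[OF X _ _ q])
     (auto intro!: cylinder_sup_cong simp: abs_le_iff)

lemma (in prob_space) window_mean_tendsto:
  fixes F :: "marked_system \<Rightarrow> real"
  assumes a: "fair_iid M a" and b: "fair_iid M b"
    and ind: "indep_var (PiM UNIV (\<lambda>_. count_space UNIV)) (\<lambda>\<omega> i. a i \<omega>)
                        (PiM UNIV (\<lambda>_. count_space UNIV)) (\<lambda>\<omega> i. b i \<omega>)"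
    and F: "continuous_on UNIV F" "\<And>x. 0 \<le> F x" "\<And>x. F x \<le> C"
  shows "(\<lambda>m. window_mean F m) \<longlonglongrightarrow> expectation (\<lambda>\<omega>. F (mark (noodle (\<lambda>i. a i \<omega>) (\<lambda>i. b i \<omega>)) 0))"
proof -
  let ?G = "\<lambda>\<omega>. mark (noodle (\<lambda>i. a i \<omega>) (\<lambda>i. b i \<omega>)) 0"
  let ?X = "\<lambda>i \<omega>. (a i \<omega>, b i \<omega>)"
  have X: "?X i \<in> measurable M (count_space UNIV)" for i
    using fair_iid_measurable[OF a] fair_iid_measurable[OF b] by (intro measurable_Pair_count_space)
  have mean: "expectation (\<lambda>\<omega>. cylinder_sup F m (\<lambda>i. ?X i \<omega>)) = window_mean F m" for m
  proof (rule expectation_cylinder_sup[OF X])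
    have "card {- int m..int m} = 2 * m + 1" by simp
    then show "prob {\<omega> \<in> space M. \<forall>i\<in>{- int m..int m}. ?X i \<omega> = p i} = (1 / 4) ^ (2 * m + 1)" for p
      using fair_pair_prob[OF a b _ ind, of "{- int m..int m}" p] by (simp only: finite_atLeastAtMost_int simp_thms)
  qed
  have "(\<lambda>m. expectation (\<lambda>\<omega>. cylinder_sup F m (\<lambda>i. ?X i \<omega>))) \<longlonglongrightarrow> expectation (\<lambda>\<omega>. F (?G \<omega>))"
  proof (rule integral_dominated_convergence[where w = "\<lambda>_. C"])
    show "(\<lambda>\<omega>. F (?G \<omega>)) \<in> borel_measurable M"
      using fair_iid_measurable[OF a] fair_iid_measurable[OF b] F by (rule borel_measurable_noodle)
    show "(\<lambda>\<omega>. cylinder_sup F m (\<lambda>i. ?X i \<omega>)) \<in> borel_measurable M" for m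
    proof (rule measurable_compose)
      show "(\<lambda>\<omega>. cylinder_sup F m (\<lambda>i. ?X i \<omega>)) \<in> measurable M (count_space UNIV)"
        by (rule measurable_finite_coordinates[OF X, of "{- int m..int m}"])
           (auto intro!: cylinder_sup_cong simp: abs_le_iff)
    qed simp
    show "AE \<omega> in M. (\<lambda>m. cylinder_sup F m (\<lambda>i. ?X i \<omega>)) \<longlonglongrightarrow> F (?G \<omega>)"
      using AE_matchable[OF a] AE_matchable[OF b]
    proof eventually_elim
      case (elim \<omega>)
      then show ?case using F by (intro cylinder_sup_tendsto noodle_in_cylinder) auto
    qed
    show "AE \<omega> in M. norm (cylinder_sup F m (\<lambda>i. ?X i \<omega>)) \<le> C" for m
      using cylinder_sup_nonneg[OF F(2,3)] cylinder_sup_le[OF F(2,3)] by auto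
  qed simp
  then show ?thesis unfolding mean .
qed

subsection \<open>Concentration\<close>

text \<open>Functions of disjoint windows of independent letters are independent, so Hoeffding's
  inequality applies. \<open>K\<close> stands in for \<open>card J\<close>, so that residue classes
  of different sizes obey one bound.\<close>

lemma (in prob_space) Hoeffding_disjoint_windows:
  fixes X :: "int \<Rightarrow> 'a \<Rightarrow> 'c::finite" and h :: "(int \<Rightarrow> 'c) \<Rightarrow> real"
    and C K \<mu> e :: real
  assumes X: "\<And>i. X i \<in> measurable M (count_space UNIV)"
    and ind: "indep_vars (\<lambda>_. count_space UNIV) X I"
    and h: "\<And>x y. (\<And>t. \<bar>t\<bar> \<le> int m \<Longrightarrow> x t = y t) \<Longrightarrow> h x = h y" "\<And>x. 0 \<le> h x" "\<And>x. h x \<le> C"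
    and C: "0 < C" and e: "0 < e"
    and J: "finite J" "\<And>i. i \<in> J \<Longrightarrow> {i - int m..i + int m} \<subseteq> I" "real (card J) \<le> K" "0 < K"
    and disj: "disjoint_family_on (\<lambda>i. {i - int m..i + int m}) J"
    and mean: "\<And>i. i \<in> J \<Longrightarrow> expectation (\<lambda>\<omega>. h (\<lambda>t. X (i + t) \<omega>)) = \<mu>"
  shows "prob {\<omega> \<in> space M. (\<Sum>i\<in>J. h (\<lambda>t. X (i + t) \<omega>)) \<ge> card J * \<mu> + e} \<le> exp (- 2 * e\<^sup>2 / (K * C\<^sup>2))"
proof (cases "J = {}")
  case True
  then show ?thesis using e by simp
next
  case False
  let ?W = "\<lambda>i. {i - int m..i + int m}"
  have "indep_vars (\<lambda>j. PiM (?W j) (\<lambda>_. count_space UNIV)) (\<lambda>j \<omega>. restrict (\<lambda>i. X i \<omega>) (?W j)) J"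
    by (rule indep_vars_restrict[OF ind J(2) disj])
  moreover have "(\<lambda>x. h (\<lambda>t. x (j + t))) \<in> borel_measurable (PiM (?W j) (\<lambda>_. count_space UNIV))" for j
  proof -
    \<comment> \<open>\<open>measurable_finite_coordinates\<close> wants every coordinate
      measurable, but the product space has components only on \<open>?W j\<close>;
      \<open>?Z\<close> is constant at the others.\<close>
    let ?Z = "\<lambda>t x. if \<bar>t\<bar> \<le> int m then x (j + t) else undefined"
    have "?Z t \<in> measurable (PiM (?W j) (\<lambda>_. count_space UNIV)) (count_space UNIV)" for t
      by (cases "\<bar>t\<bar> \<le> int m") (auto intro!: measurable_component_singleton simp: abs_le_iff)
    then have "(\<lambda>x. h (\<lambda>t. ?Z t x)) \<in> measurable (PiM (?W j) (\<lambda>_. count_space UNIV)) (count_space UNIV)"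
      by (rule measurable_finite_coordinates[where W = "{- int m..int m}"])
         (auto intro!: h(1) simp: abs_le_iff)
    moreover have "h (\<lambda>t. ?Z t x) = h (\<lambda>t. x (j + t))" for x by (rule h(1)) simp
    ultimately have "(\<lambda>x. h (\<lambda>t. x (j + t))) \<in> measurable (PiM (?W j) (\<lambda>_. count_space UNIV)) (count_space UNIV)"
      by simp
    then show ?thesis by (rule measurable_compose) simp
  qed
  ultimately have "indep_vars (\<lambda>_. borel) (\<lambda>j \<omega>. h (\<lambda>t. restrict (\<lambda>i. X i \<omega>) (?W j) (j + t))) J"
    by (rule indep_vars_compose2[where Y = "\<lambda>j x. h (\<lambda>t. x (j + t))"])
  moreover have "h (\<lambda>t. restrict (\<lambda>i. X i \<omega>) (?W j) (j + t)) = h (\<lambda>t. X (j + t) \<omega>)" for j \<omega>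
    by (rule h(1)) (auto simp: abs_le_iff)
  ultimately have "indep_vars (\<lambda>_. borel) (\<lambda>j \<omega>. h (\<lambda>t. X (j + t) \<omega>)) J" by simp
  then interpret Hoeffding_ineq M J "\<lambda>j \<omega>. h (\<lambda>t. X (j + t) \<omega>)" "\<lambda>_. 0" "\<lambda>_. C"
    "\<Sum>i\<in>J. expectation (\<lambda>\<omega>. h (\<lambda>t. X (i + t) \<omega>))"
    using J(1) h(2,3) by unfold_locales auto
  have cJ: "0 < card J" using False J(1) by (simp add: card_gt_0_iff)
  have "prob {\<omega> \<in> space M. (\<Sum>i\<in>J. h (\<lambda>t. X (i + t) \<omega>)) \<ge> card J * \<mu> + e} \<le> exp (- 2 * e\<^sup>2 / (card J * C\<^sup>2))"
    using Hoeffding_ineq_ge[of e] mean e C cJ by simp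
  also have "\<dots> \<le> exp (- 2 * e\<^sup>2 / (K * C\<^sup>2))"
    using J cJ C e by (simp add: frac_le)
  finally show ?thesis .
qed

text \<open>Windows centred at points of one residue class modulo their length are disjoint, hence
  independent; the union bound over the classes costs only a constant factor.\<close>

lemma (in prob_space) sliding_window_deviation:
  fixes X :: "int \<Rightarrow> 'a \<Rightarrow> 'c::finite" and h :: "(int \<Rightarrow> 'c) \<Rightarrow> real"
    and C K \<mu> e :: real
  assumes X: "\<And>i. X i \<in> measurable M (count_space UNIV)"
    and ind: "indep_vars (\<lambda>_. count_space UNIV) X I"
    and h: "\<And>x y. (\<And>t. \<bar>t\<bar> \<le> int m \<Longrightarrow> x t = y t) \<Longrightarrow> h x = h y" "\<And>x. 0 \<le> h x" "\<And>x. h x \<le> C"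
    and C: "0 < C" and e: "0 < e"
    and J: "finite J" "\<And>i. i \<in> J \<Longrightarrow> {i - int m..i + int m} \<subseteq> I" "real (card J) \<le> K" "0 < K"
    and mean: "\<And>i. i \<in> J \<Longrightarrow> expectation (\<lambda>\<omega>. h (\<lambda>t. X (i + t) \<omega>)) = \<mu>"
  shows "prob {\<omega> \<in> space M. (\<Sum>i\<in>J. h (\<lambda>t. X (i + t) \<omega>)) \<ge> card J * \<mu> + (2 * real m + 1) * e}
    \<le> (2 * real m + 1) * exp (- 2 * e\<^sup>2 / (K * C\<^sup>2))"
proof -
  define q where "q = 2 * int m + 1"
  define J' where "J' s = {i \<in> J. i mod q = s}" for s
  let ?H = "\<lambda>i \<omega>. h (\<lambda>t. X (i + t) \<omega>)"
  define E where "E s = {\<omega> \<in> space M. (\<Sum>i\<in>J' s. ?H i \<omega>) \<ge> card (J' s) * \<mu> + e}" for s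
  have q: "q > 0" by (simp add: q_def)
  have H [measurable]: "?H i \<in> borel_measurable M" for i
  proof (rule measurable_compose)
    show "?H i \<in> measurable M (count_space UNIV)"
      by (rule measurable_finite_coordinates[of "\<lambda>t. X (i + t)" M "{- int m..int m}" h])
         (auto intro!: h(1) X simp: abs_le_iff)
  qed simp
  have E_sets [measurable]: "E s \<in> sets M" for s unfolding E_def by measurable
  have E: "prob (E s) \<le> exp (- 2 * e\<^sup>2 / (K * C\<^sup>2))" for s
    unfolding E_def
  proof (rule Hoeffding_disjoint_windows[OF X ind h C e])
    show "disjoint_family_on (\<lambda>i. {i - int m..i + int m}) (J' s)"
      unfolding disjoint_family_on_def
    proof (intro ballI impI)
      fix i j assume ij: "i \<in> J' s" "j \<in> J' s" "i \<noteq> j"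
      then have "q dvd i - j" by (simp add: J'_def flip: mod_eq_dvd_iff)
      then have "q \<le> \<bar>i - j\<bar>" using ij(3) by (metis dvd_abs_iff eq_iff_diff_eq_0 zdvd_imp_le zero_less_abs_iff)
      then show "{i - int m..i + int m} \<inter> {j - int m..j + int m} = {}"
        by (auto simp: q_def abs_if split: if_splits)
    qed
    have "card (J' s) \<le> card J" using J(1) by (intro card_mono) (auto simp: J'_def)
    then show "real (card (J' s)) \<le> K" using J(3) by simp
  qed (use J mean in \<open>auto simp: J'_def\<close>)
  have split: "(\<Sum>i\<in>J. f i) = (\<Sum>s\<in>{0..<q}. \<Sum>i\<in>J' s. f i)" for f :: "int \<Rightarrow> real"
    unfolding J'_def using q J(1) by (intro sum.group[symmetric]) auto
  have "{\<omega> \<in> space M. (\<Sum>i\<in>J. ?H i \<omega>) \<ge> card J * \<mu> + (2 * real m + 1) * e} \<subseteq> (\<Union>s\<in>{0..<q}. E s)"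
  proof
    fix \<omega> assume \<omega>: "\<omega> \<in> {\<omega> \<in> space M. (\<Sum>i\<in>J. ?H i \<omega>) \<ge> card J * \<mu> + (2 * real m + 1) * e}"
    show "\<omega> \<in> (\<Union>s\<in>{0..<q}. E s)"
    proof (rule ccontr)
      assume "\<omega> \<notin> (\<Union>s\<in>{0..<q}. E s)"
      \<comment> \<open>Without a deviating class, the \<open>q = 2 * m + 1\<close> excesses, each
        below \<open>e\<close>, sum to less than \<open>(2 * m + 1) * e\<close>.\<close>
      then have lt: "(\<Sum>i\<in>J' s. ?H i \<omega>) < card (J' s) * \<mu> + e" if "s \<in> {0..<q}" for s
        using \<omega> that by (force simp: E_def)
      have "(\<Sum>i\<in>J. ?H i \<omega>) < (\<Sum>s\<in>{0..<q}. card (J' s) * \<mu> + e)"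
        unfolding split using q lt by (intro sum_strict_mono) auto
      also have "\<dots> = (\<Sum>i\<in>J. \<mu>) + (2 * real m + 1) * e"
        unfolding split by (simp add: sum.distrib q_def)
      finally show False using \<omega> by simp
    qed
  qed
  then have "prob {\<omega> \<in> space M. (\<Sum>i\<in>J. ?H i \<omega>) \<ge> card J * \<mu> + (2 * real m + 1) * e} \<le> prob (\<Union>s\<in>{0..<q}. E s)"
    by (intro finite_measure_mono) auto
  also have "\<dots> \<le> (\<Sum>s\<in>{0..<q}. prob (E s))"
    by (intro finite_measure_subadditive_finite) auto
  also have "\<dots> \<le> (\<Sum>s\<in>{0..<q}. exp (- 2 * e\<^sup>2 / (K * C\<^sup>2)))"
    by (intro sum_mono E)
  also have "\<dots> = (2 * real m + 1) * exp (- 2 * e\<^sup>2 / (K * C\<^sup>2))" by (simp add: q_def)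
  finally show ?thesis .
qed

text \<open>The default \<open>(R, R)\<close> is the value of \<open>opener\<close> outside a finite
  domain, so the pair of opener functions of a meandric system is literally one of the
  \<open>16 ^ n\<close> equally likely words.\<close>

definition word_pmf :: "nat \<Rightarrow> (int \<Rightarrow> side \<times> side) pmf" where
  "word_pmf n = Pi_pmf {0..<2 * int n} (R, R) (\<lambda>_. pmf_of_set UNIV)"

lemma word_pmf_window:
  assumes W: "{i - int m..i + int m} \<subseteq> {0..<2 * int n}"
  shows "measure_pmf.prob (word_pmf n) {c. \<forall>t\<in>{- int m..int m}. c (i + t) = p t} = (1 / 4) ^ (2 * m + 1)"
proof -
  let ?W = "{i - int m..i + int m}"
  let ?B = "\<lambda>x. if x \<in> ?W then {p (x - i)} else UNIV"
  have "{c. \<forall>t\<in>{- int m..int m}. c (i + t) = p t} = Pi {0..<2 * int n} ?B" (is "?l = ?r")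
  proof (intro equalityI subsetI)
    fix c assume c: "c \<in> ?l"
    have "c x = p (x - i)" if "x \<in> ?W" for x
      using c that by (auto dest!: bspec[of _ _ "x - i"])
    then show "c \<in> ?r" by auto
  next
    fix c assume c: "c \<in> ?r"
    have "c (i + t) = p t" if "t \<in> {- int m..int m}" for t
    proof -
      have "i + t \<in> ?W" using that by auto
      then show ?thesis using c W by (auto simp: Pi_iff dest!: bspec[of _ _ "i + t"])
    qed
    then show "c \<in> ?l" by blast
  qed
  also have "measure_pmf.prob (word_pmf n) (Pi {0..<2 * int n} ?B) =
      (\<Prod>x\<in>{0..<2 * int n}. measure_pmf.prob (pmf_of_set UNIV) (?B x))"
    unfolding word_pmf_def by (rule measure_Pi_pmf_Pi) simp
  also have "\<dots> = (\<Prod>x\<in>{0..<2 * int n}. if x \<in> ?W then 1 / 4 else 1)"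
    by (intro prod.cong) (auto simp: measure_pmf_of_set card_UNIV_side)
  also have "\<dots> = (1 / 4) ^ card ?W"
  proof -
    have "{0..<2 * int n} \<inter> {x. x \<in> ?W} = ?W" using W by blast
    then show ?thesis by (simp only: prod.If_cases finite_atLeastLessThan_int prod_constant) simp
  qed
  also have "card ?W = 2 * m + 1" by simp
  finally show ?thesis .
qed

lemma word_pmf_card:
  "real (card {c \<in> PiE_dflt {0..<2 * int n} (R, R) (\<lambda>_. UNIV). P c}) =
    16 ^ n * measure_pmf.prob (word_pmf n) {c. P c}"
proof -
  let ?S = "PiE_dflt {0..<2 * int n} (R, R) (\<lambda>_. UNIV :: (side \<times> side) set)"
  have eq: "word_pmf n = pmf_of_set ?S"
    unfolding word_pmf_def by (rule Pi_pmf_of_set) auto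
  have fin: "finite ?S" by (intro finite_PiE_dflt) auto
  have card: "card ?S = 16 ^ n"
    by (subst card_PiE_dflt) (auto simp: card_UNIV_side nat_mult_distrib power_mult)
  have ne: "?S \<noteq> {}" using card by auto
  have "measure_pmf.prob (word_pmf n) {c. P c} = card (?S \<inter> {c. P c}) / card ?S"
    unfolding eq by (rule measure_pmf_of_set[OF ne fin])
  then show ?thesis by (simp add: card Int_def)
qed

section \<open>From words to meandric systems\<close>

definition mark_average :: "(marked_system \<Rightarrow> real) \<Rightarrow> nat \<Rightarrow> system \<Rightarrow> real" where
  "mark_average F n M = (\<Sum>i\<in>{0..<2 * int n}. F (mark M i)) / (2 * real n)"

context
  fixes F :: "marked_system \<Rightarrow> real" and C :: real
  assumes F0: "\<And>x. 0 \<le> F x" and FC: "\<And>x. F x \<le> C"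
begin

text \<open>Marks in the middle range have a full window and are controlled by their cylinder; the
  at most \<open>2 * m\<close> marks near the ends cost at most \<open>C\<close> each.\<close>

lemma mark_average_le:
  assumes "(U, D) \<in> meandric_systems n" and n: "n > 0"
  shows "2 * real n * mark_average F n (U, D) \<le>
    (\<Sum>i\<in>{int m..<2 * int n - int m}. cylinder_sup F m (\<lambda>t. (opener U (i + t), opener D (i + t)))) + 2 * real m * C"
proof -
  let ?I = "{0..<2 * int n}" and ?J = "{int m..<2 * int n - int m}"
  have UD: "noncrossing_matching ?I U" "noncrossing_matching ?I D"
    using assms by (auto simp: meandric_systems_def)
  have C0: "0 \<le> C" using order_trans[OF F0 FC] .
  have cyl: "F (mark (U, D) i) \<le> cylinder_sup F m (\<lambda>t. (opener U (i + t), opener D (i + t)))" if "i \<in> ?J" for i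
  proof (rule cylinder_sup_upper[OF F0 FC])
    have "{i - int m..i + int m} \<subseteq> ?I" using that by auto
    moreover have "int_interval ?I" by (auto simp: int_interval_def)
    ultimately show "mark (U, D) i \<in> cylinder m (\<lambda>t. (opener U (i + t), opener D (i + t)))"
      unfolding cylinder_def using UD by blast
  qed
  have "2 * real n * mark_average F n (U, D) = (\<Sum>i\<in>?I. F (mark (U, D) i))"
    using n by (simp add: mark_average_def)
  \<comment> \<open>For \<open>m > n\<close> the boundary ranges overlap and may leave
    \<open>?I\<close>. As \<open>F\<close> is nonnegative, enlarging the index set keeps an upper
    bound, so no case distinction arises.\<close>
  also have "\<dots> \<le> (\<Sum>i\<in>?J \<union> ({0..<int m} \<union> {2 * int n - int m..<2 * int n}). F (mark (U, D) i))"
    using F0 by (intro sum_mono2) auto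
  also have "\<dots> \<le> (\<Sum>i\<in>?J. F (mark (U, D) i)) + (\<Sum>i\<in>{0..<int m} \<union> {2 * int n - int m..<2 * int n}. F (mark (U, D) i))"
    using F0 by (subst sum_Un) (auto simp: sum_nonneg)
  also have "(\<Sum>i\<in>{0..<int m} \<union> {2 * int n - int m..<2 * int n}. F (mark (U, D) i)) \<le>
      card ({0..<int m} \<union> {2 * int n - int m..<2 * int n}) * C"
    using FC by (rule sum_bounded_above)
  also have "\<dots> \<le> 2 * real m * C"
  proof -
    have "card ({0..<int m} \<union> {2 * int n - int m..<2 * int n}) \<le> 2 * m"
      using card_Un_le[of "{0..<int m}" "{2 * int n - int m..<2 * int n}"] by simp
    then have "real (card ({0..<int m} \<union> {2 * int n - int m..<2 * int n})) \<le> 2 * real m" by linarith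
    then show ?thesis using C0 by (rule mult_right_mono)
  qed
  also have "(\<Sum>i\<in>?J. F (mark (U, D) i)) \<le> (\<Sum>i\<in>?J. cylinder_sup F m (\<lambda>t. (opener U (i + t), opener D (i + t))))"
    by (intro sum_mono cyl)
  finally show ?thesis by simp
qed

text \<open>Opener words map the deviating systems injectively to deviating words. Among uniform
  words these are rare by \<open>sliding_window_deviation\<close>, used with
  \<open>K = 2 * n\<close>.\<close>

lemma card_deviating_systems:
  assumes C: "0 < C" and \<epsilon>: "0 < \<epsilon>" and n: "0 < n" "2 * real m * C \<le> real n * \<epsilon>"
  shows "real (card {M \<in> meandric_systems n. mark_average F n M > window_mean F m + \<epsilon>}) \<le>
    16 ^ n * ((2 * real m + 1) * exp (- (real n * (\<epsilon>\<^sup>2 / ((2 * real m + 1)\<^sup>2 * C\<^sup>2)))))"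
proof -
  let ?I = "{0..<2 * int n}" and ?J = "{int m..<2 * int n - int m}" and ?\<mu> = "window_mean F m"
  let ?h = "cylinder_sup F m"
  \<comment> \<open>The sum over all marks exceeds its target by \<open>2 * n * \<epsilon>\<close>.
    Half of this absorbs the boundary term \<open>2 * m * C\<close>, and the other half is shared by
    the \<open>2 * m + 1\<close> residue classes.\<close>
  define e where "e = real n * \<epsilon> / (2 * real m + 1)"
  define \<Phi> where "\<Phi> M = (\<lambda>i. (opener (fst M) i, opener (snd M) i))" for M :: system
  let ?bad = "\<lambda>c. (\<Sum>i\<in>?J. ?h (\<lambda>t. c (i + t))) \<ge> card ?J * ?\<mu> + (2 * real m + 1) * e"
  let ?S = "PiE_dflt ?I (R, R) (\<lambda>_. UNIV :: (side \<times> side) set)"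
  have e: "0 < e" using \<epsilon> n by (simp add: e_def)
  have \<mu>0: "0 \<le> ?\<mu>" unfolding window_mean_def
    by (intro mult_nonneg_nonneg sum_nonneg cylinder_sup_nonneg[OF F0 FC]) auto
  have "inj_on \<Phi> (meandric_systems n)"
  proof (rule inj_onI)
    fix M N assume MN: "M \<in> meandric_systems n" "N \<in> meandric_systems n" "\<Phi> M = \<Phi> N"
    then have "opener (fst M) = opener (fst N)" "opener (snd M) = opener (snd N)"
      by (auto simp: \<Phi>_def fun_eq_iff)
    then have "fst M = fst N \<and> snd M = snd N"
      using MN inj_onD[OF inj_on_opener[of n]] by (auto simp: meandric_systems_eq)
    then show "M = N" by (simp add: prod_eq_iff)
  qed
  moreover have "\<Phi> M \<in> {c \<in> ?S. ?bad c}" if M: "M \<in> meandric_systems n" "mark_average F n M > ?\<mu> + \<epsilon>" for M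
  proof -
    obtain U D where UD: "M = (U, D)" by (cases M)
    then have nc: "noncrossing_matching ?I U" "noncrossing_matching ?I D"
      using M by (auto simp: meandric_systems_def)
    have "\<Phi> M \<in> ?S"
      using opener_outside[OF nc(1)] opener_outside[OF nc(2)] by (auto simp: PiE_dflt_def \<Phi>_def UD)
    moreover have "?bad (\<Phi> M)"
    proof -
      have "card ?J * ?\<mu> \<le> 2 * real n * ?\<mu>" using \<mu>0 by (intro mult_right_mono) auto
      moreover have "(2 * real m + 1) * e = real n * \<epsilon>" unfolding e_def by (simp add: add_nonneg_eq_0_iff)
      moreover have "2 * real n * (?\<mu> + \<epsilon>) \<le> 2 * real n * mark_average F n M"
        using M(2) by (intro mult_left_mono) auto
      ultimately have "card ?J * ?\<mu> + (2 * real m + 1) * e + 2 * real m * C \<le> 2 * real n * mark_average F n M"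
        using n(2) by (simp add: distrib_left)
      then show ?thesis using mark_average_le[of U D n m] M(1) n(1) by (simp add: UD \<Phi>_def)
    qed
    ultimately show ?thesis by blast
  qed
  ultimately have "card {M \<in> meandric_systems n. mark_average F n M > ?\<mu> + \<epsilon>} \<le> card {c \<in> ?S. ?bad c}"
  proof (intro card_inj_on_le[of \<Phi>])
    have "finite ?S" by (intro finite_PiE_dflt) auto
    then show "finite {c \<in> ?S. ?bad c}" by (rule rev_finite_subset) blast
  qed (auto intro: inj_on_subset)
  then have "real (card {M \<in> meandric_systems n. mark_average F n M > ?\<mu> + \<epsilon>}) \<le>
      16 ^ n * measure_pmf.prob (word_pmf n) {c. ?bad c}"
    unfolding word_pmf_card[symmetric] by simp
  also have "measure_pmf.prob (word_pmf n) {c. ?bad c} \<le>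
      (2 * real m + 1) * exp (- 2 * e\<^sup>2 / (2 * real n * C\<^sup>2))"
  proof -
    have "measure_pmf.prob (word_pmf n) {c \<in> space (measure_pmf (word_pmf n)). ?bad c} \<le>
      (2 * real m + 1) * exp (- 2 * e\<^sup>2 / (2 * real n * C\<^sup>2))"
    proof (rule measure_pmf.sliding_window_deviation[where X = "\<lambda>i c. c i" and I = ?I])
      show "prob_space.indep_vars (measure_pmf (word_pmf n)) (\<lambda>_. count_space UNIV) (\<lambda>i c. c i) ?I"
        unfolding word_pmf_def by (rule indep_vars_Pi_pmf) simp
      show "?h x = ?h y" if "\<And>t. \<bar>t\<bar> \<le> int m \<Longrightarrow> x t = y t" for x y using that by (rule cylinder_sup_cong)
      show "measure_pmf.expectation (word_pmf n) (\<lambda>c. ?h (\<lambda>t. c (i + t))) = ?\<mu>" if "i \<in> ?J" for i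
      proof (rule measure_pmf.expectation_cylinder_sup)
        fix p
        have "{i - int m..i + int m} \<subseteq> ?I" using that by auto
        from word_pmf_window[OF this, of p]
        show "measure_pmf.prob (word_pmf n) {c \<in> space (measure_pmf (word_pmf n)). \<forall>t\<in>{- int m..int m}. c (i + t) = p t} =
            (1 / 4) ^ (2 * m + 1)" by simp
      qed simp
    qed (use cylinder_sup_nonneg[OF F0 FC] cylinder_sup_le[OF F0 FC] C e n in auto)
    then show ?thesis by simp
  qed
  also have "- 2 * e\<^sup>2 / (2 * real n * C\<^sup>2) = - (real n * (\<epsilon>\<^sup>2 / ((2 * real m + 1)\<^sup>2 * C\<^sup>2)))"
  proof -
    have "- 2 * (x * \<epsilon> / k)\<^sup>2 / (2 * x * C\<^sup>2) = - (x * (\<epsilon>\<^sup>2 / (k\<^sup>2 * C\<^sup>2)))"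
      if "0 < x" "0 < k" for x k :: real
      using that C by (simp add: power2_eq_square field_simps)
    from this[of "real n" "2 * real m + 1"] show ?thesis using n(1) by (simp add: e_def)
  qed
  finally show ?thesis by simp
qed

text \<open>There are at least \<open>16 ^ n / (2 * n) ^ 4\<close> systems, so passing from words to
  systems costs a polynomial factor, which the exponential bound of rate \<open>\<kappa>\<close>
  beats.\<close>

lemma deviating_fraction_tendsto_0:
  assumes C: "0 < C" and \<epsilon>: "0 < \<epsilon>"
  shows "(\<lambda>n. card {M \<in> meandric_systems n. mark_average F n M > window_mean F m + \<epsilon>} /
              card (meandric_systems n)) \<longlonglongrightarrow> 0"
proof -
  define \<kappa> where "\<kappa> = \<epsilon>\<^sup>2 / ((2 * real m + 1)\<^sup>2 * C\<^sup>2)"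
  have \<kappa>: "\<kappa> > 0" using \<epsilon> C by (simp add: \<kappa>_def add_nonneg_pos)
  let ?q = "\<lambda>n. card {M \<in> meandric_systems n. mark_average F n M > window_mean F m + \<epsilon>} / card (meandric_systems n)"
  \<comment> \<open>\<open>(2 * n) ^ 4\<close> is written as
    \<open>(2 / \<kappa>) ^ 4 * (\<kappa> * n) ^ 4\<close> to match the limit of
    \<open>x ^ 4 / exp x\<close>.\<close>
  let ?r = "\<lambda>n. (2 * real m + 1) * (2 / \<kappa>) ^ 4 * ((\<kappa> * real n) ^ 4 / exp (\<kappa> * real n))"
  have bound: "?q n \<le> ?r n" if n: "0 < n" "2 * real m * C \<le> real n * \<epsilon>" for n
  proof -
    let ?c = "real (card (nc_matchings n))"
    have c: "4 ^ n \<le> (2 * real n)\<^sup>2 * ?c" by (rule card_nc_matchings_ge[OF n(1)])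
    then have c0: "?c > 0" by (smt (verit) mult_eq_0_iff of_nat_0_le_iff zero_less_power)
    have "(16::real) ^ n = (4 ^ n)\<^sup>2" by (simp add: power2_eq_square flip: power_mult_distrib)
    also have "\<dots> \<le> ((2 * real n)\<^sup>2 * ?c)\<^sup>2" using c by (intro power_mono) auto
    also have "\<dots> = (2 * real n) ^ 4 * card (meandric_systems n)"
      by (simp add: meandric_systems_eq card_cartesian_product power_mult_distrib power2_eq_square power4_eq_xxxx mult_ac)
    finally have c16: "(16::real) ^ n \<le> (2 * real n) ^ 4 * card (meandric_systems n)" .
    have MS: "real (card (meandric_systems n)) > 0"
      using c0 by (simp add: meandric_systems_eq card_cartesian_product)
    have "real (card {M \<in> meandric_systems n. mark_average F n M > window_mean F m + \<epsilon>}) \<le>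
        16 ^ n * ((2 * real m + 1) * exp (- (real n * \<kappa>)))"
      unfolding \<kappa>_def by (rule card_deviating_systems[OF C \<epsilon> n])
    also have "\<dots> \<le> (2 * real n) ^ 4 * card (meandric_systems n) * ((2 * real m + 1) * exp (- (real n * \<kappa>)))"
      using c16 by (intro mult_right_mono) auto
    finally have "?q n \<le> (2 * real n) ^ 4 * ((2 * real m + 1) * exp (- (real n * \<kappa>)))"
      using MS by (simp add: divide_le_eq mult_ac)
    also have "\<dots> = ?r n"
      using \<kappa> by (simp add: exp_minus field_simps)
    finally show ?thesis .
  qed
  have "filterlim (\<lambda>n. \<kappa> * real n) at_top sequentially"
    using \<kappa> by (intro filterlim_tendsto_pos_mult_at_top[OF tendsto_const] filterlim_real_sequentially)
  then have "(\<lambda>n. (\<kappa> * real n) ^ 4 / exp (\<kappa> * real n)) \<longlonglongrightarrow> 0"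
    by (rule filterlim_compose[OF tendsto_power_div_exp_0])
  then have r: "?r \<longlonglongrightarrow> 0" by (rule tendsto_mult_right_zero)
  have "eventually (\<lambda>n. 2 * real m * C / \<epsilon> \<le> real n) sequentially"
    using filterlim_real_sequentially by (auto simp: filterlim_at_top)
  with eventually_gt_at_top[of 0] have "eventually (\<lambda>n. ?q n \<le> ?r n) sequentially"
  proof eventually_elim
    case (elim n)
    then show ?case using \<epsilon> by (intro bound) (auto simp: pos_divide_le_eq)
  qed
  then show ?thesis by (rule tendsto_sandwich[OF _ _ tendsto_const r, rotated]) auto
qed

end

subsection \<open>Conditional expectations and the limit theorem\<close>

text \<open>On an event that \<open>X\<close> lies in \<open>B\<close>, both integrals are finite
  sums over the law of \<open>(X, Y)\<close>, which factorises by independence; averaging over the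
  uniform \<open>Y\<close> leaves the function of \<open>X\<close> on the right.\<close>

lemma (in prob_space) real_cond_exp_indep_uniform:
  fixes f :: "'s \<Rightarrow> 't \<Rightarrow> real"
  assumes X: "uniform_rv M X S" and S: "finite S" and Y: "uniform_rv M Y T" and T: "finite T"
    and ind: "indep_rvs M (count_space S) X (count_space T) Y"
  shows "AE \<omega> in M. real_cond_exp M (vimage_algebra (space M) X (count_space S)) (\<lambda>\<omega>. f (X \<omega>) (Y \<omega>)) \<omega> =
    (\<Sum>t\<in>T. f (X \<omega>) t) / card T"
proof -
  let ?G = "vimage_algebra (space M) X (count_space S)"
  let ?g = "\<lambda>s. (\<Sum>t\<in>T. f s t) / card T"
  have Xm: "X \<in> measurable M (count_space S)" using X by (simp add: uniform_rv_def)
  have XS: "X \<in> space M \<rightarrow> space (count_space S)" using uniform_rv_range[OF X] by auto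
  have sub: "subalgebra M ?G"
    using Xm by (auto simp: subalgebra_def sets_vimage_algebra2[OF XS] intro: measurable_sets)
  interpret finite_measure_subalgebra M ?G by unfold_locales (rule sub)
  let ?Z = "\<lambda>\<omega>. (X \<omega>, Y \<omega>)"
  have fin: "finite (S \<times> T)" using S T by simp
  have Z: "?Z \<omega> \<in> S \<times> T" if "\<omega> \<in> space M" for \<omega>
    using that uniform_rv_range[OF X] uniform_rv_range[OF Y] by auto
  have Zeq: "{\<omega> \<in> space M. ?Z \<omega> = p} = {\<omega> \<in> space M. X \<omega> \<in> {fst p}} \<inter> {\<omega> \<in> space M. Y \<omega> \<in> {snd p}}" for p
    by (auto simp: prod_eq_iff)
  have Z_sets: "{\<omega> \<in> space M. ?Z \<omega> = p} \<in> events" for p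
    unfolding Zeq by (intro sets.Int uniform_rv_sets[OF X] uniform_rv_sets[OF Y])
  have X_sets: "{\<omega> \<in> space M. X \<omega> = s} \<in> events" for s
    using uniform_rv_sets[OF X, of "{s}"] by simp
  have Z_prob: "prob {\<omega> \<in> space M. ?Z \<omega> = p} = prob {\<omega> \<in> space M. X \<omega> = fst p} / card T" if "p \<in> S \<times> T" for p
  proof -
    have "prob ({\<omega> \<in> space M. X \<omega> \<in> {fst p}} \<inter> {\<omega> \<in> space M. Y \<omega> \<in> {snd p}}) =
        prob {\<omega> \<in> space M. X \<omega> \<in> {fst p}} * prob {\<omega> \<in> space M. Y \<omega> \<in> {snd p}}"
    proof (rule indep_setD)
      show "indep_set {X -` A \<inter> space M |A. A \<in> sets (count_space S)} {Y -` B \<inter> space M |B. B \<in> sets (count_space T)}"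
        using ind by (simp add: indep_rvs_def)
      show "{\<omega> \<in> space M. X \<omega> \<in> {fst p}} \<in> {X -` A \<inter> space M |A. A \<in> sets (count_space S)}"
        using that by (auto intro!: exI[of _ "{fst p}"])
      show "{\<omega> \<in> space M. Y \<omega> \<in> {snd p}} \<in> {Y -` B \<inter> space M |B. B \<in> sets (count_space T)}"
        using that by (auto intro!: exI[of _ "{snd p}"])
    qed
    moreover have "prob {\<omega> \<in> space M. Y \<omega> = snd p} = 1 / card T"
      using that T by (intro uniform_rv_prob[OF Y]) auto
    ultimately show ?thesis unfolding Zeq by simp
  qed
  show ?thesis
  proof (rule real_cond_exp_charact)
    show "integrable M (\<lambda>\<omega>. f (X \<omega>) (Y \<omega>))"
      using integrable_finite_range[OF fin Z Z_sets, of "\<lambda>p. f (fst p) (snd p)"] by simp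
    show "integrable M (\<lambda>\<omega>. ?g (X \<omega>))"
      by (rule integrable_finite_range[OF S uniform_rv_range[OF X] X_sets])
    have "?g \<in> measurable (count_space S) borel" by simp
    then show "(\<lambda>\<omega>. ?g (X \<omega>)) \<in> borel_measurable ?G"
      by (rule measurable_compose[OF measurable_vimage_algebra1[OF XS]])
    fix A assume "A \<in> sets ?G"
    then obtain B where B: "A = X -` B \<inter> space M" "B \<subseteq> S"
      unfolding sets_vimage_algebra2[OF XS] by auto
    have A: "indicator A \<omega> = (indicator B (X \<omega>) :: real)" if "\<omega> \<in> space M" for \<omega>
      using that by (simp add: B indicator_def)
    have "(\<integral>\<omega>\<in>A. f (X \<omega>) (Y \<omega>) \<partial>M) = expectation (\<lambda>\<omega>. (\<lambda>p. indicator B (fst p) * f (fst p) (snd p)) (?Z \<omega>))"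
      unfolding set_lebesgue_integral_def by (rule Bochner_Integration.integral_cong) (simp_all add: A)
    also have "\<dots> = (\<Sum>p\<in>S \<times> T. indicator B (fst p) * f (fst p) (snd p) * prob {\<omega> \<in> space M. ?Z \<omega> = p})"
      by (rule expectation_finite_range[OF fin Z Z_sets])
    also have "\<dots> = (\<Sum>p\<in>S \<times> T. indicator B (fst p) * f (fst p) (snd p) * (prob {\<omega> \<in> space M. X \<omega> = fst p} / card T))"
      by (intro sum.cong refl arg_cong2[where f = "(*)"] Z_prob)
    also have "\<dots> = (\<Sum>s\<in>S. \<Sum>t\<in>T. indicator B s * f s t * (prob {\<omega> \<in> space M. X \<omega> = s} / card T))"
      by (simp add: sum.cartesian_product case_prod_unfold)
    also have "\<dots> = (\<Sum>s\<in>S. indicator B s * ?g s * prob {\<omega> \<in> space M. X \<omega> = s})"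
      by (intro sum.cong refl) (simp add: sum_distrib_left sum_distrib_right sum_divide_distrib mult_ac)
    also have "\<dots> = expectation (\<lambda>\<omega>. (\<lambda>s. indicator B s * ?g s) (X \<omega>))"
      by (rule expectation_finite_range[OF S uniform_rv_range[OF X] X_sets, symmetric])
    also have "\<dots> = (\<integral>\<omega>\<in>A. ?g (X \<omega>) \<partial>M)"
      unfolding set_lebesgue_integral_def by (rule Bochner_Integration.integral_cong) (simp_all add: A)
    finally show "(\<integral>\<omega>\<in>A. f (X \<omega>) (Y \<omega>) \<partial>M) = (\<integral>\<omega>\<in>A. ?g (X \<omega>) \<partial>M)" .
  qed
qed

lemma (in prob_space) uniform_rv_fraction:
  assumes X: "uniform_rv M X S" and S: "finite S"
  shows "prob {\<omega> \<in> space M. P (X \<omega>)} = card {s \<in> S. P s} / card S"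
proof -
  have X_sets: "{\<omega> \<in> space M. X \<omega> = s} \<in> events" for s
    using uniform_rv_sets[OF X, of "{s}"] by simp
  have "prob {\<omega> \<in> space M. P (X \<omega>)} = expectation (indicator {\<omega> \<in> space M. P (X \<omega>)})"
    by simp (rule arg_cong[where f = prob], auto)
  also have "\<dots> = expectation (\<lambda>\<omega>. (\<lambda>s. of_bool (P s)) (X \<omega>))"
    by (rule Bochner_Integration.integral_cong) (auto simp: indicator_def)
  also have "\<dots> = (\<Sum>s\<in>S. of_bool (P s) * prob {\<omega> \<in> space M. X \<omega> = s})"
    by (rule expectation_finite_range[OF S uniform_rv_range[OF X] X_sets])
  also have "\<dots> = (\<Sum>s\<in>S. of_bool (P s) / card S)"
    using uniform_rv_prob[OF X _ S] by (intro sum.cong) auto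
  also have "\<dots> = card {s \<in> S. P s} / card S"
    using S by (simp add: sum_of_bool_eq flip: sum_divide_distrib) (simp add: Int_def)
  finally show ?thesis .
qed

context prob_space
begin

context
  fixes a b :: "int \<Rightarrow> 'a \<Rightarrow> side"
  assumes a: "fair_iid M a" and b: "fair_iid M b"
    and ind: "indep_var (PiM UNIV (\<lambda>_. count_space UNIV)) (\<lambda>\<omega> i. a i \<omega>)
                        (PiM UNIV (\<lambda>_. count_space UNIV)) (\<lambda>\<omega> i. b i \<omega>)"
begin

text \<open>The radius \<open>m\<close> is fixed first, with \<open>window_mean F m\<close> less
  than \<epsilon> / 2 above the limit, and only then does \<open>n\<close> grow; the remaining
  \<epsilon> / 2 is the deviation allowed from the window mean.\<close>

lemma upper_fraction_tendsto_0:
  fixes F :: "marked_system \<Rightarrow> real" and C \<epsilon> :: real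
  assumes F: "continuous_on UNIV F" "\<And>x. 0 \<le> F x" "\<And>x. F x \<le> C" and C: "0 < C" and \<epsilon>: "0 < \<epsilon>"
  shows "(\<lambda>n. card {N \<in> meandric_systems n. mark_average F n N >
      expectation (\<lambda>\<omega>. F (mark (noodle (\<lambda>i. a i \<omega>) (\<lambda>i. b i \<omega>)) 0)) + \<epsilon>} / card (meandric_systems n)) \<longlonglongrightarrow> 0"
    (is "(\<lambda>n. card {N \<in> _ n. _ n N > ?c + \<epsilon>} / _ n) \<longlonglongrightarrow> 0")
proof -
  have "\<forall>\<^sub>F m in sequentially. window_mean F m < ?c + \<epsilon> / 2"
    using \<epsilon> by (intro order_tendstoD[OF window_mean_tendsto[OF a b ind F]]) auto
  then obtain m where m: "window_mean F m < ?c + \<epsilon> / 2" by (auto simp: eventually_sequentially)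
  have le: "card {N \<in> meandric_systems n. mark_average F n N > ?c + \<epsilon>} / card (meandric_systems n) \<le>
      card {N \<in> meandric_systems n. mark_average F n N > window_mean F m + \<epsilon> / 2} / card (meandric_systems n)" for n
  proof (rule divide_right_mono)
    have "card {N \<in> meandric_systems n. mark_average F n N > ?c + \<epsilon>} \<le>
        card {N \<in> meandric_systems n. mark_average F n N > window_mean F m + \<epsilon> / 2}"
      using m by (intro card_mono) auto
    then show "real (card {N \<in> meandric_systems n. mark_average F n N > ?c + \<epsilon>}) \<le>
        real (card {N \<in> meandric_systems n. mark_average F n N > window_mean F m + \<epsilon> / 2})" by simp
  qed simp
  show ?thesis
    by (rule tendsto_sandwich[OF _ _ tendsto_const deviating_fraction_tendsto_0[where F = F and C = C and \<epsilon> = "\<epsilon> / 2" and m = m]])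
       (use le \<epsilon> F C in auto)
qed

text \<open>The lower bound is the upper bound for \<^term>\<open>\<lambda>x. C - F x\<close>.\<close>

lemma fraction_tendsto_0:
  fixes F :: "marked_system \<Rightarrow> real" and C \<epsilon> :: real
  assumes F: "continuous_on UNIV F" "\<And>x. 0 \<le> F x" "\<And>x. F x \<le> C" and C: "0 < C" and \<epsilon>: "0 < \<epsilon>"
  defines "c \<equiv> expectation (\<lambda>\<omega>. F (mark (noodle (\<lambda>i. a i \<omega>) (\<lambda>i. b i \<omega>)) 0))"
  shows "(\<lambda>n. card {N \<in> meandric_systems n. \<bar>mark_average F n N - c\<bar> > \<epsilon>} / card (meandric_systems n)) \<longlonglongrightarrow> 0"
proof -
  let ?G = "\<lambda>\<omega>. mark (noodle (\<lambda>i. a i \<omega>) (\<lambda>i. b i \<omega>)) 0"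
  let ?F' = "\<lambda>x. C - F x"
  \<comment> \<open>Integrability is what lets the expectation of the reflected function
    split.\<close>
  have "(\<lambda>\<omega>. F (?G \<omega>)) \<in> borel_measurable M"
    using fair_iid_measurable[OF a] fair_iid_measurable[OF b] F by (rule borel_measurable_noodle)
  then have "integrable M (\<lambda>\<omega>. F (?G \<omega>))"
    using F by (intro integrable_const_bound[of _ C]) auto
  then have c': "expectation (\<lambda>\<omega>. ?F' (?G \<omega>)) = C - c"
    by (simp add: c_def prob_space)
  \<comment> \<open>At \<open>n = 0\<close> both averages are 0 by division by zero, so the identity
    starts at \<open>n = 1\<close>.\<close>
  have avg: "mark_average ?F' n N = C - mark_average F n N" if "n > 0" for n N
    using that by (simp add: mark_average_def sum_subtractf diff_divide_distrib)
  have up: "(\<lambda>n. card {N \<in> meandric_systems n. mark_average F n N > c + \<epsilon>} / card (meandric_systems n)) \<longlonglongrightarrow> 0"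
    unfolding c_def by (rule upper_fraction_tendsto_0[OF F C \<epsilon>])
  have low: "(\<lambda>n. card {N \<in> meandric_systems n. mark_average ?F' n N > C - c + \<epsilon>} / card (meandric_systems n)) \<longlonglongrightarrow> 0"
  proof -
    have "continuous_on UNIV ?F'" by (intro continuous_intros F(1))
    from upper_fraction_tendsto_0[OF this _ _ C \<epsilon>] show ?thesis using F c' by simp
  qed
  let ?p = "\<lambda>n. card {N \<in> meandric_systems n. \<bar>mark_average F n N - c\<bar> > \<epsilon>} / card (meandric_systems n)"
  let ?r = "\<lambda>n. card {N \<in> meandric_systems n. mark_average F n N > c + \<epsilon>} / card (meandric_systems n) +
     card {N \<in> meandric_systems n. mark_average ?F' n N > C - c + \<epsilon>} / card (meandric_systems n)"
  have le: "eventually (\<lambda>n. ?p n \<le> ?r n) sequentially"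
    using eventually_gt_at_top[of 0]
  proof eventually_elim
    case (elim n)
    have "{N \<in> meandric_systems n. \<bar>mark_average F n N - c\<bar> > \<epsilon>} \<subseteq>
        {N \<in> meandric_systems n. mark_average F n N > c + \<epsilon>} \<union>
        {N \<in> meandric_systems n. mark_average ?F' n N > C - c + \<epsilon>}"
      unfolding avg[OF elim] by auto
    then have "card {N \<in> meandric_systems n. \<bar>mark_average F n N - c\<bar> > \<epsilon>} \<le>
        card ({N \<in> meandric_systems n. mark_average F n N > c + \<epsilon>} \<union>
        {N \<in> meandric_systems n. mark_average ?F' n N > C - c + \<epsilon>})"
      by (intro card_mono) auto
    also have "\<dots> \<le> card {N \<in> meandric_systems n. mark_average F n N > c + \<epsilon>} +
        card {N \<in> meandric_systems n. mark_average ?F' n N > C - c + \<epsilon>}" by (rule card_Un_le)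
    finally show ?case
      unfolding add_divide_distrib[symmetric] by (intro divide_right_mono) linarith+
  qed
  have "?r \<longlonglongrightarrow> 0" using tendsto_add[OF up low] by simp
  then show ?thesis by (rule tendsto_sandwich[OF _ le tendsto_const, rotated]) simp
qed

end

end

theorem proposition5:
  fixes P :: "nat \<Rightarrow> 'a measure" and M :: "nat \<Rightarrow> 'a \<Rightarrow> system" and I :: "nat \<Rightarrow> 'a \<Rightarrow> int"
    and Q :: "'b measure" and a b :: "int \<Rightarrow> 'b \<Rightarrow> side"
    and F :: "marked_system \<Rightarrow> real"
  assumes "\<And>n. n \<ge> 1 \<Longrightarrow> prob_space (P n)"
    and "\<And>n. n \<ge> 1 \<Longrightarrow> uniform_rv (P n) (M n) (meandric_systems n)"
    and "\<And>n. n \<ge> 1 \<Longrightarrow> uniform_rv (P n) (I n) {0..<2 * int n}"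
    and "\<And>n. n \<ge> 1 \<Longrightarrow> indep_rvs (P n)
           (count_space (meandric_systems n)) (M n) (count_space {0..<2 * int n}) (I n)"
    and "prob_space Q"
    and "fair_iid Q a" and "fair_iid Q b"
    and "prob_space.indep_var Q
           (PiM UNIV (\<lambda>_. count_space UNIV)) (\<lambda>\<omega> i. a i \<omega>)
           (PiM UNIV (\<lambda>_. count_space UNIV)) (\<lambda>\<omega> i. b i \<omega>)"
    and "continuous_on UNIV F" and "bounded (range F)" and "\<And>x. F x \<ge> 0"
  shows "tendsto_in_prob P
           (\<lambda>n. real_cond_exp (P n)
                  (vimage_algebra (space (P n)) (M n) (count_space (meandric_systems n)))
                  (\<lambda>\<omega>. F (mark (M n \<omega>) (I n \<omega>))))
           (\<integral>\<omega>. F (mark (noodle (\<lambda>i. a i \<omega>) (\<lambda>i. b i \<omega>)) 0) \<partial>Q)"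
proof -
  let ?c = "\<integral>\<omega>. F (mark (noodle (\<lambda>i. a i \<omega>) (\<lambda>i. b i \<omega>)) 0) \<partial>Q"
  let ?E = "\<lambda>n. real_cond_exp (P n) (vimage_algebra (space (P n)) (M n) (count_space (meandric_systems n)))
    (\<lambda>\<omega>. F (mark (M n \<omega>) (I n \<omega>)))"
  obtain B where B: "\<And>x. norm (F x) \<le> B" using assms(10) by (auto simp: bounded_iff)
  \<comment> \<open>The concentration bounds divide by \<open>C\<close>, so it is kept positive even
    when \<open>F\<close> vanishes.\<close>
  define C where "C = max B 1"
  have C: "0 < C" "\<And>x. F x \<le> C"
    using B by (auto simp: C_def le_max_iff_disj intro: order_trans[OF abs_ge_self])
  show ?thesis
    unfolding tendsto_in_prob_def
  proof (intro allI impI)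
    fix \<epsilon> :: real assume \<epsilon>: "0 < \<epsilon>"
    have "(\<lambda>n. card {N \<in> meandric_systems n. \<bar>mark_average F n N - ?c\<bar> > \<epsilon>} / card (meandric_systems n)) \<longlonglongrightarrow> 0"
      by (rule prob_space.fraction_tendsto_0[OF assms(5-9,11) C(2,1) \<epsilon>])
    \<comment> \<open>Nothing is known of \<open>P 0\<close>, so the two sequences are compared from
      \<open>n = 1\<close> on.\<close>
    moreover have "\<forall>\<^sub>F n in sequentially.
        card {N \<in> meandric_systems n. \<bar>mark_average F n N - ?c\<bar> > \<epsilon>} / card (meandric_systems n) =
        measure (P n) {\<omega> \<in> space (P n). \<bar>?E n \<omega> - ?c\<bar> > \<epsilon>}"
      using eventually_ge_at_top[of 1]
    proof eventually_elim
      case (elim n)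
      interpret prob_space "P n" by (rule assms(1)[OF elim])
      note M = assms(2)[OF elim]
      \<comment> \<open>The conditional expectation is identified only up to null sets, which
        suffices for equal probabilities of the two deviation events.\<close>
      have "AE \<omega> in P n. ?E n \<omega> = mark_average F n (M n \<omega>)"
        using real_cond_exp_indep_uniform[OF M _ assms(3)[OF elim] _ assms(4)[OF elim], of "\<lambda>N i. F (mark N i)"]
        by (simp add: mark_average_def)
      then have "AE \<omega> in P n. \<omega> \<in> {\<omega> \<in> space (P n). \<bar>?E n \<omega> - ?c\<bar> > \<epsilon>} \<longleftrightarrow>
          \<omega> \<in> {\<omega> \<in> space (P n). \<bar>mark_average F n (M n \<omega>) - ?c\<bar> > \<epsilon>}"
        by eventually_elim simp
      moreover have "{\<omega> \<in> space (P n). \<bar>?E n \<omega> - ?c\<bar> > \<epsilon>} \<in> sets (P n)" by measurable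
      moreover have "{\<omega> \<in> space (P n). \<bar>mark_average F n (M n \<omega>) - ?c\<bar> > \<epsilon>} \<in> sets (P n)"
        using uniform_rv_sets[OF M, of "{N. \<bar>mark_average F n N - ?c\<bar> > \<epsilon>}"] by simp
      ultimately have "prob {\<omega> \<in> space (P n). \<bar>?E n \<omega> - ?c\<bar> > \<epsilon>} =
          prob {\<omega> \<in> space (P n). \<bar>mark_average F n (M n \<omega>) - ?c\<bar> > \<epsilon>}"
        by (rule finite_measure_eq_AE)
      also have "\<dots> = card {N \<in> meandric_systems n. \<bar>mark_average F n N - ?c\<bar> > \<epsilon>} / card (meandric_systems n)"
        by (rule uniform_rv_fraction[OF M]) simp
      finally show ?case by simp
    qed
    ultimately show "(\<lambda>n. measure (P n) {\<omega> \<in> space (P n). \<bar>?E n \<omega> - ?c\<bar> > \<epsilon>}) \<longlonglongrightarrow> 0"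
      by (rule Lim_transform_eventually)
  qed
qed

end
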